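(* Let $M \in \mathbf{M}_3(\mathbb{C})$ have distinct eigenvalues $\lambda_1,\lambda_2,\lambda_3$ with corresponding normalized (unit) eigenvectors $\mathbf{x}_1,\mathbf{x}_2,\mathbf{x}_3\in\mathbb{C}^3$ satisfying $\langle \mathbf{x}_i,\mathbf{x}_j\rangle \neq 0$ for $1\leq i,j\leq 3$. Then the following are equivalent: (i) $M$ is unitarily equivalent to an analytic truncated Toeplitz operator; (ii) $M$ is unitarily equivalent to a complex symmetric matrix; (iii) the condition $$\det X^*X = (1-|\langle \mathbf{x}_1,\mathbf{x}_2\rangle|^2)(1-|\langle \mathbf{x}_2,\mathbf{x}_3\rangle|^2)(1-|\langle \mathbf{x}_3,\mathbf{x}_1\rangle|^2)$$ holds, where $X=(\mathbf{x}_1|\mathbf{x}_2|\mathbf{x}_3)$ is the matrix having $\mathbf{x}_1,\mathbf{x}_2,\mathbf{x}_3$ as its columns.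
   Context: $\mathbf{M}_3(\mathbb{C})$ is the set of $3\times 3$ complex matrices, acting on $\mathbb{C}^3$ with its standard inner product $\langle\cdot,\cdot\rangle$; $X^*$ is the conjugate transpose of $X$. A matrix $S$ is complex symmetric if $S=S^t$, where $S^t$ is the transpose (no conjugation). $\mathbb{D}$ is the open unit disk, $H^2$ the Hardy space on $\mathbb{D}$ (regarded via boundary values as a closed subspace of $L^2=L^2(\partial\mathbb{D})$), and $H^\infty$ the algebra of bounded analytic functions on $\mathbb{D}$. For a nonconstant inner function $\Theta$, the model space is $\mathcal{K}_\Theta := H^2 \ominus \Theta H^2$, with the inner product inherited from $L^2$, and $P_\Theta$ is the orthogonal projection of $L^2$ onto $\mathcal{K}_\Theta$. An analytic truncated Toeplitz operator is an operator of the form $A_\varphi^\Theta:\mathcal{K}_\Theta\to\mathcal{K}_\Theta$, $A_\varphi^\Theta f := P_\Theta(\varphi f)$, for some nonconstant inner function $\Theta$ and some $\varphi\in H^\infty$. Operators $S$ and $T$ on Hilbert spaces $\mathcal{X}$ and $\mathcal{Y}$ are unitarily equivalent if $US=TU$ for some unitary $U:\mathcal{X}\to\mathcal{Y}$. *)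

theory Defs
  imports "HOL-Complex_Analysis.Complex_Analysis"
begin

section \<open>Operators on complex inner product spaces and unitary equivalence\<close>

text \<open>
  A complex inner product space with explicit operations, so that spaces of column vectors and
  spaces of analytic functions can be compared. All inner products below are linear in the
  first and conjugate-linear in the second argument.
\<close>

record 'a cips =
  cips_carrier :: "'a set"
  cips_add :: "'a \<Rightarrow> 'a \<Rightarrow> 'a"
  cips_scale :: "complex \<Rightarrow> 'a \<Rightarrow> 'a"
  cips_inner :: "'a \<Rightarrow> 'a \<Rightarrow> complex"

definition unitary_map :: "'a cips \<Rightarrow> 'b cips \<Rightarrow> ('a \<Rightarrow> 'b) \<Rightarrow> bool" where
  "unitary_map V W U \<longleftrightarrow>
     U ` cips_carrier V = cips_carrier W \<and>
     (\<forall>x\<in>cips_carrier V. \<forall>y\<in>cips_carrier V.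
        U (cips_add V x y) = cips_add W (U x) (U y)) \<and>
     (\<forall>c. \<forall>x\<in>cips_carrier V. U (cips_scale V c x) = cips_scale W c (U x)) \<and>
     (\<forall>x\<in>cips_carrier V. \<forall>y\<in>cips_carrier V.
        cips_inner W (U x) (U y) = cips_inner V x y)"

definition unitarily_equivalent ::
  "'a cips \<Rightarrow> ('a \<Rightarrow> 'a) \<Rightarrow> 'b cips \<Rightarrow> ('b \<Rightarrow> 'b) \<Rightarrow> bool" where
  "unitarily_equivalent V S W T \<longleftrightarrow>
     (\<exists>U. unitary_map V W U \<and> (\<forall>x\<in>cips_carrier V. U (S x) = T (U x)))"

section \<open>Complex column vectors and matrices\<close>

text \<open>The library's \<open>inner\<close> on \<^typ>\<open>complex ^ 'n\<close> is real-valued, hence the following.\<close>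

definition cvec_inner :: "complex ^ 'n::finite \<Rightarrow> complex ^ 'n \<Rightarrow> complex" where
  "cvec_inner x y = (\<Sum>i\<in>UNIV. x $ i * cnj (y $ i))"

definition cvec_space :: "(complex ^ 'n::finite) cips" where
  "cvec_space = \<lparr> cips_carrier = UNIV, cips_add = (+), cips_scale = (*s),
     cips_inner = cvec_inner \<rparr>"

definition conj_transpose :: "complex ^ 'n ^ 'm \<Rightarrow> complex ^ 'm ^ 'n" where
  "conj_transpose A = (\<chi> i j. cnj (A $ j $ i))"

definition complex_symmetric :: "complex ^ 'n ^ 'n \<Rightarrow> bool" where
  "complex_symmetric S \<longleftrightarrow> transpose S = S"

section \<open>Hardy spaces on the unit disk\<close>

definition boundary_value :: "(complex \<Rightarrow> complex) \<Rightarrow> complex \<Rightarrow> complex" where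
  "boundary_value f \<zeta> = Lim (at_left 1) (\<lambda>r::real. f (of_real r * \<zeta>))"

text \<open>
  Functions on the unit circle are functions on \<^typ>\<open>complex\<close> of which only the values
  \<open>F (cis t)\<close> matter; the circle carries normalized Lebesgue measure.
\<close>

definition circle_inner :: "(complex \<Rightarrow> complex) \<Rightarrow> (complex \<Rightarrow> complex) \<Rightarrow> complex" where
  "circle_inner F G =
     (LINT t|lebesgue_on {0..2 * pi}. F (cis t) * cnj (G (cis t))) / of_real (2 * pi)"

text \<open>
  Elements of \<open>H\<^sup>2\<close> are normalized to vanish off the open disk, so that analytic functions on
  the disk have unique representatives and equality in \<open>H\<^sup>2\<close> is equality of HOL functions.
\<close>

definition hardy2 :: "(complex \<Rightarrow> complex) set" where
  "hardy2 = {f. f holomorphic_on ball 0 1 \<and> (\<forall>z. z \<notin> ball 0 1 \<longrightarrow> f z = 0) \<and>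
     (\<exists>C. \<forall>r\<in>{0..<1::real}.
        (LINT t|lebesgue_on {0..2 * pi}. (norm (f (of_real r * cis t)))\<^sup>2) / (2 * pi) \<le> C)}"

definition hardy_inf :: "(complex \<Rightarrow> complex) set" where
  "hardy_inf = {f. f holomorphic_on ball 0 1 \<and> bounded (f ` ball 0 1)}"

definition inner_function :: "(complex \<Rightarrow> complex) \<Rightarrow> bool" where
  "inner_function \<Theta> \<longleftrightarrow> \<Theta> \<in> hardy_inf \<and>
     (AE t in lebesgue_on {0..2 * pi}. norm (boundary_value \<Theta> (cis t)) = 1)"

section \<open>Model spaces and truncated Toeplitz operators\<close>

definition hardy2_inner :: "(complex \<Rightarrow> complex) \<Rightarrow> (complex \<Rightarrow> complex) \<Rightarrow> complex" where
  "hardy2_inner f g = circle_inner (boundary_value f) (boundary_value g)"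

definition model_carrier :: "(complex \<Rightarrow> complex) \<Rightarrow> (complex \<Rightarrow> complex) set" where
  "model_carrier \<Theta> = {f \<in> hardy2. \<forall>h\<in>hardy2. hardy2_inner f (\<lambda>z. \<Theta> z * h z) = 0}"

definition model_space :: "(complex \<Rightarrow> complex) \<Rightarrow> (complex \<Rightarrow> complex) cips" where
  "model_space \<Theta> = \<lparr> cips_carrier = model_carrier \<Theta>,
     cips_add = (\<lambda>f g z. f z + g z), cips_scale = (\<lambda>c f z. c * f z),
     cips_inner = hardy2_inner \<rparr>"

text \<open>
  The orthogonal projection of a square-integrable function \<open>F\<close> on the circle: the unique
  element of the model space whose boundary function differs from \<open>F\<close> by something orthogonal to
  the (boundary functions of the) model space.
\<close>

definition model_proj ::
  "(complex \<Rightarrow> complex) \<Rightarrow> (complex \<Rightarrow> complex) \<Rightarrow> (complex \<Rightarrow> complex)" where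
  "model_proj \<Theta> F = (THE k. k \<in> model_carrier \<Theta> \<and>
     (\<forall>g\<in>model_carrier \<Theta>.
        circle_inner (\<lambda>\<zeta>. F \<zeta> - boundary_value k \<zeta>) (boundary_value g) = 0))"

definition truncated_toeplitz ::
  "(complex \<Rightarrow> complex) \<Rightarrow> (complex \<Rightarrow> complex) \<Rightarrow> (complex \<Rightarrow> complex) \<Rightarrow> (complex \<Rightarrow> complex)"
where
  "truncated_toeplitz \<Theta> \<phi> f =
     model_proj \<Theta> (\<lambda>\<zeta>. boundary_value \<phi> \<zeta> * boundary_value f \<zeta>)"

definition ue_analytic_tto :: "complex ^ 'n ^ 'n::finite \<Rightarrow> bool" where
  "ue_analytic_tto M \<longleftrightarrow>
     (\<exists>\<Theta> \<phi>. inner_function \<Theta> \<and> \<not> \<Theta> constant_on ball 0 1 \<and> \<phi> \<in> hardy_inf \<and>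
        unitarily_equivalent cvec_space ((*v) M) (model_space \<Theta>) (truncated_toeplitz \<Theta> \<phi>))"

definition ue_complex_symmetric :: "complex ^ 'n ^ 'n::finite \<Rightarrow> bool" where
  "ue_complex_symmetric M \<longleftrightarrow>
     (\<exists>S :: complex ^ 'n ^ 'n. complex_symmetric S \<and>
        unitarily_equivalent cvec_space ((*v) M) cvec_space ((*v) S))"

end

theory Submission
  imports Defs
begin

text \<open>
  Let \<open>y 1, y 2, y 3\<close> be the basis dual to the eigenvectors \<open>x i\<close>, so that the \<open>y i\<close> are eigenvectors
  of \<open>M\<^sup>*\<close>, and let \<open>G\<close> and \<open>H\<close> be the Gram matrices of \<open>x\<close> and \<open>y\<close>; they are inverse to each
  other. Jacobi's identity for complementary minors turns (iii) into
  \<open>|H 1 2|\<^sup>2 = |G 1 2|\<^sup>2 * H 1 1 * H 2 2\<close>, and by symmetry into its two cyclic variants.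

  If \<open>S = S\<^sup>t\<close>, the eigenvectors of \<open>S\<^sup>*\<close> are the entrywise conjugates of those of \<open>S\<close>; hence (ii)
  makes \<open>H\<close> a diagonal rescaling of the conjugate of \<open>G\<close>. Conversely such a rescaling yields an
  antiunitary involution \<open>J\<close> with \<open>J M J = M\<^sup>*\<close>, and \<open>M\<close> is symmetric in an orthonormal basis fixed
  by \<open>J\<close>.

  For an analytic truncated Toeplitz operator on a finite-dimensional model space, the co-analytic
  Toeplitz operator and the backward shift leave the model space invariant and commute. So the simple
  eigenvectors of the adjoint are eigenvectors of the backward shift, i.e. multiples of Szego
  kernels \<open>1 / (1 - \<mu> z)\<close>, and \<open>H i j = c i * cnj (c j) / (1 - \<mu> i * cnj (\<mu> j))\<close>. Conversely, such
  a factorization of \<open>H\<close> gives \<open>M\<close> as a truncated Toeplitz operator for the Blaschke product with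
  zeros \<open>cnj (\<mu> i)\<close> and an interpolating polynomial symbol. A factorization with \<open>\<mu> 3 = 0\<close> exists
  exactly if a certain two-by-two matrix has rank one, which again is (iii).

  Boundary values are handled by Fatou's theorem on radial limits of \<open>H\<^sup>2\<close> functions: the antiderivative of
  \<open>f\<close> is absolutely continuous on the circle, and the radial limit of \<open>f\<close> exists wherever it is
  differentiable.
\<close>

section \<open>Radial limits of derivatives\<close>

text \<open>The analytic obstacle lies in the definitions: inner products, inner functions and the
  projection are all expressed through radial limits, so nothing about model spaces can be computed
  before these limits are known to exist almost everywhere. Once Parseval's identity holds for
  boundary values, \<open>hardy2\<close> is a space of square-summable sequences, and most of the
  rest is linear algebra.

  The normalization \<open>\<mu> 3 = 0\<close> costs no generality: a disk automorphism applied to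
  all \<open>\<mu> i\<close> multiplies \<open>1 / (1 - \<mu> i * cnj (\<mu> j))\<close> by a factor
  \<open>f i * cnj (f j)\<close>, which the \<open>c i\<close> absorb. It forces \<open>\<mu> i *
  cnj (\<mu> j) = 1 - H i 3 * H 3 j / (H 3 3 * H i j)\<close>, and for i, j in {1, 2} this is the
  matrix of rank one.

  For complex symmetry the moduli in Jacobi's identity do not suffice, since a diagonal rescaling
  must also match arguments. Up to rescaling, the only free argument is that of the cyclic product
  of three entries; one more polynomial identity shows that (iii) fixes it.\<close>

text \<open>Up to the factor \<open>-2 * r\<close> the real kernel is the angular derivative of the
  Poisson kernel. It arises from Cauchy's formula for the derivative by subtracting a vanishing
  integral, whose denominator \<open>1 - r * u\<close> has no zero in the closed disk.\<close>

lemma derivative_kernel_circle: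
  fixes G :: "complex \<Rightarrow> complex" and r :: real
  assumes cont: "continuous_on (cball 0 1) G" and hol: "G holomorphic_on ball 0 1"
    and r: "0 \<le> r" "r < 1"
  shows "((\<lambda>s. - \<i> * G (cis s) * of_real (sin s * ((1 - r\<^sup>2) / norm (1 - r * cis s) ^ 4)))
     has_integral of_real pi * deriv G r) {0..2 * pi}"
proof -
  have n: "norm (of_real r :: complex) < 1" using r by simp
  have nz1: "1 \<noteq> r * u" if "norm u \<le> 1" for u :: complex
  proof
    assume "1 = r * u"
    then have "norm (of_real r * u) = 1" by (metis norm_one)
    moreover have "norm (of_real r * u) \<le> r * 1" 
      unfolding norm_mult using r that by (intro mult_mono) auto
    ultimately show False using r by simp
  qed
  have "((\<lambda>u. G u / (u - r)\<^sup>2) has_contour_integral 2 * of_real pi * \<i> * deriv G r) (circlepath 0 1)"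
  proof -
    have rb: "of_real r \<in> ball (0::complex) 1" using n by simp
    note * = Cauchy_derivative_integral_circlepath[OF cont hol rb]
    have "deriv G r = (1 / (2 * of_real pi * \<i>) * contour_integral(circlepath 0 1) (\<lambda>u. G u / (u-r)^2))"
      by (rule DERIV_imp_deriv[OF *(2)])
    then have "contour_integral(circlepath 0 1) (\<lambda>u. G u / (u-r)^2) = 2 * of_real pi * \<i> * deriv G r"
      by (simp add: field_simps)
    then show ?thesis using has_contour_integral_integral[OF *(1)] by simp
  qed
  then have 1: "((\<lambda>s. G (cis s) / (cis s - r)\<^sup>2 * \<i> * cis s) has_integral 2 * of_real pi * \<i> * deriv G r) {0..2*pi}"
    unfolding circlepath_def by (subst (asm) has_contour_integral_part_circlepath_iff) (auto simp: mult_ac)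
  \<comment> \<open>Cauchy's formula at the centre 0, where the factor u makes the value
    zero.\<close>
  have "((\<lambda>u. (u * G u / (1 - r * u)\<^sup>2) / (u - 0)) has_contour_integral 
      2 * of_real pi * \<i> * (0 * G 0 / (1 - of_real r * 0)\<^sup>2)) (circlepath 0 1)"
    by (rule Cauchy_integral_circlepath)
      (auto intro!: continuous_intros holomorphic_intros cont hol simp: nz1[symmetric])
  then have 2: "((\<lambda>s. G (cis s) / (1 - r * cis s)\<^sup>2 * \<i> * cis s) has_integral 0) {0..2*pi}"
    unfolding circlepath_def by (subst (asm) has_contour_integral_part_circlepath_iff) (auto simp: mult_ac)
  \<comment> \<open>On the circle the kernels \<open>u / (u - r)^2\<close> and
    \<open>u / (1 - r * u)^2\<close> are conjugate to each other, so their difference is purely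
    imaginary; this leaves a real weight.\<close>
  have eq: "(1/(2 * \<i>)) * (G u / (u - r)\<^sup>2 * \<i> * u - G u / (1 - r * u)\<^sup>2 * \<i> * u)
      = - \<i> * G u * of_real (Im u * ((1 - r\<^sup>2) / norm (1 - r * u) ^ 4))" if u: "norm u = 1" for u :: complex
  proof -
    have uc: "u * cnj u = 1" using u by (simp add: complex_norm_square[symmetric])
    have u0: "u \<noteq> 0" using u by auto
    have "(u - r) = u * (cnj (1 - r * u))" using uc by (simp add: algebra_simps)
    then have "u / (u - r)\<^sup>2 = u / (u * cnj (1 - r * u))\<^sup>2" by (rule arg_cong)
    also have "\<dots> = inverse u / (cnj (1 - r * u))\<^sup>2"
      using u0 by (simp add: power_mult_distrib power2_eq_square divide_inverse)
    also have "inverse u = cnj u" using uc u0 by (metis inverse_unique)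
    finally have a: "u / (u - r)\<^sup>2 = cnj u / (cnj (1 - r * u))\<^sup>2" .
    define w where "w = 1 - r * u"
    have w0: "w \<noteq> 0" using nz1[of u] u by (simp add: w_def)
    have nw: "of_real (norm w ^ 4) = w\<^sup>2 * (cnj w)\<^sup>2"
    proof -
      have "of_real (norm w ^ 4) = ((of_real (norm w) :: complex) ^ 2) ^ 2" by (simp flip: power_mult)
      also have "\<dots> = w\<^sup>2 * (cnj w)\<^sup>2" using complex_norm_square[of w] by (simp add: power_mult_distrib)
      finally show ?thesis .
    qed
    have im: "2 * \<i> * of_real (Im u) = u - cnj u" by (simp add: complex_eq_iff)
    have "cnj u * w\<^sup>2 - u * (cnj w)\<^sup>2 = (cnj u - u) * (1 - r\<^sup>2 * (u * cnj u))"
      unfolding w_def by (simp add: algebra_simps power2_eq_square)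
    also have "\<dots> = - (2 * \<i> * of_real (Im u)) * (1 - r\<^sup>2)"
      unfolding im uc by simp
    finally have b: "cnj u * w\<^sup>2 - u * (cnj w)\<^sup>2 = - (2 * \<i> * of_real (Im u)) * (1 - r\<^sup>2)" .
    have "cnj u / (cnj w)\<^sup>2 - u / w\<^sup>2 = (cnj u * w\<^sup>2 - u * (cnj w)\<^sup>2) / (of_real (norm w ^ 4))"
      unfolding nw using w0 by (simp add: divide_simps)
    then have c: "u / (u - r)\<^sup>2 - u / w\<^sup>2 = - (2 * \<i> * of_real (Im u)) * (1 - r\<^sup>2) / (of_real (norm w ^ 4))"
      unfolding b a w_def[symmetric] .
    have "(1/(2 * \<i>)) * (G u / (u - r)\<^sup>2 * \<i> * u - G u / w\<^sup>2 * \<i> * u) = 1/2 * G u * (u / (u - r)\<^sup>2 - u / w\<^sup>2)"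
      by (simp add: field_simps)
    also have "\<dots> = - \<i> * G u * of_real (Im u * ((1 - r\<^sup>2) / norm w ^ 4))"
      unfolding c by simp
    finally show ?thesis unfolding w_def .
  qed
  have A: "((\<lambda>s. (1/(2 * \<i>)) * (G (cis s) / (cis s - r)\<^sup>2 * \<i> * cis s - G (cis s) / (1 - r * cis s)\<^sup>2 * \<i> * cis s))
    has_integral (1/(2 * \<i>)) * (2 * of_real pi * \<i> * deriv G r - 0)) {0..2*pi}"
    by (intro has_integral_mult_right has_integral_diff 1 2)
  have B: "(1/(2 * \<i>)) * (2 * of_real pi * \<i> * deriv G r - 0) = of_real pi * deriv G r"
    by (simp add: mult.left_commute[of \<i> "of_real pi"])
  show ?thesis
    using A unfolding eq[OF norm_cis] B cis.sel .
qed

text \<open>The kernel formula for the identity map, whose derivative is 1. Taking real parts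
  supplies a second factor \<open>sin s\<close>, hence a nonnegative integrand whose mass does not
  depend on r.\<close>

lemma poisson_kernel_moment:
  assumes r: "0 \<le> r" "r < (1::real)"
  shows "((\<lambda>s. (sin s)\<^sup>2 * ((1 - r\<^sup>2) / norm (1 - r * cis s) ^ 4)) has_integral pi) {0..2 * pi}"
proof -
  have "((\<lambda>s. - \<i> * cis s * of_real (sin s * ((1 - r\<^sup>2) / norm (1 - r * cis s) ^ 4)))
     has_integral of_real pi * deriv (\<lambda>z. z) (of_real r)) {0..2 * pi}"
    by (rule derivative_kernel_circle) (use r in \<open>auto intro: continuous_intros holomorphic_intros\<close>)
  then have "((\<lambda>s. Re (- \<i> * cis s * of_real (sin s * ((1 - r\<^sup>2) / norm (1 - r * cis s) ^ 4))))
     has_integral Re pi) {0..2 * pi}"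
    by (intro has_integral_Re) simp
  moreover have "Re (- \<i> * cis s * of_real (sin s * ((1 - r\<^sup>2) / norm (1 - r * cis s) ^ 4))) = 
    (sin s)\<^sup>2 * ((1 - r\<^sup>2) / norm (1 - r * cis s) ^ 4)" for s
    by (simp add: power2_eq_square)
  ultimately show ?thesis by (simp only: Re_complex_of_real)
qed

text \<open>Near 1 the smallness of G supplies the second factor \<open>sin s\<close>, and
  \<open>poisson_kernel_moment\<close> bounds the integral uniformly in r; away from 1 the kernel
  itself is of order \<open>1 - r^2\<close>.\<close>

lemma radial_derivative_tendsto_zero:
  fixes G :: "complex \<Rightarrow> complex"
  assumes cont: "continuous_on (cball 0 1) G" and hol: "G holomorphic_on ball 0 1"
    and small: "\<And>\<epsilon>. \<epsilon> > 0 \<Longrightarrow> \<exists>\<eta>>0. \<forall>u. norm u = 1 \<and> norm (u - 1) < \<eta> \<longrightarrow> norm (G u) \<le> \<epsilon> * norm (u - 1)"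
  shows "((\<lambda>r. deriv G (of_real r)) \<longlongrightarrow> 0) (at_left 1)"
proof (rule tendstoI)
  fix e :: real assume e: "e > 0"
  have "compact (G ` cball 0 1)" using cont by (intro compact_continuous_image) auto
  then obtain M where M: "M > 0" "\<And>u. norm u \<le> 1 \<Longrightarrow> norm (G u) \<le> M"
    by (auto simp: bounded_pos dest!: compact_imp_bounded)
  obtain \<eta>0 where \<eta>0: "\<eta>0 > 0" "\<And>u. norm u = 1 \<Longrightarrow> norm (u - 1) < \<eta>0 \<Longrightarrow> norm (G u) \<le> e / 4 * norm (u - 1)"
    using small[of "e/4"] e by auto
  define \<eta> where "\<eta> = min \<eta>0 1"
  have \<eta>: "\<eta> > 0" "\<eta> \<le> 1" "\<eta> \<le> \<eta>0" using \<eta>0 by (auto simp: \<eta>_def)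
  have bound: "norm (deriv G (of_real r)) \<le> e / 2 + 2 * M * (1 - r\<^sup>2) * (2 / \<eta>) ^ 4" if r: "0 \<le> r" "r < 1" for r :: real
  proof -
    define P where "P = (\<lambda>s. (1 - r\<^sup>2) / norm (1 - r * cis s) ^ 4)"
    have r2: "0 \<le> 1 - r\<^sup>2" using r by (simp add: power_le_one)
    have P0: "P s \<ge> 0" for s unfolding P_def using r2 by simp
    have pw: "norm (- \<i> * G (cis s) * of_real (sin s * P s)) \<le> e / 2 * ((sin s)\<^sup>2 * P s) + M * (1 - r\<^sup>2) * (2 / \<eta>) ^ 4" for s
    proof (cases "norm (cis s - 1) < \<eta>")
      case True
      have n2: "(norm (cis s - 1))\<^sup>2 = 2 * (1 - cos s)"
      proof -
        have "(norm (cis s - 1))\<^sup>2 = (cos s - 1)\<^sup>2 + (sin s)\<^sup>2" by (simp add: cmod_power2)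
        then show ?thesis using sin_cos_squared_add[of s] by (simp add: power2_eq_square algebra_simps)
      qed
      \<comment> \<open>Within distance 1 of the point 1 one has \<open>cos s \<ge> 1/2\<close>, so
        the chord is at most \<open>2 * \<bar>sin s\<bar>\<close>.\<close>
      have "2 * (1 - cos s) \<le> 1" using True \<eta> n2
        by (metis abs_norm_cancel abs_square_le_1 less_eq_real_def order.trans)
      then have "(1 - cos s) \<le> 2 * (sin s)\<^sup>2"
      proof -
        assume "2 * (1 - cos s) \<le> 1"
        then have "(1 - cos s) * 1 \<le> (1 - cos s) * (2 * (1 + cos s))" by (intro mult_left_mono) auto
        also have "\<dots> = 2 * (sin s)\<^sup>2" unfolding sin_squared_eq by (simp add: power2_eq_square algebra_simps)
        finally show ?thesis by simp
      qed
      then have "(norm (cis s - 1))\<^sup>2 \<le> (2 * \<bar>sin s\<bar>)\<^sup>2" using n2 by (simp add: power_mult_distrib)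
      then have le: "norm (cis s - 1) \<le> 2 * \<bar>sin s\<bar>" by (rule power2_le_imp_le) simp
      have "norm (G (cis s)) \<le> e / 4 * norm (cis s - 1)" using \<eta>0(2)[of "cis s"] True \<eta> by simp
      also have "\<dots> \<le> e / 4 * (2 * \<bar>sin s\<bar>)" using le e by (intro mult_left_mono) auto
      finally have "norm (G (cis s)) * (\<bar>sin s\<bar> * P s) \<le> e / 4 * (2 * \<bar>sin s\<bar>) * (\<bar>sin s\<bar> * P s)"
        using P0 by (intro mult_right_mono) auto
      also have "\<dots> = e / 2 * ((sin s)\<^sup>2 * P s)" by (simp add: power2_eq_square)
      also have "\<dots> \<le> e / 2 * ((sin s)\<^sup>2 * P s) + M * (1 - r\<^sup>2) * (2 / \<eta>) ^ 4" using M r2 \<eta> by simp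
      finally show ?thesis using P0 by (simp add: norm_mult abs_mult)
    next
      case False
      have "norm (cis s - 1) \<le> norm (1 - r * cis s) + norm ((1 - r) * cis s)"
        using norm_triangle_ineq4[of "(1 - r) * cis s" "1 - r * cis s"] by (simp add: algebra_simps)
      also have "norm ((1 - r) * cis s) = 1 - r" using r by (simp add: norm_mult del: of_real_diff)
      also have "1 - r \<le> norm (1 - r * cis s)"
        using norm_triangle_ineq2[of 1 "r * cis s"] r by (simp add: norm_mult)
      finally have "\<eta> / 2 \<le> norm (1 - r * cis s)" using False by simp
      then have "(\<eta> / 2) ^ 4 \<le> norm (1 - r * cis s) ^ 4" using \<eta> by (intro power_mono) auto
      then have "P s \<le> (1 - r\<^sup>2) / (\<eta> / 2) ^ 4" unfolding P_def using r2 \<eta>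
        by (intro divide_left_mono) (auto intro!: mult_pos_pos zero_less_power simp del: zero_less_norm_iff)
      also have "\<dots> = (1 - r\<^sup>2) * (2 / \<eta>) ^ 4" using \<eta> by (simp add: field_simps)
      finally have Pl: "P s \<le> (1 - r\<^sup>2) * (2 / \<eta>) ^ 4" .
      have "norm (G (cis s)) * (\<bar>sin s\<bar> * P s) \<le> M * (1 * ((1 - r\<^sup>2) * (2 / \<eta>) ^ 4))"
        using Pl P0 M r2 by (intro mult_mono) auto
      also have "\<dots> \<le> e / 2 * ((sin s)\<^sup>2 * P s) + M * (1 - r\<^sup>2) * (2 / \<eta>) ^ 4" using e P0 by simp
      finally show ?thesis using P0 by (simp add: norm_mult abs_mult)
    qed
    have i1: "((\<lambda>s. - \<i> * G (cis s) * of_real (sin s * P s)) has_integral of_real pi * deriv G r) {0..2 * pi}"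
      unfolding P_def by (rule derivative_kernel_circle[OF cont hol r])
    have i2: "((\<lambda>s. e / 2 * ((sin s)\<^sup>2 * P s) + M * (1 - r\<^sup>2) * (2 / \<eta>) ^ 4) has_integral 
       (e / 2 * pi + (2 * pi - 0) *\<^sub>R (M * (1 - r\<^sup>2) * (2 / \<eta>) ^ 4))) {0..2*pi}"
      unfolding P_def by (intro has_integral_add has_integral_mult_right poisson_kernel_moment[OF r] has_integral_const_real[of _ 0 "2*pi", simplified]) 
         (use has_integral_const_real[of "M * (1 - r\<^sup>2) * (2 / \<eta>) ^ 4" 0 "2*pi"] in simp)
    have "norm (of_real pi * deriv G r) \<le> e / 2 * pi + (2 * pi - 0) *\<^sub>R (M * (1 - r\<^sup>2) * (2 / \<eta>) ^ 4)"
      using integral_norm_bound_integral[OF has_integral_integrable[OF i1] has_integral_integrable[OF i2] pw]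
      unfolding integral_unique[OF i1] integral_unique[OF i2] .
    then have "pi * norm (deriv G r) \<le> pi * (e / 2 + 2 * M * (1 - r\<^sup>2) * (2 / \<eta>) ^ 4)"
      by (simp add: norm_mult algebra_simps)
    then show ?thesis by simp
  qed
  have "((\<lambda>r::real. e / 2 + 2 * M * (1 - r\<^sup>2) * (2 / \<eta>) ^ 4) \<longlongrightarrow> e / 2 + 2 * M * (1 - 1\<^sup>2) * (2 / \<eta>) ^ 4) (at_left 1)"
    by (intro tendsto_intros)
  then have "\<forall>\<^sub>F r in at_left 1. e / 2 + 2 * M * (1 - r\<^sup>2) * (2 / \<eta>) ^ 4 < e"
    by (rule order_tendstoD) (use e in simp)
  moreover have "\<forall>\<^sub>F r::real in at_left 1. 0 < r \<and> r < 1"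
    using eventually_at_left_real[of 0 "1::real"] by simp
  ultimately show "\<forall>\<^sub>F r in at_left 1. dist (deriv G (of_real r)) 0 < e"
    
  proof eventually_elim
    case (elim r)
    then show ?case using bound[of r] by simp
  qed
qed

text \<open>Rotating \<zeta> to 1 and subtracting the first-order Taylor polynomial reduces this to
  \<open>radial_derivative_tendsto_zero\<close>. Differentiability along the circle alone controls
  the complex derivative along the radius.\<close>

lemma fatou_radial_limit:
  fixes G g :: "complex \<Rightarrow> complex"
  assumes cont: "continuous_on (cball 0 1) G"
    and der: "\<And>z. norm z < 1 \<Longrightarrow> (G has_field_derivative g z) (at z)"
    and z: "norm \<zeta> = 1"
    and small: "\<And>\<epsilon>. \<epsilon> > 0 \<Longrightarrow> \<exists>\<eta>>0. \<forall>u. norm u = 1 \<and> norm (u - 1) < \<eta> \<longrightarrow>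
       norm (G (\<zeta> * u) - G \<zeta> - c * \<zeta> * (u - 1)) \<le> \<epsilon> * norm (u - 1)"
  shows "((\<lambda>r. g (of_real r * \<zeta>)) \<longlongrightarrow> c) (at_left 1)"
proof -
  have \<zeta>0: "\<zeta> \<noteq> 0" using z by force
  define H where "H = (\<lambda>u. G (\<zeta> * u) - G \<zeta> - c * \<zeta> * (u - 1))"
  have H': "(H has_field_derivative (g (\<zeta> * u) - c) * \<zeta>) (at u)" if "norm u < 1" for u
  proof -
    have "((\<lambda>u. G (\<zeta> * u)) has_field_derivative g (\<zeta> * u) * \<zeta>) (at u)"
      by (rule DERIV_chain2[OF der DERIV_cmult_Id]) (use that z in \<open>simp add: norm_mult\<close>)
    then have "(H has_field_derivative (g (\<zeta> * u) * \<zeta> - 0 - c * \<zeta> * (1 - 0))) (at u)"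
      unfolding H_def by (intro DERIV_diff DERIV_cmult DERIV_const DERIV_ident)
    then show ?thesis by (simp add: algebra_simps)
  qed
  have "((\<lambda>r. deriv H (of_real r)) \<longlongrightarrow> 0) (at_left 1)"
  proof (rule radial_derivative_tendsto_zero)
    show "continuous_on (cball 0 1) H" unfolding H_def
      by (intro continuous_intros continuous_on_compose2[OF cont]) (use z in \<open>auto simp: norm_mult\<close>)
    show "H holomorphic_on ball 0 1"
      using H' by (subst holomorphic_on_open) (auto simp: Ball_def)
  qed (use small in \<open>simp add: H_def\<close>)
  moreover have "\<forall>\<^sub>F r::real in at_left 1. 0 < r \<and> r < 1"
    using eventually_at_left_real[of 0 "1::real"] by simp
  then have "\<forall>\<^sub>F r in at_left 1. deriv H (of_real r) = (g (of_real r * \<zeta>) - c) * \<zeta>"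
  proof eventually_elim
    case (elim r)
    then show ?case using DERIV_imp_deriv[OF H'[of "of_real r"]] by (simp add: mult.commute)
  qed
  ultimately have "((\<lambda>r::real. (g (of_real r * \<zeta>) - c) * \<zeta>) \<longlongrightarrow> 0) (at_left 1)"
    by (rule Lim_transform_eventually)
  then have "((\<lambda>r::real. (g (of_real r * \<zeta>) - c) * \<zeta> / \<zeta> + c) \<longlongrightarrow> 0 / \<zeta> + c) (at_left 1)"
    by (intro tendsto_intros \<zeta>0)
  moreover have "(\<lambda>r::real. (g (of_real r * \<zeta>) - c) * \<zeta> / \<zeta> + c) = (\<lambda>r. g (of_real r * \<zeta>))"
    using nonzero_mult_div_cancel_right[OF \<zeta>0] by simp
  ultimately show ?thesis by simp
qed

section \<open>Square-summable Fourier series on the circle\<close>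

abbreviation circ :: "real measure" where "circ \<equiv> lebesgue_on {0..2 * pi}"

lemma integrable_circ_continuous [intro]:
  fixes h :: "real \<Rightarrow> 'b::euclidean_space"
  shows "continuous_on {0..2 * pi} h \<Longrightarrow> integrable circ h"
  by (rule continuous_imp_integrable_real)

lemma finite_measure_circ: "finite_measure circ"
  by (auto intro!: finite_measureI simp: emeasure_restrict_space)

lemma measure_circ: "measure circ (space circ) = 2 * pi"
  by (simp add: measure_restrict_space)

lemma complete_measure_lebesgue_on:
  assumes "S \<in> sets lebesgue" shows "complete_measure (lebesgue_on S)"
proof
  fix A B assume "B \<subseteq> A" "A \<in> null_sets (lebesgue_on S)"
  then have "B \<subseteq> S" "B \<in> null_sets lebesgue"
    using assms by (auto simp: null_sets_restrict_space intro: completion.complete2)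
  then show "B \<in> sets (lebesgue_on S)"
    using assms by (auto simp: sets_restrict_space_iff)
qed

text \<open>Completeness of Lebesgue measure. \<open>boundary_value\<close> is unspecified where the
  radial limit fails to exist, so its measurability is taken over from an almost everywhere equal
  function.\<close>

lemma borel_measurable_lebesgue_on_AE:
  fixes f g :: "'a::euclidean_space \<Rightarrow> 'b::topological_space"
  assumes S: "S \<in> sets lebesgue" and f: "f \<in> borel_measurable (lebesgue_on S)"
    and ae: "AE x in lebesgue_on S. f x = g x"
  shows "g \<in> borel_measurable (lebesgue_on S)"
proof (rule measurableI)
  fix A :: "'b set" assume A: "A \<in> sets borel"
  show "g -` A \<inter> space (lebesgue_on S) \<in> sets (lebesgue_on S)"
  proof (rule complete_measure.in_sets_AE[OF complete_measure_lebesgue_on[OF S]])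
    show "AE x in lebesgue_on S. x \<in> f -` A \<inter> space (lebesgue_on S) \<longleftrightarrow> x \<in> g -` A \<inter> space (lebesgue_on S)"
      using ae by eventually_elim auto
    show "f -` A \<inter> space (lebesgue_on S) \<in> sets (lebesgue_on S)"
      using f A by (rule measurable_sets)
  qed auto
qed auto

lemma integral_circ_cis: "(LINT t|circ. cis (of_int k * t)) = (if k = 0 then of_real (2 * pi) else 0)"
proof (cases "k = 0")
  case True
  then show ?thesis using measure_circ by (simp add: scaleR_conv_of_real)
next
  case False
  have "((\<lambda>t. cis (of_int k * t)) has_integral
     (cis (of_int k * (2 * pi)) / (\<i> * of_int k) - cis (of_int k * 0) / (\<i> * of_int k))) {0..2 * pi}"
  proof (rule fundamental_theorem_of_calculus)
    fix t :: real
    have "((\<lambda>t. cis (of_int k * t)) has_vector_derivative (of_int k * (\<i> * cis (of_int k * t)))) (at t within {0..2 * pi})"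
      unfolding cis_conv_exp
      by (auto intro!: derivative_eq_intros has_vector_derivative_real_field simp: algebra_simps)
    then have "((\<lambda>t. cis (of_int k * t) / (\<i> * of_int k)) has_vector_derivative (of_int k * (\<i> * cis (of_int k * t))) / (\<i> * of_int k)) (at t within {0..2 * pi})"
      by (rule has_vector_derivative_divide)
    then show "((\<lambda>t. cis (of_int k * t) / (\<i> * of_int k)) has_vector_derivative cis (of_int k * t)) (at t within {0..2 * pi})"
      using False by simp
  qed simp
  moreover have "cis (of_int k * (2 * pi)) = 1" by (metis cis_multiple_2pi Ints_of_int mult.commute)
  ultimately have "((\<lambda>t. cis (of_int k * t)) has_integral 0) {0..2 * pi}" by simp
  moreover have "integrable circ (\<lambda>t. cis (of_int k * t))" by (intro integrable_circ_continuous continuous_intros)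
  ultimately show ?thesis using False by (simp add: lebesgue_integral_eq_integral integral_unique)
qed

lemma integral_circ_trig_poly:
  fixes a :: "nat \<Rightarrow> complex"
  assumes A: "finite A"
  shows "(LINT t|circ. (norm (\<Sum>k\<in>A. a k * cis (k * t)))\<^sup>2) = 2 * pi * (\<Sum>k\<in>A. (norm (a k))\<^sup>2)"
proof -
  have "of_real (LINT t|circ. (norm (\<Sum>k\<in>A. a k * cis (k * t)))\<^sup>2) = (LINT t|circ. complex_of_real ((norm (\<Sum>k\<in>A. a k * cis (k * t)))\<^sup>2))"
    by (rule integral_complex_of_real[symmetric])
  also have "\<dots> = (LINT t|circ. (\<Sum>j\<in>A. \<Sum>k\<in>A. a j * cnj (a k) * cis (of_int (int j - int k) * t)))"
    unfolding complex_norm_square cnj_sum sum_product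
    by (intro Bochner_Integration.integral_cong refl sum.cong)
       (simp add: cis_cnj cis_mult algebra_simps)
  also have "\<dots> = (\<Sum>j\<in>A. \<Sum>k\<in>A. a j * cnj (a k) * (LINT t|circ. cis (of_int (int j - int k) * t)))"
    by (subst Bochner_Integration.integral_sum | intro Bochner_Integration.integrable_sum integrable_circ_continuous continuous_intros)+ 
      (simp del: of_int_diff)
  also have "\<dots> = (\<Sum>j\<in>A. \<Sum>k\<in>A. if k = j then of_real (2 * pi * (norm (a j))\<^sup>2) else 0)"
    unfolding integral_circ_cis
    by (intro sum.cong refl) (auto simp: mult_ac simp flip: complex_norm_square)
  also have "\<dots> = of_real (2 * pi * (\<Sum>k\<in>A. (norm (a k))\<^sup>2))"
    using A by (simp add: sum.delta sum_distrib_left)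
  finally show ?thesis unfolding of_real_eq_iff .
qed

text \<open>The arithmetic-geometric mean inequality, applied pointwise, replaces Cauchy-Schwarz; it
  is sharp where \<open>norm (h t) = e\<close>, so no constant is lost.\<close>

lemma integral_norm_le_of_square:
  fixes h :: "real \<Rightarrow> complex"
  assumes m: "h \<in> borel_measurable circ" and sq: "integrable circ (\<lambda>t. (norm (h t))\<^sup>2)"
    and le: "(LINT t|circ. (norm (h t))\<^sup>2) \<le> 2 * pi * e\<^sup>2" and e: "e > 0"
  shows "integrable circ h" "(LINT t|circ. norm (h t)) \<le> 2 * pi * e"
proof -
  interpret finite_measure circ by (rule finite_measure_circ)
  have b: "norm (h t) \<le> (norm (h t))\<^sup>2 / (2 * e) + e / 2" for t
  proof -
    have "0 \<le> (norm (h t) - e)\<^sup>2" by simp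
    then show ?thesis using e by (simp add: field_simps power2_eq_square)
  qed
  have i: "integrable circ (\<lambda>t. (norm (h t))\<^sup>2 / (2 * e) + e / 2)" using sq by simp
  show ih: "integrable circ h"
    by (rule Bochner_Integration.integrable_bound[OF i m]) (use b e in \<open>auto intro: order_trans\<close>)
  have "(LINT t|circ. norm (h t)) \<le> (LINT t|circ. (norm (h t))\<^sup>2 / (2 * e) + e / 2)"
    by (intro integral_mono i integrable_norm ih b)
  also have "\<dots> = (LINT t|circ. (norm (h t))\<^sup>2) / (2 * e) + 2 * pi * (e / 2)"
    using sq measure_circ by (simp add: Bochner_Integration.integral_add)
  also have "\<dots> \<le> 2 * pi * e\<^sup>2 / (2 * e) + 2 * pi * (e / 2)"
    using le e by (intro add_right_mono divide_right_mono) auto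
  also have "\<dots> = 2 * pi * e" using e by (simp add: field_simps power2_eq_square)
  finally show "(LINT t|circ. norm (h t)) \<le> 2 * pi * e" .
qed


text \<open>Riesz-Fischer by hand: along a subsequence with tails at most \<open>(1/4)^k\<close> the
  partial sums converge almost everywhere, and Fatou's lemma turns bounds between partial sums into
  bounds for the distance to the limit.\<close>

lemma l2_circle_limit:
  fixes a :: "nat \<Rightarrow> complex"
  assumes a: "summable (\<lambda>n. (norm (a n))\<^sup>2)"
  obtains F :: "real \<Rightarrow> complex" where "F \<in> borel_measurable circ"
    "\<And>N. integrable circ (\<lambda>t. (norm (F t - (\<Sum>n<N. a n * cis (n * t))))\<^sup>2)"
    "\<And>N. (LINT t|circ. (norm (F t - (\<Sum>n<N. a n * cis (n * t))))\<^sup>2) \<le> 2 * pi * (\<Sum>n. (norm (a (n + N)))\<^sup>2)"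
proof -
  define S where "S = (\<lambda>N t. \<Sum>n<N. a n * cis (real n * t))"
  define tail where "tail = (\<lambda>N. \<Sum>n. (norm (a (n + N)))\<^sup>2)"
  have Sc: "continuous_on A (S N)" for N A unfolding S_def by (intro continuous_intros)
  have Sm [measurable]: "S N \<in> borel_measurable circ" for N
    using borel_measurable_integrable[OF integrable_circ_continuous[OF Sc]] .
  have diff: "S N t - S M t = (\<Sum>n\<in>{M..<N}. a n * cis (n * t))" if "M \<le> N" for M N t
    unfolding S_def using that sum_diff_nat_ivl[of 0 M N "\<lambda>n. a n * cis (n * t)"] by (simp add: lessThan_atLeast0)
  have tail_le: "(\<Sum>n\<in>{M..<N}. (norm (a n))\<^sup>2) \<le> tail M" if "M \<le> N" for M N
  proof -
    have "(\<Sum>n\<in>{M..<N}. (norm (a n))\<^sup>2) = (\<Sum>n<N-M. (norm (a (n + M)))\<^sup>2)"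
      using sum.shift_bounds_nat_ivl[of "\<lambda>n. (norm (a n))\<^sup>2" 0 M "N - M"] that by (simp add: lessThan_atLeast0)
    also have "\<dots> \<le> tail M" unfolding tail_def
      by (rule sum_le_suminf) (use summable_ignore_initial_segment[OF a, of M] in auto)
    finally show ?thesis .
  qed
  have intS: "(LINT t|circ. (norm (S N t - S M t))\<^sup>2) \<le> 2 * pi * tail M" if "M \<le> N" for M N
    using tail_le[OF that] unfolding diff[OF that] by (subst integral_circ_trig_poly) auto
  have tail0: "tail \<longlonglongrightarrow> 0" unfolding tail_def by (rule suminf_exist_split2[OF a])
  have ex: "\<exists>N\<ge>k. tail N \<le> ((1/2) ^ k)\<^sup>2" for k
  proof -
    have "\<forall>\<^sub>F N in sequentially. tail N < ((1/2) ^ k)\<^sup>2 \<and> k \<le> N"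
      by (intro eventually_conj order_tendstoD(2)[OF tail0] eventually_ge_at_top) simp
    then show ?thesis by (metis (no_types, lifting) eventually_sequentially less_imp_le order_refl)
  qed
  \<comment> \<open>Taking the least index makes N monotone, because the tail bound for
    \<open>Suc k\<close> implies the one for k; the demand \<open>k \<le> N\<close> makes N pass
    every M.\<close>
  define N where "N = (\<lambda>k. LEAST N. k \<le> N \<and> tail N \<le> ((1/2) ^ k)\<^sup>2)"
  have N: "k \<le> N k" "tail (N k) \<le> ((1/2) ^ k)\<^sup>2" for k
    using LeastI_ex[OF ex[of k, unfolded Bex_def]] unfolding N_def by auto
  have Nmono: "N k \<le> N (Suc k)" for k
  proof -
    have "((1/2) ^ Suc k)\<^sup>2 \<le> ((1/2::real) ^ k)\<^sup>2" by (intro power_mono) auto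
    with N[of "Suc k"] have "k \<le> N (Suc k) \<and> tail (N (Suc k)) \<le> ((1/2) ^ k)\<^sup>2" by linarith
    then have "(LEAST N. k \<le> N \<and> tail N \<le> ((1/2) ^ k)\<^sup>2) \<le> N (Suc k)" by (rule Least_le)
    then show ?thesis by (simp add: N_def)
  qed
  define D where "D = (\<lambda>k t. S (N (Suc k)) t - S (N k) t)"
  have D1: "integrable circ (D k)" "(LINT t|circ. norm (D k t)) \<le> 2 * pi * (1/2) ^ k" for k
  proof -
    have c: "continuous_on {0..2*pi} (D k)" unfolding D_def by (intro continuous_intros Sc)
    have le: "(LINT t|circ. (norm (D k t))\<^sup>2) \<le> 2 * pi * ((1/2) ^ k)\<^sup>2"
    proof -
      have "(LINT t|circ. (norm (D k t))\<^sup>2) \<le> 2 * pi * tail (N k)" unfolding D_def by (rule intS[OF Nmono])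
      also have "\<dots> \<le> 2 * pi * ((1/2) ^ k)\<^sup>2" using N by (intro mult_left_mono) auto
      finally show ?thesis .
    qed
    have i: "integrable circ (\<lambda>t. (norm (D k t))\<^sup>2)"
      by (intro integrable_circ_continuous continuous_intros c)
    have m: "D k \<in> borel_measurable circ"
      using borel_measurable_integrable[OF integrable_circ_continuous[OF c]] .
    show "integrable circ (D k)" by (rule integral_norm_le_of_square(1)[OF m i le]) simp
    show "(LINT t|circ. norm (D k t)) \<le> 2 * pi * (1/2) ^ k" by (rule integral_norm_le_of_square(2)[OF m i le]) simp
  qed
  have Dm [measurable]: "D k \<in> borel_measurable circ" for k unfolding D_def by measurable
  have "AE t in circ. (\<Sum>k. ennreal (norm (D k t))) \<noteq> \<infinity>"
  proof (rule nn_integral_PInf_AE)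
    have "(\<integral>\<^sup>+ t. (\<Sum>k. ennreal (norm (D k t))) \<partial>circ) = (\<Sum>k. \<integral>\<^sup>+ t. ennreal (norm (D k t)) \<partial>circ)"
      by (rule nn_integral_suminf) measurable
    also have "\<dots> \<le> (\<Sum>k. ennreal (2 * pi * (1/2) ^ k))"
      using D1 by (intro suminf_le) (auto simp: nn_integral_eq_integral)
    also have "\<dots> = ennreal (\<Sum>k. 2 * pi * (1/2) ^ k)"
      by (intro suminf_ennreal2 summable_mult summable_geometric) auto
    finally show "(\<integral>\<^sup>+ t. (\<Sum>k. ennreal (norm (D k t))) \<partial>circ) \<noteq> \<infinity>"
      by (auto simp: top_unique)
  qed measurable
  then have conv: "AE t in circ. convergent (\<lambda>k. S (N k) t)"
  proof eventually_elim
    case (elim t)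
    then have "summable (\<lambda>k. norm (D k t))" by (intro summable_suminf_not_top) auto
    then have "summable (\<lambda>k. D k t)" by (rule summable_norm_cancel)
    then have "convergent (\<lambda>n. \<Sum>k<n. D k t)" by (simp add: summable_iff_convergent)
    moreover have "(\<Sum>k<n. D k t) = S (N n) t - S (N 0) t" for n
      unfolding D_def by (rule sum_lessThan_telescope)
    ultimately show ?case using convergent_diff_const_right_iff by auto
  qed
  define F where "F = (\<lambda>t. lim (\<lambda>k. S (N k) t))"
  have Fm [measurable]: "F \<in> borel_measurable circ" unfolding F_def by measurable
  have lim: "AE t in circ. (\<lambda>k. S (N k) t) \<longlonglongrightarrow> F t"
    using conv by eventually_elim (simp add: F_def convergent_LIMSEQ_iff)
  have fin: "(\<integral>\<^sup>+ t. ennreal ((norm (F t - S M t))\<^sup>2) \<partial>circ) \<le> ennreal (2 * pi * tail M)" for M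
  proof -
    have "(\<integral>\<^sup>+ t. ennreal ((norm (F t - S M t))\<^sup>2) \<partial>circ)
       = (\<integral>\<^sup>+ t. liminf (\<lambda>k. ennreal ((norm (S (N k) t - S M t))\<^sup>2)) \<partial>circ)"
    proof (rule nn_integral_cong_AE)
      show "AE t in circ. ennreal ((norm (F t - S M t))\<^sup>2) = liminf (\<lambda>k. ennreal ((norm (S (N k) t - S M t))\<^sup>2))"
        using lim
      proof eventually_elim
        case (elim t)
        then have "(\<lambda>k. ennreal ((norm (S (N k) t - S M t))\<^sup>2)) \<longlonglongrightarrow> ennreal ((norm (F t - S M t))\<^sup>2)"
          by (intro tendsto_intros) auto
        then show ?case by (intro lim_imp_Liminf[symmetric]) auto
      qed
    qed
    also have "\<dots> \<le> liminf (\<lambda>k. \<integral>\<^sup>+ t. ennreal ((norm (S (N k) t - S M t))\<^sup>2) \<partial>circ)"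
      by (rule nn_integral_liminf) measurable
    also have "\<dots> \<le> liminf (\<lambda>k. ennreal (2 * pi * tail M))"
    proof (rule Liminf_mono)
      show "\<forall>\<^sub>F k in sequentially. (\<integral>\<^sup>+ t. ennreal ((norm (S (N k) t - S M t))\<^sup>2) \<partial>circ) \<le> ennreal (2 * pi * tail M)"
        using eventually_ge_at_top[of M]
      proof eventually_elim
        case (elim k)
        then have "M \<le> N k" using N(1)[of k] by simp
        have "integrable circ (\<lambda>t. (norm (S (N k) t - S M t))\<^sup>2)"
          by (intro integrable_circ_continuous continuous_intros Sc)
        then show ?case using intS[OF \<open>M \<le> N k\<close>] by (simp add: nn_integral_eq_integral ennreal_leI)
      qed
    qed
    finally show ?thesis by (simp add: Liminf_const)
  qed
  have fold: "(\<Sum>n<M. a n * cis (real n * t)) = S M t" "(\<Sum>n. (norm (a (n + M)))\<^sup>2) = tail M" for M t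
    by (simp_all add: S_def tail_def)
  show thesis
  proof (rule that[OF Fm], unfold fold)
    fix M
    show i: "integrable circ (\<lambda>t. (norm (F t - S M t))\<^sup>2)"
      by (rule integrableI_bounded) (use fin[of M] in \<open>auto simp: less_top[symmetric] top_unique\<close>)
    have "0 \<le> tail M" using tail_le[of M M] by simp
    then show "(LINT t|circ. (norm (F t - S M t))\<^sup>2) \<le> 2 * pi * tail M"
      using fin[of M] i by (simp add: nn_integral_eq_integral)
  qed
qed

section \<open>Lebesgue differentiation and Fatou's theorem on radial limits\<close>

text \<open>Lebesgue's differentiation theorem. The averages in
  \<open>integrable_ccontinuous_explicit\<close> extend to the right of the point; applied to the
  reflected function it gives the averages on the left, and together they give the two-sided
  derivative.\<close>

lemma AE_indefinite_integral_derivative: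
  fixes h :: "real \<Rightarrow> 'b::euclidean_space"
  assumes h: "integrable (lebesgue_on {a..b}) h"
  shows "AE t in lebesgue_on {a..b}. ((\<lambda>x. integral {a..x} h) has_vector_derivative h t) (at t)"
proof -
  define k where "k = (\<lambda>x. if x \<in> {a..b} then h x else 0)"
  have hint: "h integrable_on {a..b}" using integrable_on_lebesgue_on[OF h] by auto
  then have "k integrable_on UNIV" unfolding k_def by (simp only: integrable_restrict_UNIV)
  then have k1: "k integrable_on cbox u v" for u v by (rule integrable_on_subcbox) simp
  then have k2: "(\<lambda>x. k (- x)) integrable_on cbox u v" for u v
    using k1[of "-v" "-u"] Henstock_Kurzweil_Integration.integrable_reflect_real[where f=k and a="-v" and b="-u"] by simp
  obtain N1 where N1: "negligible N1" "\<And>x e. x \<notin> N1 \<Longrightarrow> 0 < e \<Longrightarrow>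
     \<exists>d>0. \<forall>h. 0 < h \<and> h < d \<longrightarrow> norm (integral (cbox x (x + h *\<^sub>R One)) k /\<^sub>R h ^ DIM(real) - k x) < e"
    using integrable_ccontinuous_explicit[OF k1] by metis
  obtain N2 where N2: "negligible N2" "\<And>x e. x \<notin> N2 \<Longrightarrow> 0 < e \<Longrightarrow>
     \<exists>d>0. \<forall>h. 0 < h \<and> h < d \<longrightarrow> norm (integral (cbox x (x + h *\<^sub>R One)) (\<lambda>x. k (- x)) /\<^sub>R h ^ DIM(real) - k (- x)) < e"
    using integrable_ccontinuous_explicit[OF k2] by metis
  have der: "((\<lambda>x. integral {a..x} h) has_vector_derivative h t) (at t)"
    if t: "t \<in> {a<..<b}" "t \<notin> N1" "- t \<notin> N2" for t
    unfolding has_vector_derivative_def has_derivative_at_alt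
  proof (intro conjI allI impI)
    fix e :: real assume e: "e > 0"
    obtain d1 where d1: "d1 > 0" "\<And>h. 0 < h \<Longrightarrow> h < d1 \<Longrightarrow> norm (integral {t..t + h} k /\<^sub>R h - k t) < e"
      using N1(2)[OF t(2) e] by auto
    obtain d2 where d2: "d2 > 0" "\<And>h. 0 < h \<Longrightarrow> h < d2 \<Longrightarrow> norm (integral {-t..-t + h} (\<lambda>x. k (- x)) /\<^sub>R h - k t) < e"
      using N2(2)[OF t(3) e] by auto
    define d where "d = min (min d1 d2) (min (t - a) (b - t))"
    have scale: "norm (I - \<delta> *\<^sub>R k t) \<le> e * \<delta>" if "norm (I /\<^sub>R \<delta> - k t) < e" "\<delta> > 0" for I :: 'b and \<delta> :: real
    proof -
      have "I - \<delta> *\<^sub>R k t = \<delta> *\<^sub>R (I /\<^sub>R \<delta> - k t)" using that by (simp add: scaleR_diff_right)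
      then have "norm (I - \<delta> *\<^sub>R k t) = \<delta> * norm (I /\<^sub>R \<delta> - k t)" using that by simp
      then show ?thesis using that by (simp add: mult.commute[of e])
    qed
    have kt: "k t = h t" using t by (simp add: k_def)
    have "norm (integral {a..y} h - integral {a..t} h - (y - t) *\<^sub>R h t) \<le> e * norm (y - t)" if y: "norm (y - t) < d" for y
    proof (cases y t rule: linorder_cases)
      case equal then show ?thesis by simp
    next
      case greater
      have yab: "y \<le> b" using y greater by (auto simp: d_def)
      have A: "integral {a..t} h + integral {t..y} h = integral {a..y} h"
        by (rule Henstock_Kurzweil_Integration.integral_combine) (use t greater yab in \<open>auto intro: integrable_on_subinterval[OF hint]\<close>)
      have "integral {t..y} h = integral {t..y} k"
        by (intro Henstock_Kurzweil_Integration.integral_cong) (use t yab in \<open>simp add: k_def\<close>)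
      then have "integral {a..y} h - integral {a..t} h = integral {t..t + (y - t)} k" unfolding A[symmetric] by simp
      moreover have "norm (integral {t..t + (y - t)} k /\<^sub>R (y - t) - k t) < e"
        by (rule d1(2)) (use y greater in \<open>auto simp: d_def\<close>)
      ultimately show ?thesis using scale[where I="integral {t..t + (y - t)} k" and \<delta>="y - t"] greater kt by simp
    next
      case less
      have yab: "y \<ge> a" using y less by (auto simp: d_def)
      have A: "integral {a..y} h + integral {y..t} h = integral {a..t} h"
        by (rule Henstock_Kurzweil_Integration.integral_combine) (use t less yab in \<open>auto intro: integrable_on_subinterval[OF hint]\<close>)
      have "integral {y..t} h = integral {y..t} k"
        by (intro Henstock_Kurzweil_Integration.integral_cong) (use t yab in \<open>simp add: k_def\<close>)
      also have "\<dots> = integral {-t..-t + (t - y)} (\<lambda>x. k (- x))"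
        using Henstock_Kurzweil_Integration.integral_reflect_real[where f=k and a=y and b=t] by simp
      finally have eq: "integral {a..y} h - integral {a..t} h - (y - t) *\<^sub>R h t = - (integral {-t..-t + (t - y)} (\<lambda>x. k (- x)) - (t - y) *\<^sub>R k t)"
        unfolding A[symmetric] kt by (simp add: scaleR_left_diff_distrib)
      have "norm (integral {-t..-t + (t - y)} (\<lambda>x. k (- x)) /\<^sub>R (t - y) - k t) < e"
        by (rule d2(2)) (use y less in \<open>auto simp: d_def\<close>)
      then show ?thesis using scale[where I="integral {-t..-t + (t - y)} (\<lambda>x. k (- x))" and \<delta>="t - y"] less unfolding eq norm_minus_cancel by simp
    qed
    moreover have "d > 0" using d1 d2 t by (auto simp: d_def)
    ultimately show "\<exists>d>0. \<forall>y. norm (y - t) < d \<longrightarrow> norm (integral {a..y} h - integral {a..t} h - (y - t) *\<^sub>R h t) \<le> e * norm (y - t)"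
      by blast
  qed (rule bounded_linear_scaleR_left)
  \<comment> \<open>The exceptional set of the reflected function has to be reflected back, and a
    differentiable map preserves null sets.\<close>
  have lin: "linear (uminus :: real \<Rightarrow> real)" by (rule linearI) auto
  have "negligible (N1 \<union> uminus ` N2 \<union> {a, b})"
    using N1(1) negligible_differentiable_image_negligible[OF _ N2(1) linear_imp_differentiable_on[OF lin]]
    by (auto intro!: negligible_Un)
  then have "AE t in lebesgue. t \<notin> N1 \<union> uminus ` N2 \<union> {a, b}"
    unfolding negligible_iff_null_sets by (rule AE_not_in)
  then have "AE t in lebesgue_on {a..b}. t \<notin> N1 \<union> uminus ` N2 \<union> {a, b} \<and> t \<in> {a..b}"
    by (subst AE_restrict_space_iff) auto
  then show ?thesis
  proof eventually_elim
    case (elim t)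
    then have "- t \<notin> N2" using imageI[of "-t" N2 uminus] by auto
    then show ?case using elim by (intro der) auto
  qed
qed


text \<open>Translates a derivative in the angle into an estimate in the chord \<open>u - 1\<close>,
  as \<open>fatou_radial_limit\<close> expects. The angle of u is \<open>Im (Ln u)\<close>, at most
  twice the chord near 1, which is where the halves of e and d come from.\<close>

lemma circle_derivative_small:
  fixes G :: "complex \<Rightarrow> complex"
  assumes G: "((\<lambda>x. G (cis x)) has_vector_derivative (\<i> * cis t * c)) (at t)" and e: "e > 0"
  shows "\<exists>\<eta>>0. \<forall>u. norm u = 1 \<and> norm (u - 1) < \<eta> \<longrightarrow>
    norm (G (cis t * u) - G (cis t) - c * cis t * (u - 1)) \<le> e * norm (u - 1)"
proof -
  define \<phi> where "\<phi> = (\<lambda>x. G (cis x) - c * cis x)"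
  have "(cis has_vector_derivative (\<i> * cis t)) (at t)"
    unfolding cis_conv_exp
    by (auto intro!: derivative_eq_intros has_vector_derivative_real_field simp: algebra_simps)
  then have "(\<phi> has_vector_derivative (\<i> * cis t * c - c * (\<i> * cis t))) (at t)"
    unfolding \<phi>_def by (intro has_vector_derivative_diff G has_vector_derivative_mult_right)
  then have "(\<phi> has_derivative (\<lambda>h. 0)) (at t)"
    by (simp add: has_vector_derivative_def mult_ac)
  then have "\<forall>e>0. \<exists>d>0. \<forall>y. norm (y - t) < d \<longrightarrow> norm (\<phi> y - \<phi> t - 0) \<le> e * norm (y - t)"
    unfolding has_derivative_at_alt by blast
  then obtain d where d: "d > 0" "\<And>y. norm (y - t) < d \<Longrightarrow> norm (\<phi> y - \<phi> t) \<le> e / 2 * norm (y - t)"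
    using e by (metis diff_zero half_gt_zero)
  have "(Ln has_derivative (\<lambda>h. 1 * h)) (at 1)"
    using has_field_derivative_Ln[of 1] by (simp add: has_field_derivative_def lambda_one)
  then have "\<forall>e>0. \<exists>d>0. \<forall>u. norm (u - 1) < d \<longrightarrow> norm (Ln u - Ln 1 - 1 * (u - 1)) \<le> e * norm (u - 1)"
    unfolding has_derivative_at_alt by blast
  from this[rule_format, of 1] obtain \<eta> where \<eta>: "\<eta> > 0" "\<And>u. norm (u - 1) < \<eta> \<Longrightarrow> norm (Ln u - (u - 1)) \<le> norm (u - 1)"
    by auto
  show ?thesis
  proof (intro exI[of _ "min \<eta> (d / 2)"] conjI allI impI)
    fix u :: complex assume u: "norm u = 1 \<and> norm (u - 1) < min \<eta> (d / 2)"
    define k where "k = Im (Ln u)"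
    have u0: "u \<noteq> 0" using u by force
    have "norm (Ln u) \<le> norm (Ln u - (u - 1)) + norm (u - 1)"
      using norm_triangle_sub[of "Ln u" "u - 1"] by simp
    then have "norm (Ln u) \<le> 2 * norm (u - 1)" using \<eta>(2)[of u] u by simp
    then have k: "\<bar>k\<bar> \<le> 2 * norm (u - 1)" using abs_Im_le_cmod[of "Ln u"] by (simp add: k_def)
    have "Re (Ln u) = 0" using u u0 by simp
    then have "Ln u = \<i> * k" by (simp add: complex_eq_iff k_def)
    then have "cis k = exp (Ln u)" by (simp add: cis_conv_exp)
    then have cu: "cis k = u" using u0 by simp
    have "norm (\<phi> (t + k) - \<phi> t) \<le> e / 2 * norm (t + k - t)" by (rule d(2)) (use k u in auto)
    also have "\<dots> \<le> e * norm (u - 1)" using k e by simp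
    also have "\<phi> (t + k) - \<phi> t = G (cis t * u) - G (cis t) - c * cis t * (u - 1)"
      by (simp add: \<phi>_def cu cis_mult[symmetric] algebra_simps)
    finally show "norm (G (cis t * u) - G (cis t) - c * cis t * (u - 1)) \<le> e * norm (u - 1)" .
  qed (use \<eta> d in auto)
qed


text \<open>Dividing the coefficients by n + 1 turns square summability into absolute summability,
  so the antiderivative \<open>G\<close> is continuous up to the circle, where it becomes an
  indefinite integral of an integrable function of the angle.\<close>

lemma radial_limit_l2_series:
  fixes a :: "nat \<Rightarrow> complex"
  assumes a: "summable (\<lambda>n. (norm (a n))\<^sup>2)" and Fm: "F \<in> borel_measurable circ"
    and Fi: "\<And>N. integrable circ (\<lambda>t. (norm (F t - (\<Sum>n<N. a n * cis (n * t))))\<^sup>2)"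
    and Fle: "\<And>N. (LINT t|circ. (norm (F t - (\<Sum>n<N. a n * cis (n * t))))\<^sup>2) \<le> 2 * pi * (\<Sum>n. (norm (a (n + N)))\<^sup>2)"
  shows "AE t in circ. ((\<lambda>r. \<Sum>n. a n * (of_real r * cis t) ^ n) \<longlongrightarrow> F t) (at_left 1)"
proof -
  define S where "S = (\<lambda>N t. \<Sum>n<N. a n * cis (real n * t))"
  have Sc: "continuous_on A (S N)" for N A unfolding S_def by (intro continuous_intros)
  have Sm [measurable]: "S N \<in> borel_measurable circ" for N
    using borel_measurable_integrable[OF integrable_circ_continuous[OF Sc]] .
  note [measurable] = Fm
  define c where "c = (\<lambda>n. if n = 0 then 0 else a (n - 1) / of_nat n)"
  have diffs: "diffs c = a" by (auto simp: diffs_def c_def fun_eq_iff simp del: of_nat_Suc)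
  have csum: "summable (\<lambda>n. norm (c n))"
  proof -
    have "summable (\<lambda>n. norm (c (Suc n)))"
    proof (rule summable_comparison_test')
      have "summable (\<lambda>n. inverse ((real (Suc n))\<^sup>2))"
        using inverse_power_summable[of 2, where 'a=real] by (subst summable_Suc_iff) auto
      then show "summable (\<lambda>n. (norm (a n))\<^sup>2 + inverse ((real (Suc n))\<^sup>2))"
        by (intro summable_add a)
      show "norm (norm (c (Suc n))) \<le> (norm (a n))\<^sup>2 + inverse ((real (Suc n))\<^sup>2)" for n
      proof -
        define x y where "x = norm (a n)" and "y = inverse (real (Suc n))"
        have "0 \<le> (x - y)\<^sup>2 + x * x + y * y" by simp
        then have "x * y \<le> x\<^sup>2 + y\<^sup>2" by (simp add: power2_eq_square algebra_simps)
        moreover have "norm (c (Suc n)) = x * y"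
          by (simp add: c_def x_def y_def divide_inverse norm_mult norm_inverse del: of_nat_Suc)
        ultimately show ?thesis by (simp add: x_def y_def power_inverse)
      qed
    qed
    then show ?thesis by (subst (asm) summable_Suc_iff)
  qed
  define G where "G = (\<lambda>z. \<Sum>n. c n * z ^ n)"
  have ulim: "uniform_limit (cball 0 1) (\<lambda>N z. \<Sum>n<N. c n * z ^ n) G sequentially"
    unfolding G_def
  proof (rule Weierstrass_m_test[OF _ csum])
    fix n and z :: complex assume "z \<in> cball 0 1"
    then show "norm (c n * z ^ n) \<le> norm (c n)"
      by (simp add: norm_mult norm_power mult_left_le power_le_one)
  qed
  have Gc: "continuous_on (cball 0 1) G"
    by (rule uniform_limit_theorem[OF _ ulim]) (auto intro!: always_eventually continuous_intros)
  have Gd: "(G has_field_derivative (\<Sum>n. a n * z ^ n)) (at z)" if "norm z < 1" for z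
  proof -
    have "summable (\<lambda>n. c n * 1 ^ n)" using summable_norm_cancel[OF csum] by simp
    from termdiffs_strong[OF this, of z] that show ?thesis unfolding G_def diffs by simp
  qed
  \<comment> \<open>The angular derivative that the chain rule predicts for
    \<open>G (cis s)\<close>, with \<open>F\<close> in place of the boundary values of the
    series.\<close>
  define h where "h = (\<lambda>s. \<i> * cis s * F s)"
  define tail where "tail = (\<lambda>N. \<Sum>n. (norm (a (n + N)))\<^sup>2)"
  have tailnn: "0 \<le> tail N" for N unfolding tail_def
    by (intro suminf_nonneg summable_ignore_initial_segment a) auto
  have tail0: "tail \<longlonglongrightarrow> 0" unfolding tail_def by (rule suminf_exist_split2[OF a])
  have fold: "(\<Sum>n<N. a n * cis (real n * t)) = S N t" "(\<Sum>n. (norm (a (n + N)))\<^sup>2) = tail N" for N t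
    by (simp_all add: S_def tail_def)
  note Fi' = Fi[unfolded fold] and Fle' = Fle[unfolded fold]
  have FSm: "(\<lambda>t. F t - S N t) \<in> borel_measurable circ" for N by measurable
  have FS: "integrable circ (\<lambda>t. F t - S N t)" for N
  proof (rule integral_norm_le_of_square(1)[OF FSm Fi'])
    \<comment> \<open>Only integrability is wanted here, so any positive e with
      \<open>tail N \<le> e^2\<close> will do; \<open>tail N\<close> itself may be zero.\<close>
    show "0 < tail N + 1" using tailnn[of N] by simp
    have "tail N \<le> (tail N + 1)\<^sup>2" using tailnn[of N] by (simp add: power2_sum)
    then have "2 * pi * tail N \<le> 2 * pi * (tail N + 1)\<^sup>2" by simp
    with Fle'[of N] show "(LINT t|circ. (norm (F t - S N t))\<^sup>2) \<le> 2 * pi * (tail N + 1)\<^sup>2" by linarith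
  qed
  have L1: "(\<lambda>N. LINT t|circ. norm (F t - S N t)) \<longlonglongrightarrow> 0"
  proof (rule tendstoI)
    fix e :: real assume e: "e > 0"
    define \<epsilon> where "\<epsilon> = e / (4 * pi)"
    have \<epsilon>: "\<epsilon> > 0" using e by (simp add: \<epsilon>_def)
    then have "\<forall>\<^sub>F N in sequentially. tail N < \<epsilon>\<^sup>2" by (intro order_tendstoD(2)[OF tail0]) simp
    then show "\<forall>\<^sub>F N in sequentially. dist (LINT t|circ. norm (F t - S N t)) 0 < e"
    proof eventually_elim
      case (elim N)
      then have "2 * pi * tail N \<le> 2 * pi * \<epsilon>\<^sup>2" by simp
      then have "(LINT t|circ. (norm (F t - S N t))\<^sup>2) \<le> 2 * pi * \<epsilon>\<^sup>2" using Fle'[of N] by linarith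
      from integral_norm_le_of_square(2)[OF FSm Fi' this \<epsilon>]
      have "(LINT t|circ. norm (F t - S N t)) \<le> 2 * pi * \<epsilon>" .
      also have "2 * pi * \<epsilon> < e" using e by (simp add: \<epsilon>_def)
      finally show ?case by simp
    qed
  qed
  have Fint: "integrable circ F" using FS[of 0] by (simp add: S_def)
  have [measurable]: "(\<lambda>s. \<i> * cis s) \<in> borel_measurable circ"
    by (rule borel_measurable_integrable[OF integrable_circ_continuous]) (intro continuous_intros)
  have hint: "integrable circ h"
    by (rule Bochner_Integration.integrable_bound[OF Fint]) (auto simp: h_def norm_mult)
  \<comment> \<open>For partial sums this is the fundamental theorem of calculus, and convergence in
    mean carries it to the limit. Integration raises the degree by one, so \<open>S N\<close> is
    paired with \<open>X (Suc N)\<close>.\<close>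
  have Gh: "G (cis t) - G 1 = integral {0..t} h" if t: "t \<in> {0..2*pi}" for t
  proof -
    define X where "X = (\<lambda>N. (\<Sum>n<N. c n * cis t ^ n) - (\<Sum>n<N. c n * 1 ^ n))"
    have "X \<longlonglongrightarrow> G (cis t) - G 1" unfolding X_def
      by (intro tendsto_diff tendsto_uniform_limitI[OF ulim]) auto
    then have X1: "(\<lambda>N. X (Suc N)) \<longlonglongrightarrow> G (cis t) - G 1" by (rule LIMSEQ_Suc)
    have XS: "((\<lambda>s. \<i> * cis s * S N s) has_integral X (Suc N)) {0..t}" for N
    proof -
      have "((\<lambda>s. \<i> * cis s * S N s) has_integral
         ((\<Sum>n<Suc N. c n * cis (real n * t)) - (\<Sum>n<Suc N. c n * cis (real n * 0)))) {0..t}"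
      proof (rule fundamental_theorem_of_calculus)
        show "0 \<le> t" using t by simp
        fix s
        have "((\<lambda>s. \<Sum>n<Suc N. c n * cis (real n * s)) has_vector_derivative
          (\<Sum>n<Suc N. c n * (\<i> * of_nat n * cis (real n * s)))) (at s within {0..t})"
          unfolding cis_conv_exp
          by (auto intro!: derivative_eq_intros has_vector_derivative_real_field simp: algebra_simps)
        also have "(\<Sum>n<Suc N. c n * (\<i> * of_nat n * cis (real n * s))) = (\<Sum>n<N. c (Suc n) * (\<i> * of_nat (Suc n) * cis (real (Suc n) * s)))"
          by (subst sum.lessThan_Suc_shift) (simp add: c_def)
        also have "\<dots> = \<i> * cis s * S N s"
          unfolding S_def sum_distrib_left
        proof (rule sum.cong[OF refl])
          fix n
          have "cis (real (Suc n) * s) = cis s * cis (real n * s)" by (simp add: cis_mult algebra_simps)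
          then show "c (Suc n) * (\<i> * of_nat (Suc n) * cis (real (Suc n) * s)) = \<i> * cis s * (a n * cis (real n * s))"
            by (simp add: c_def del: of_nat_Suc)
        qed
        finally show "((\<lambda>s. \<Sum>n<Suc N. c n * cis (real n * s)) has_vector_derivative (\<i> * cis s * S N s)) (at s within {0..t})" .
      qed
      then show ?thesis by (simp add: X_def Complex.DeMoivre del: sum.lessThan_Suc)
    qed
    have sub: "{0..t} \<subseteq> {0..2*pi}" using t by auto
    have hI: "h integrable_on {0..t}"
      using integrable_on_lebesgue_on[OF hint] by (rule integrable_on_subinterval) (use sub in auto)
    have "(\<lambda>N. integral {0..t} h - X (Suc N)) \<longlonglongrightarrow> 0"
    proof (rule Lim_null_comparison[OF always_eventually L1], rule allI)
      fix N
      define D where "D = (\<lambda>s. F s - S N s)"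
      have Dn: "(\<lambda>s. norm (D s)) integrable_on {0..2*pi}"
        using integrable_on_lebesgue_on[OF integrable_norm[OF FS[of N]]] by (simp add: D_def)
      have Dn': "(\<lambda>s. norm (D s)) integrable_on {0..t}"
        by (rule integrable_on_subinterval[OF Dn]) (use sub in auto)
      have D: "((\<lambda>s. \<i> * cis s * D s) has_integral (integral {0..t} h - X (Suc N))) {0..t}"
        using has_integral_diff[OF integrable_integral[OF hI] XS[of N]] by (simp add: h_def D_def algebra_simps)
      have "norm (integral {0..t} (\<lambda>s. \<i> * cis s * D s)) \<le> integral {0..t} (\<lambda>s. norm (D s))"
        by (rule integral_norm_bound_integral[OF has_integral_integrable[OF D] Dn']) (simp add: norm_mult)
      also have "\<dots> \<le> integral {0..2*pi} (\<lambda>s. norm (D s))"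
        by (rule integral_subset_le[OF sub Dn' Dn]) simp
      also have "\<dots> = (LINT s|circ. norm (D s))"
        using FS[of N] by (subst lebesgue_integral_eq_integral) (auto simp: D_def)
      finally show "norm (integral {0..t} h - X (Suc N)) \<le> (LINT t|circ. norm (F t - S N t))"
        using integral_unique[OF D] by (simp add: D_def)
    qed
    then have "(\<lambda>N. integral {0..t} h - (integral {0..t} h - X (Suc N))) \<longlonglongrightarrow> integral {0..t} h - 0"
      by (intro tendsto_diff tendsto_const)
    then show ?thesis using X1 by (simp add: LIMSEQ_unique)
  qed
  have "AE t in circ. ((\<lambda>x. integral {0..x} h) has_vector_derivative h t) (at t)"
    by (rule AE_indefinite_integral_derivative[OF hint])
  moreover have "AE t in circ. t \<in> {0<..<2*pi}"
  proof -
    have "AE t in lebesgue. t \<notin> {0, 2*pi}"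
      by (rule AE_not_in) (simp flip: negligible_iff_null_sets)
    then have "AE t in circ. t \<notin> {0, 2*pi} \<and> t \<in> {0..2*pi}"
      by (subst AE_restrict_space_iff) auto
    then show ?thesis by eventually_elim auto
  qed
  ultimately show ?thesis
  proof eventually_elim
    case (elim t)
    have "((\<lambda>x. G 1 + integral {0..x} h) has_vector_derivative (0 + h t)) (at t)"
      by (intro has_vector_derivative_add has_vector_derivative_const elim)
    then have "((\<lambda>x. G (cis x)) has_vector_derivative (0 + h t)) (at t)"
      by (rule has_vector_derivative_transform_within_open[where S="{0<..<2*pi}"])
        (use elim Gh in \<open>auto simp: algebra_simps\<close>)
    then have "((\<lambda>x. G (cis x)) has_vector_derivative (\<i> * cis t * F t)) (at t)"
      by (simp add: h_def)
    note sm = circle_derivative_small[OF this]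
    show ?case
      by (rule fatou_radial_limit[OF Gc Gd _ sm]) auto
  qed
qed

section \<open>The Hardy space as a sequence space\<close>

definition hcoef :: "(complex \<Rightarrow> complex) \<Rightarrow> nat \<Rightarrow> complex" where
  "hcoef f n = (deriv ^^ n) f 0 / fact n"

text \<open>Zero off the disk to match the normalization of \<open>hardy2\<close>, so that
  \<open>hardy2_eq_disk_series\<close> is an equality of functions.\<close>

definition disk_series :: "(nat \<Rightarrow> complex) \<Rightarrow> complex \<Rightarrow> complex" where
  "disk_series a z = (if norm z < 1 then \<Sum>n. a n * z ^ n else 0)"

lemma hcoef_sums:
  assumes "f holomorphic_on ball 0 1" "norm z < 1"
  shows "(\<lambda>n. hcoef f n * z ^ n) sums f z"
  using holomorphic_power_series[OF assms(1), of z] assms(2) by (simp add: hcoef_def)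

lemma hcoef_unique:
  assumes "\<And>z. norm z < 1 \<Longrightarrow> (\<lambda>n. a n * z ^ n) sums f z"
  shows "hcoef f = a"
proof
  fix n
  have "\<forall>\<^sub>F z in nhds 0. (\<lambda>n. fps_nth (Abs_fps a) n * z ^ n) sums f z"
  proof (rule eventually_mono)
    show "\<forall>\<^sub>F z in nhds 0. z \<in> ball (0::complex) 1" by (rule eventually_nhds_in_open) auto
  qed (use assms in simp)
  then have "f has_fps_expansion Abs_fps a" by (rule has_fps_expansionI)
  from fps_nth_fps_expansion[OF this, of n] show "hcoef f n = a n" by (simp add: hcoef_def)
qed

text \<open>Parseval on the circle of radius r, where the Taylor series converges absolutely and
  thereby dominates its partial sums.\<close>

lemma circle_mean_square:
  assumes f: "f holomorphic_on ball 0 1" and r: "0 \<le> r" "r < 1"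
  shows "(\<lambda>n. 2 * pi * ((norm (hcoef f n))\<^sup>2 * r ^ (2 * n))) sums (LINT t|circ. (norm (f (of_real r * cis t)))\<^sup>2)"
proof -
  interpret finite_measure circ by (rule finite_measure_circ)
  define b where "b = (\<lambda>n. hcoef f n * of_real r ^ n)"
  have bs: "(\<lambda>n. b n * cis (n * t)) sums f (of_real r * cis t)" for t :: real
    using hcoef_sums[OF f, of "of_real r * cis t"] r
    by (simp add: b_def power_mult_distrib Complex.DeMoivre norm_mult mult_ac)
  have bsum: "summable (\<lambda>n. norm (b n))"
  proof -
    define s where "s = (r + 1) / 2"
    have s: "r < s" "s < 1" "0 < s" using r by (auto simp: s_def)
    have "summable (\<lambda>n. hcoef f n * of_real s ^ n)"
      using hcoef_sums[OF f, of "of_real s"] s by (auto simp: sums_iff)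
    from powser_insidea[OF this, of "of_real r"] show ?thesis using r s by (simp add: b_def)
  qed
  have "(\<lambda>N. LINT t|circ. (norm (\<Sum>n<N. b n * cis (n * t)))\<^sup>2) \<longlonglongrightarrow> (LINT t|circ. (norm (f (of_real r * cis t)))\<^sup>2)"
  proof (rule integral_dominated_convergence[where w="\<lambda>_. (\<Sum>n. norm (b n))\<^sup>2"])
    show "(\<lambda>t. (norm (f (of_real r * cis t)))\<^sup>2) \<in> borel_measurable circ"
      by (intro borel_measurable_integrable integrable_circ_continuous continuous_intros
         continuous_on_compose2[OF holomorphic_on_imp_continuous_on[OF f]]) (use r in \<open>auto simp: norm_mult\<close>)
    show "(\<lambda>t. (norm (\<Sum>n<N. b n * cis (n * t)))\<^sup>2) \<in> borel_measurable circ" for N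
      by (intro borel_measurable_integrable integrable_circ_continuous continuous_intros)
    show "AE t in circ. (\<lambda>N. (norm (\<Sum>n<N. b n * cis (n * t)))\<^sup>2) \<longlonglongrightarrow> (norm (f (of_real r * cis t)))\<^sup>2"
      by (intro always_eventually allI tendsto_intros) (use bs in \<open>simp add: sums_def\<close>)
    show "AE t in circ. norm ((norm (\<Sum>n<N. b n * cis (n * t)))\<^sup>2) \<le> (\<Sum>n. norm (b n))\<^sup>2" for N
    proof (intro always_eventually allI)
      fix t :: real
      have "norm (\<Sum>n<N. b n * cis (n * t)) \<le> (\<Sum>n<N. norm (b n))"
        by (rule order_trans[OF norm_sum]) (simp add: norm_mult)
      also have "\<dots> \<le> (\<Sum>n. norm (b n))" by (rule sum_le_suminf[OF bsum]) auto
      finally show "norm ((norm (\<Sum>n<N. b n * cis (n * t)))\<^sup>2) \<le> (\<Sum>n. norm (b n))\<^sup>2"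
        by (simp add: power_mono)
    qed
  qed simp
  then have "(\<lambda>N. 2 * pi * (\<Sum>n<N. (norm (b n))\<^sup>2)) \<longlonglongrightarrow> (LINT t|circ. (norm (f (of_real r * cis t)))\<^sup>2)"
    by (subst (asm) integral_circ_trig_poly) auto
  moreover have "(norm (b n))\<^sup>2 = (norm (hcoef f n))\<^sup>2 * r ^ (2 * n)" for n
    using r by (simp add: b_def norm_mult norm_power power_mult_distrib power_mult power_even_eq flip: power_mult)
  ultimately show ?thesis unfolding sums_def sum_distrib_left by simp
qed

text \<open>Each finite partial sum is the limit, as r tends to 1, of the corresponding partial sum
  in Parseval's identity at radius r, which the means bound.\<close>

lemma
  assumes f: "f holomorphic_on ball 0 1"
    and C: "\<forall>r\<in>{0..<1::real}. (LINT t|circ. (norm (f (of_real r * cis t)))\<^sup>2) / (2 * pi) \<le> C"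
  shows bounded_means_summable: "summable (\<lambda>n. (norm (hcoef f n))\<^sup>2)"
    and bounded_means_suminf_le: "(\<Sum>n. (norm (hcoef f n))\<^sup>2) \<le> C"
proof -
  have "(\<Sum>n<N. (norm (hcoef f n))\<^sup>2) \<le> C" for N
  proof -
    have "((\<lambda>r. \<Sum>n<N. (norm (hcoef f n))\<^sup>2 * r ^ (2 * n)) \<longlongrightarrow> (\<Sum>n<N. (norm (hcoef f n))\<^sup>2 * 1 ^ (2 * n))) (at_left (1::real))"
      by (intro tendsto_intros)
    moreover have "\<forall>\<^sub>F r::real in at_left 1. 0 < r \<and> r < 1"
      using eventually_at_left_real[of 0 "1::real"] by simp
    then have "\<forall>\<^sub>F r in at_left (1::real). (\<Sum>n<N. (norm (hcoef f n))\<^sup>2 * r ^ (2 * n)) \<le> C"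
    proof eventually_elim
      case (elim r)
      have s: "(\<lambda>n. 2 * pi * ((norm (hcoef f n))\<^sup>2 * r ^ (2 * n))) sums (LINT t|circ. (norm (f (of_real r * cis t)))\<^sup>2)"
        using elim by (intro circle_mean_square[OF f]) auto
      have "(\<Sum>n<N. 2 * pi * ((norm (hcoef f n))\<^sup>2 * r ^ (2 * n))) \<le> (LINT t|circ. (norm (f (of_real r * cis t)))\<^sup>2)"
        using sum_le_suminf[of "\<lambda>n. 2 * pi * ((norm (hcoef f n))\<^sup>2 * r ^ (2 * n))" "{..<N}"] s elim
        by (simp add: sums_iff)
      also have "\<dots> \<le> 2 * pi * C" using C[rule_format, of r] elim by (simp add: field_simps)
      finally show ?case by (simp add: sum_distrib_left[symmetric])
    qed
    ultimately have "(\<Sum>n<N. (norm (hcoef f n))\<^sup>2 * 1 ^ (2 * n)) \<le> C"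
      by (rule tendsto_upperbound) simp
    then show ?thesis by simp
  qed
  then show "summable (\<lambda>n. (norm (hcoef f n))\<^sup>2)" "(\<Sum>n. (norm (hcoef f n))\<^sup>2) \<le> C"
    by (auto intro!: summableI_nonneg_bounded suminf_le_const)
qed

lemma hardy2_summable:
  assumes "f \<in> hardy2"
  shows "summable (\<lambda>n. (norm (hcoef f n))\<^sup>2)"
proof -
  obtain C where "\<forall>r\<in>{0..<1::real}. (LINT t|circ. (norm (f (of_real r * cis t)))\<^sup>2) / (2 * pi) \<le> C"
    using assms unfolding hardy2_def by blast
  with assms show ?thesis by (intro bounded_means_summable) (auto simp: hardy2_def)
qed

lemma hardy2_mean_le:
  assumes "f \<in> hardy2" "0 \<le> r" "r < 1"
  shows "(LINT t|circ. (norm (f (of_real r * cis t)))\<^sup>2) / (2 * pi) \<le> (\<Sum>n. (norm (hcoef f n))\<^sup>2)"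
proof -
  have h: "f holomorphic_on ball 0 1" using assms(1) by (simp add: hardy2_def)
  have "(LINT t|circ. (norm (f (of_real r * cis t)))\<^sup>2) \<le> 2 * pi * (\<Sum>n. (norm (hcoef f n))\<^sup>2)"
    by (rule sums_le[OF _ circle_mean_square[OF h assms(2,3)] sums_mult[OF summable_sums[OF hardy2_summable[OF assms(1)]]]])
      (use assms in \<open>auto intro!: mult_left_le power_le_one\<close>)
  then show ?thesis by (simp add: field_simps)
qed

text \<open>Used to estimate quotients on small circles by their means on a larger one, when a zero
  is divided out.\<close>

lemma circle_mean_mono:
  assumes h: "f holomorphic_on ball 0 1" and r: "0 \<le> r" "r \<le> s" "s < 1"
  shows "(LINT t|circ. (norm (f (of_real r * cis t)))\<^sup>2) \<le> (LINT t|circ. (norm (f (of_real s * cis t)))\<^sup>2)"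
  by (rule sums_le[OF _ circle_mean_square[OF h] circle_mean_square[OF h]])
    (use r in \<open>auto intro!: mult_left_mono power_mono\<close>)

lemma hardy2_eq_disk_series:
  assumes "f \<in> hardy2" shows "f = disk_series (hcoef f)"
proof
  fix z
  have "f holomorphic_on ball 0 1" using assms by (simp add: hardy2_def)
  then show "f z = disk_series (hcoef f) z"
    using hcoef_sums[of f z] assms by (auto simp: disk_series_def sums_iff hardy2_def)
qed

lemma summable_l2_power:
  fixes a :: "nat \<Rightarrow> complex"
  assumes a: "summable (\<lambda>n. (norm (a n))\<^sup>2)" and z: "norm z < 1"
  shows "summable (\<lambda>n. a n * z ^ n)"
proof (rule summable_comparison_test')
  have "summable (\<lambda>n. ((norm z)\<^sup>2) ^ n)"
    using z by (intro summable_geometric) (simp add: abs_square_less_1)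
  then show "summable (\<lambda>n. (norm (a n))\<^sup>2 + ((norm z)\<^sup>2) ^ n)" by (intro summable_add a)
  fix n
  have "0 \<le> (norm (a n) - norm z ^ n)\<^sup>2 + norm (a n) * norm (a n) + norm z ^ n * norm z ^ n" by simp
  then show "norm (a n * z ^ n) \<le> (norm (a n))\<^sup>2 + ((norm z)\<^sup>2) ^ n"
    by (simp add: norm_mult norm_power power2_eq_square algebra_simps power_mult_distrib)
qed

lemma disk_series_sums:
  fixes a :: "nat \<Rightarrow> complex"
  assumes a: "summable (\<lambda>n. (norm (a n))\<^sup>2)" and z: "norm z < 1"
  shows "(\<lambda>n. a n * z ^ n) sums disk_series a z"
  using summable_l2_power[OF assms] z by (simp add: disk_series_def summable_sums)

lemma hcoef_disk_series:
  fixes a :: "nat \<Rightarrow> complex"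
  assumes a: "summable (\<lambda>n. (norm (a n))\<^sup>2)"
  shows "hcoef (disk_series a) = a"
  by (rule hcoef_unique) (rule disk_series_sums[OF a])

lemma disk_series_hardy2:
  fixes a :: "nat \<Rightarrow> complex"
  assumes a: "summable (\<lambda>n. (norm (a n))\<^sup>2)"
  shows "disk_series a \<in> hardy2"
proof -
  have h: "disk_series a holomorphic_on ball 0 1"
    by (rule power_series_holomorphic[where a=a]) (use disk_series_sums[OF a] in simp)
  have "(LINT t|circ. (norm (disk_series a (of_real r * cis t)))\<^sup>2) / (2 * pi) \<le> (\<Sum>n. (norm (a n))\<^sup>2)"
    if r: "0 \<le> r" "r < 1" for r
  proof -
    have s: "(\<lambda>n. 2 * pi * ((norm (a n))\<^sup>2 * r ^ (2 * n))) sums (LINT t|circ. (norm (disk_series a (of_real r * cis t)))\<^sup>2)"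
      using circle_mean_square[OF h r] unfolding hcoef_disk_series[OF a] .
    have "(LINT t|circ. (norm (disk_series a (of_real r * cis t)))\<^sup>2) \<le> 2 * pi * (\<Sum>n. (norm (a n))\<^sup>2)"
      by (rule sums_le[OF _ s sums_mult[OF summable_sums[OF a]]]) (use r in \<open>auto intro!: mult_left_le power_le_one\<close>)
    then show ?thesis by (simp add: field_simps)
  qed
  then have "\<exists>C. \<forall>r\<in>{0..<1::real}. (LINT t|circ. (norm (disk_series a (of_real r * cis t)))\<^sup>2) / (2 * pi) \<le> C"
    by (intro exI[of _ "\<Sum>n. (norm (a n))\<^sup>2"] ballI) simp
  moreover have "\<forall>z. z \<notin> ball 0 1 \<longrightarrow> disk_series a z = 0" by (simp add: disk_series_def)
  ultimately show ?thesis using h unfolding hardy2_def by blast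
qed


section \<open>Boundary values of Hardy functions and Parseval's identity\<close>

text \<open>The radial limits agree almost everywhere with the mean-square limit \<open>F\<close> of
  the Fourier series, so measurability and norm carry over from \<open>F\<close>.\<close>

lemma
  assumes f: "f \<in> hardy2"
  shows hardy2_radial_limit: "AE t in circ. ((\<lambda>r. f (of_real r * cis t)) \<longlongrightarrow> boundary_value f (cis t)) (at_left 1)" (is ?A)
    and hardy2_boundary_measurable: "(\<lambda>t. boundary_value f (cis t)) \<in> borel_measurable circ" (is ?B)
    and hardy2_boundary_square_integrable: "integrable circ (\<lambda>t. (norm (boundary_value f (cis t)))\<^sup>2)" (is ?C)
    and hardy2_boundary_norm: "(LINT t|circ. (norm (boundary_value f (cis t)))\<^sup>2) = 2 * pi * (\<Sum>n. (norm (hcoef f n))\<^sup>2)" (is ?D)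
proof -
  define a where "a = hcoef f"
  have a: "summable (\<lambda>n. (norm (a n))\<^sup>2)" unfolding a_def by (rule hardy2_summable[OF f])
  define S where "S = (\<lambda>N t. \<Sum>n<N. a n * cis (real n * t))"
  obtain F where Fm: "F \<in> borel_measurable circ"
    and Fi: "\<And>N. integrable circ (\<lambda>t. (norm (F t - (\<Sum>n<N. a n * cis (n * t))))\<^sup>2)"
    and Fle: "\<And>N. (LINT t|circ. (norm (F t - (\<Sum>n<N. a n * cis (n * t))))\<^sup>2) \<le> 2 * pi * (\<Sum>n. (norm (a (n + N)))\<^sup>2)"
    by (rule l2_circle_limit[OF a]) (rule that)
  have lim: "AE t in circ. ((\<lambda>r. f (of_real r * cis t)) \<longlongrightarrow> F t) (at_left 1)"
    using radial_limit_l2_series[OF a Fm Fi Fle]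
  proof eventually_elim
    case (elim t)
    have "\<forall>\<^sub>F r::real in at_left 1. 0 < r \<and> r < 1"
      using eventually_at_left_real[of 0 "1::real"] by simp
    then have "\<forall>\<^sub>F r::real in at_left 1. (\<Sum>n. a n * (of_real r * cis t) ^ n) = f (of_real r * cis t)"
    proof eventually_elim
      case (elim r)
      then show ?case using fun_cong[OF hardy2_eq_disk_series[OF f], of "of_real r * cis t"]
        by (simp add: disk_series_def norm_mult a_def)
    qed
    then show ?case using elim by (rule Lim_transform_eventually[rotated])
  qed
  then have eq: "AE t in circ. F t = boundary_value f (cis t)"
  proof eventually_elim
    case (elim t)
    then show ?case unfolding boundary_value_def by (intro tendsto_Lim[symmetric]) auto
  qed
  show ?A using lim eq by eventually_elim simp
  show m: ?B by (rule borel_measurable_lebesgue_on_AE[OF _ Fm eq]) simp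
  have FI: "integrable circ (\<lambda>t. (norm (F t))\<^sup>2)" using Fi[of 0] by simp
  have cong: "AE t in circ. (norm (F t))\<^sup>2 = (norm (boundary_value f (cis t)))\<^sup>2"
    using eq by eventually_elim simp
  show ?C by (rule integrable_cong_AE_imp[OF FI]) (use m cong in auto)
  define A where "A = (LINT t|circ. (norm (F t))\<^sup>2)"
  have "A = (LINT t|circ. (norm (boundary_value f (cis t)))\<^sup>2)"
    unfolding A_def by (rule integral_cong_AE) (use m Fm cong in auto)
  moreover have "A = 2 * pi * (\<Sum>n. (norm (a n))\<^sup>2)"
  proof (rule antisym)
    show "A \<le> 2 * pi * (\<Sum>n. (norm (a n))\<^sup>2)" using Fle[of 0] by (simp add: A_def)
    \<comment> \<open>The reverse inequality, by a weighted triangle inequality for squares: for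
      fixed e the error term vanishes as N grows, and afterwards e tends to 0.\<close>
    have le: "2 * pi * (\<Sum>n. (norm (a n))\<^sup>2) \<le> (1 + e) * A" if e: "e > 0" for e
    proof (rule LIMSEQ_le)
      show "(\<lambda>N. 2 * pi * (\<Sum>n<N. (norm (a n))\<^sup>2)) \<longlonglongrightarrow> 2 * pi * (\<Sum>n. (norm (a n))\<^sup>2)"
        by (intro tendsto_intros summable_LIMSEQ a)
      show "(\<lambda>N. (1 + e) * A + (1 + 1/e) * (2 * pi * (\<Sum>n. (norm (a (n + N)))\<^sup>2))) \<longlonglongrightarrow> (1 + e) * A"
        using tendsto_add[OF tendsto_const tendsto_mult_left[OF tendsto_mult_left[OF suminf_exist_split2[OF a]]], of "(1 + e) * A" "1 + 1/e" "2 * pi"] by simp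
      show "\<exists>N. \<forall>n\<ge>N. 2 * pi * (\<Sum>n<n. (norm (a n))\<^sup>2) \<le> (1 + e) * A + (1 + 1/e) * (2 * pi * (\<Sum>k. (norm (a (k + n)))\<^sup>2))"
      proof (intro exI[of _ 0] allI impI)
        fix N
        define D where "D = (\<lambda>t. F t - S N t)"
        have DI: "integrable circ (\<lambda>t. (norm (D t))\<^sup>2)" using Fi[of N] by (simp add: D_def S_def)
        have "2 * pi * (\<Sum>n<N. (norm (a n))\<^sup>2) = (LINT t|circ. (norm (S N t))\<^sup>2)"
          unfolding S_def by (rule integral_circ_trig_poly[symmetric]) simp
        also have "\<dots> \<le> (LINT t|circ. (1 + e) * (norm (F t))\<^sup>2 + (1 + 1/e) * (norm (D t))\<^sup>2)"
        proof (intro integral_mono)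
          show "integrable circ (\<lambda>t. (norm (S N t))\<^sup>2)"
            unfolding S_def by (intro integrable_circ_continuous continuous_intros)
          show "integrable circ (\<lambda>t. (1 + e) * (norm (F t))\<^sup>2 + (1 + 1/e) * (norm (D t))\<^sup>2)"
            by (intro Bochner_Integration.integrable_add integrable_mult_right FI DI)
          fix t
          have "norm (S N t) \<le> norm (F t) + norm (D t)"
            using norm_triangle_ineq4[of "F t" "D t"] by (simp add: D_def)
          then have "(norm (S N t))\<^sup>2 \<le> (norm (F t) + norm (D t))\<^sup>2" by (rule power_mono) simp
          also have "\<dots> \<le> (1 + e) * (norm (F t))\<^sup>2 + (1 + 1/e) * (norm (D t))\<^sup>2"
          proof -
            have "0 \<le> (e * norm (F t) - norm (D t))\<^sup>2 / e" using e by simp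
            also have "\<dots> = e * (norm (F t))\<^sup>2 + (1/e) * (norm (D t))\<^sup>2 - 2 * norm (F t) * norm (D t)"
              using e by (simp add: power2_eq_square field_simps)
            finally show ?thesis by (simp add: power2_sum algebra_simps)
          qed
          finally show "(norm (S N t))\<^sup>2 \<le> (1 + e) * (norm (F t))\<^sup>2 + (1 + 1/e) * (norm (D t))\<^sup>2" .
        qed
        also have "\<dots> = (1 + e) * A + (1 + 1/e) * (LINT t|circ. (norm (D t))\<^sup>2)"
          unfolding A_def
          by (subst Bochner_Integration.integral_add) (auto intro!: integrable_mult_right FI DI)
        also have "\<dots> \<le> (1 + e) * A + (1 + 1/e) * (2 * pi * (\<Sum>k. (norm (a (k + N)))\<^sup>2))"
          using Fle[of N] e by (intro add_left_mono mult_left_mono) (auto simp: D_def S_def)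
        finally show "2 * pi * (\<Sum>n<N. (norm (a n))\<^sup>2) \<le> (1 + e) * A + (1 + 1/e) * (2 * pi * (\<Sum>k. (norm (a (k + N)))\<^sup>2))" .
      qed
    qed
    have "((\<lambda>e. (1 + e) * A) \<longlongrightarrow> (1 + 0) * A) (at_right 0)" by (intro tendsto_intros)
    then have "2 * pi * (\<Sum>n. (norm (a n))\<^sup>2) \<le> (1 + 0) * A"
      by (rule tendsto_lowerbound) (auto intro!: eventually_at_right_less[THEN eventually_mono] le)
    then show "2 * pi * (\<Sum>n. (norm (a n))\<^sup>2) \<le> A" by simp
  qed
  ultimately show ?D by (simp add: a_def)
qed


lemma summable_l2_lincomb:
  fixes a b :: "nat \<Rightarrow> complex"
  assumes a: "summable (\<lambda>n. (norm (a n))\<^sup>2)" and b: "summable (\<lambda>n. (norm (b n))\<^sup>2)"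
  shows "summable (\<lambda>n. (norm (a n + c * b n))\<^sup>2)"
proof (rule summable_comparison_test')
  show "summable (\<lambda>n. 2 * (norm (a n))\<^sup>2 + 2 * (norm c)\<^sup>2 * (norm (b n))\<^sup>2)"
    by (intro summable_add summable_mult a b)
  fix n
  define x y where "x = norm (a n)" and "y = norm (c * b n)"
  have "norm (a n + c * b n) \<le> x + y" unfolding x_def y_def by (rule norm_triangle_ineq)
  then have "(norm (a n + c * b n))\<^sup>2 \<le> (x + y)\<^sup>2" by (rule power_mono) simp
  also have "\<dots> \<le> 2 * x\<^sup>2 + 2 * y\<^sup>2"
    using zero_le_power2[of "x - y"] by (simp add: power2_eq_square algebra_simps)
  finally show "norm ((norm (a n + c * b n))\<^sup>2) \<le> 2 * (norm (a n))\<^sup>2 + 2 * (norm c)\<^sup>2 * (norm (b n))\<^sup>2"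
    by (simp add: x_def y_def norm_mult power_mult_distrib)
qed

lemma
  assumes f: "f \<in> hardy2" and g: "g \<in> hardy2"
  shows hardy2_lincomb: "(\<lambda>z. f z + c * g z) \<in> hardy2"
    and hcoef_lincomb: "hcoef (\<lambda>z. f z + c * g z) = (\<lambda>n. hcoef f n + c * hcoef g n)"
proof -
  have fs: "(\<lambda>n. hcoef f n * z ^ n) sums f z" "(\<lambda>n. hcoef g n * z ^ n) sums g z" if "norm z < 1" for z
    using f g that by (auto intro: hcoef_sums simp: hardy2_def)
  have s: "(\<lambda>n. (hcoef f n + c * hcoef g n) * z ^ n) sums (f z + c * g z)" if "norm z < 1" for z
    using sums_add[OF fs(1)[OF that] sums_mult[OF fs(2)[OF that], of c]] by (simp add: algebra_simps)
  then show "hcoef (\<lambda>z. f z + c * g z) = (\<lambda>n. hcoef f n + c * hcoef g n)" by (rule hcoef_unique)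
  have "(\<lambda>z. f z + c * g z) = disk_series (\<lambda>n. hcoef f n + c * hcoef g n)"
    using s f g by (auto simp: disk_series_def sums_iff hardy2_def fun_eq_iff)
  then show "(\<lambda>z. f z + c * g z) \<in> hardy2"
    using summable_l2_lincomb[OF hardy2_summable[OF f] hardy2_summable[OF g], of c] disk_series_hardy2 by simp
qed

lemma hardy2_boundary_lincomb:
  assumes f: "f \<in> hardy2" and g: "g \<in> hardy2"
  shows "AE t in circ. boundary_value (\<lambda>z. f z + c * g z) (cis t) = boundary_value f (cis t) + c * boundary_value g (cis t)"
  using hardy2_radial_limit[OF f] hardy2_radial_limit[OF g]
proof eventually_elim
  case (elim t)
  then have "((\<lambda>r. f (of_real r * cis t) + c * g (of_real r * cis t)) \<longlongrightarrow> boundary_value f (cis t) + c * boundary_value g (cis t)) (at_left 1)"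
    by (intro tendsto_intros)
  then show ?case unfolding boundary_value_def[of "\<lambda>z. f z + c * g z"] by (intro tendsto_Lim) auto
qed

text \<open>The factors 1 and -1 are written out so that all four squares have the shape
  \<open>u + c * v\<close> of \<open>hardy2_lincomb\<close>.\<close>

lemma polarization:
  "u * cnj v = (of_real ((norm (u + 1 * v))\<^sup>2) - of_real ((norm (u + (-1) * v))\<^sup>2)
    + \<i> * of_real ((norm (u + \<i> * v))\<^sup>2) - \<i> * of_real ((norm (u + (-\<i>) * v))\<^sup>2)) / 4"
  unfolding cmod_power2 complex_eq_iff by (simp add: power2_eq_square) (simp add: algebra_simps)

text \<open>Polarization of the norm identity for \<open>f + c * g\<close> with c a fourth root of
  unity; it yields the integrability of the product as well as the value of the integral.\<close>

lemma hardy2_inner_sums: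
  assumes f: "f \<in> hardy2" and g: "g \<in> hardy2"
  shows "(\<lambda>n. hcoef f n * cnj (hcoef g n)) sums hardy2_inner f g"
proof -
  define q where "q = (\<lambda>c. \<Sum>n. (norm (hcoef f n + c * hcoef g n))\<^sup>2)"
  let ?F = "\<lambda>t. boundary_value f (cis t)" and ?G = "\<lambda>t. boundary_value g (cis t)"
  have qs: "(\<lambda>n. complex_of_real ((norm (hcoef f n + c * hcoef g n))\<^sup>2)) sums of_real (q c)" for c
    unfolding q_def sums_of_real_iff
    by (rule summable_sums[OF summable_l2_lincomb[OF hardy2_summable[OF f] hardy2_summable[OF g]]])
  have qi: "has_bochner_integral circ (\<lambda>t. complex_of_real ((norm (?F t + c * ?G t))\<^sup>2)) (of_real (2 * pi * q c))" for c
  proof -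
    let ?H = "\<lambda>t. boundary_value (\<lambda>z. f z + c * g z) (cis t)"
    have h: "(\<lambda>z. f z + c * g z) \<in> hardy2" by (rule hardy2_lincomb[OF f g])
    have "has_bochner_integral circ (\<lambda>t. (norm (?H t))\<^sup>2) (2 * pi * q c)"
      using hardy2_boundary_square_integrable[OF h] hardy2_boundary_norm[OF h]
      by (simp add: has_bochner_integral_iff hcoef_lincomb[OF f g] q_def)
    moreover have "AE t in circ. (norm (?H t))\<^sup>2 = (norm (?F t + c * ?G t))\<^sup>2"
      using hardy2_boundary_lincomb[OF f g, of c] by eventually_elim simp
    ultimately have "has_bochner_integral circ (\<lambda>t. (norm (?F t + c * ?G t))\<^sup>2) (2 * pi * q c)"
      using hardy2_boundary_measurable[OF h] hardy2_boundary_measurable[OF f] hardy2_boundary_measurable[OF g]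
      by (subst (asm) has_bochner_integral_cong_AE) auto
    then show ?thesis by (rule has_bochner_integral_of_real)
  qed
  have "(\<lambda>n. hcoef f n * cnj (hcoef g n)) sums ((of_real (q 1) - of_real (q (-1)) + \<i> * of_real (q \<i>) - \<i> * of_real (q (-\<i>))) / 4)"
    unfolding polarization by (intro sums_divide sums_diff sums_add sums_mult qs)
  moreover have "has_bochner_integral circ (\<lambda>t. ?F t * cnj (?G t))
     ((of_real (2 * pi * q 1) - of_real (2 * pi * q (-1)) + \<i> * of_real (2 * pi * q \<i>) - \<i> * of_real (2 * pi * q (-\<i>))) / 4)"
    unfolding polarization
    by (intro has_bochner_integral_divide_zero has_bochner_integral_diff has_bochner_integral_add has_bochner_integral_mult_right qi)
  note L = has_bochner_integral_integral_eq[OF this]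
  have "hardy2_inner f g = (of_real (q 1) - of_real (q (-1)) + \<i> * of_real (q \<i>) - \<i> * of_real (q (-\<i>))) / 4"
    unfolding hardy2_inner_def circle_inner_def L
    by (simp add: diff_divide_distrib add_divide_distrib)
  ultimately show ?thesis by (simp only:)
qed

section \<open>Multiplication by bounded analytic functions\<close>

lemma
  assumes \<phi>: "\<phi> holomorphic_on ball 0 1" "\<And>z. norm z < 1 \<Longrightarrow> norm (\<phi> z) \<le> B" and f: "f \<in> hardy2"
  shows bounded_times_hardy2: "(\<lambda>z. \<phi> z * f z) \<in> hardy2"
    and bounded_times_hardy2_norm: "(\<Sum>n. (norm (hcoef (\<lambda>z. \<phi> z * f z) n))\<^sup>2) \<le> B\<^sup>2 * (\<Sum>n. (norm (hcoef f n))\<^sup>2)"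
proof -
  have hol: "\<phi> holomorphic_on ball 0 1" "f holomorphic_on ball 0 1"
    using \<phi> f by (auto simp: hardy2_def)
  have bd: "\<forall>r\<in>{0..<1::real}. (LINT t|circ. (norm (\<phi> (of_real r * cis t) * f (of_real r * cis t)))\<^sup>2) / (2 * pi) \<le> B\<^sup>2 * (\<Sum>n. (norm (hcoef f n))\<^sup>2)"
  proof
    fix r :: real assume r: "r \<in> {0..<1}"
    have ci: "integrable circ (\<lambda>t. (norm (h (of_real r * cis t)))\<^sup>2)" if "h holomorphic_on ball 0 1" for h :: "complex \<Rightarrow> complex"
      by (intro integrable_circ_continuous continuous_intros
         continuous_on_compose2[OF holomorphic_on_imp_continuous_on[OF that]]) (use r in \<open>auto simp: norm_mult\<close>)
    have "(LINT t|circ. (norm (\<phi> (of_real r * cis t) * f (of_real r * cis t)))\<^sup>2) \<le> (LINT t|circ. B\<^sup>2 * (norm (f (of_real r * cis t)))\<^sup>2)"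
    proof (rule integral_mono)
      show "integrable circ (\<lambda>t. (norm (\<phi> (of_real r * cis t) * f (of_real r * cis t)))\<^sup>2)"
        by (rule ci) (intro holomorphic_intros hol)
      show "integrable circ (\<lambda>t. B\<^sup>2 * (norm (f (of_real r * cis t)))\<^sup>2)"
        using ci[OF hol(2)] by simp
      show "(norm (\<phi> (of_real r * cis t) * f (of_real r * cis t)))\<^sup>2 \<le> B\<^sup>2 * (norm (f (of_real r * cis t)))\<^sup>2" for t
        unfolding norm_mult power_mult_distrib
        by (intro mult_right_mono power_mono \<phi>) (use r in \<open>auto simp: norm_mult\<close>)
    qed
    then have "(LINT t|circ. (norm (\<phi> (of_real r * cis t) * f (of_real r * cis t)))\<^sup>2) / (2 * pi)
      \<le> B\<^sup>2 * ((LINT t|circ. (norm (f (of_real r * cis t)))\<^sup>2) / (2 * pi))"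
      by (simp add: divide_right_mono)
    also have "\<dots> \<le> B\<^sup>2 * (\<Sum>n. (norm (hcoef f n))\<^sup>2)" using hardy2_mean_le[OF f] r by (intro mult_left_mono) auto
    finally show "(LINT t|circ. (norm (\<phi> (of_real r * cis t) * f (of_real r * cis t)))\<^sup>2) / (2 * pi) \<le> B\<^sup>2 * (\<Sum>n. (norm (hcoef f n))\<^sup>2)" .
  qed
  then show "(\<lambda>z. \<phi> z * f z) \<in> hardy2"
    using f hol unfolding hardy2_def by (auto intro!: holomorphic_intros)
  show "(\<Sum>n. (norm (hcoef (\<lambda>z. \<phi> z * f z) n))\<^sup>2) \<le> B\<^sup>2 * (\<Sum>n. (norm (hcoef f n))\<^sup>2)"
    by (rule bounded_means_suminf_le[OF _ bd]) (intro holomorphic_intros hol)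
qed

lemma hardy_infE:
  assumes "\<phi> \<in> hardy_inf"
  obtains B where "\<phi> holomorphic_on ball 0 1" "\<And>z. norm z < 1 \<Longrightarrow> norm (\<phi> z) \<le> B"
proof -
  obtain B where "\<forall>z\<in>ball 0 1. norm (\<phi> z) \<le> B" using assms by (auto simp: hardy_inf_def bounded_iff)
  with assms show thesis by (intro that[of B]) (auto simp: hardy_inf_def)
qed

lemma hardy_inf_times_hardy2:
  assumes "\<phi> \<in> hardy_inf" "f \<in> hardy2"
  shows "(\<lambda>z. \<phi> z * f z) \<in> hardy2"
  using assms(1) by (rule hardy_infE) (rule bounded_times_hardy2[OF _ _ assms(2)])

text \<open>\<open>hardy_inf\<close> leaves values off the disk free while \<open>hardy2\<close>
  demands zero there. Cutting off makes Fatou's theorem applicable to bounded symbols.\<close>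

lemma hardy_inf_restrict_hardy2:
  assumes \<phi>: "\<phi> \<in> hardy_inf"
  shows "(\<lambda>z. if norm z < 1 then \<phi> z else 0) \<in> hardy2"
proof -
  have "disk_series (\<lambda>n. if n = 0 then 1 else 0) \<in> hardy2"
    by (rule disk_series_hardy2, rule summable_finite[of "{0}"]) auto
  from hardy_inf_times_hardy2[OF \<phi> this]
  have "(\<lambda>z. \<phi> z * disk_series (\<lambda>n. if n = 0 then 1 else 0) z) \<in> hardy2" .
  moreover have "disk_series (\<lambda>n. if n = 0 then 1 else 0) z = (if norm z < 1 then 1 else 0)" for z
    using powser_zero[of "\<lambda>n. if n = 0 then 1 else 0"] sums_unique[OF sums_finite[of "{0}" "\<lambda>n. (if n = 0 then 1 else 0) * z ^ n"]]
    by (auto simp: disk_series_def)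
  then have "(\<lambda>z. \<phi> z * disk_series (\<lambda>n. if n = 0 then 1 else 0) z) = (\<lambda>z. if norm z < 1 then \<phi> z else 0)"
    by auto
  ultimately show ?thesis by simp
qed

lemma hardy_inf_radial_limit:
  assumes \<phi>: "\<phi> \<in> hardy_inf"
  shows "AE t in circ. ((\<lambda>r. \<phi> (of_real r * cis t)) \<longlongrightarrow> boundary_value \<phi> (cis t)) (at_left 1)"
  using hardy2_radial_limit[OF hardy_inf_restrict_hardy2[OF \<phi>]]
proof eventually_elim
  case (elim t)
  have "\<forall>\<^sub>F r::real in at_left 1. 0 < r \<and> r < 1"
    using eventually_at_left_real[of 0 "1::real"] by simp
  then have "\<forall>\<^sub>F r::real in at_left 1. (if norm (of_real r * cis t) < 1 then \<phi> (of_real r * cis t) else 0) = \<phi> (of_real r * cis t)"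
    by eventually_elim (simp add: norm_mult)
  with elim have "((\<lambda>r. \<phi> (of_real r * cis t)) \<longlongrightarrow> boundary_value (\<lambda>z. if norm z < 1 then \<phi> z else 0) (cis t)) (at_left 1)"
    by (rule Lim_transform_eventually)
  moreover from this have "boundary_value \<phi> (cis t) = boundary_value (\<lambda>z. if norm z < 1 then \<phi> z else 0) (cis t)"
    unfolding boundary_value_def[of \<phi>] by (intro tendsto_Lim) auto
  ultimately show ?case by simp
qed

text \<open>Turns the defining condition of \<open>model_proj\<close>, about functions on the
  circle, into inner products in H^2: almost everywhere, a product of boundary values is the
  boundary value of the product.\<close>

lemma circle_inner_hardy2:
  assumes \<phi>: "\<phi> \<in> hardy_inf" and f: "f \<in> hardy2" and k: "k \<in> hardy2" and g: "g \<in> hardy2"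
  shows "circle_inner (\<lambda>\<zeta>. boundary_value \<phi> \<zeta> * boundary_value f \<zeta> - boundary_value k \<zeta>) (boundary_value g)
    = hardy2_inner (\<lambda>z. \<phi> z * f z) g - hardy2_inner k g"
proof -
  let ?h = "\<lambda>z. \<phi> z * f z + (-1) * k z"
  have pf: "(\<lambda>z. \<phi> z * f z) \<in> hardy2" by (rule hardy_inf_times_hardy2[OF \<phi> f])
  have h: "?h \<in> hardy2" by (rule hardy2_lincomb[OF pf k])
  have ae: "AE t in circ. boundary_value ?h (cis t) = boundary_value \<phi> (cis t) * boundary_value f (cis t) - boundary_value k (cis t)"
    using hardy_inf_radial_limit[OF \<phi>] hardy2_radial_limit[OF f] hardy2_radial_limit[OF k]
  proof eventually_elim
    case (elim t)
    then have "((\<lambda>r. \<phi> (of_real r * cis t) * f (of_real r * cis t) + (-1) * k (of_real r * cis t)) \<longlongrightarrow>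
       boundary_value \<phi> (cis t) * boundary_value f (cis t) + (-1) * boundary_value k (cis t)) (at_left 1)"
      by (intro tendsto_intros)
    then show ?case unfolding boundary_value_def[of ?h] by (subst tendsto_Lim) auto
  qed
  have ae': "AE t in circ. boundary_value ?h (cis t) * cnj (boundary_value g (cis t)) =
      (boundary_value \<phi> (cis t) * boundary_value f (cis t) - boundary_value k (cis t)) * cnj (boundary_value g (cis t))"
    using ae by eventually_elim simp
  have m: "(\<lambda>t. boundary_value ?h (cis t) * cnj (boundary_value g (cis t))) \<in> borel_measurable circ"
  proof -
    have "cnj \<in> borel_measurable borel" by (intro borel_measurable_continuous_onI continuous_intros)
    then show ?thesis
      using hardy2_boundary_measurable[OF h] measurable_compose[OF hardy2_boundary_measurable[OF g]]
      by (intro borel_measurable_times) auto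
  qed
  have "(LINT t|circ. boundary_value ?h (cis t) * cnj (boundary_value g (cis t))) =
     (LINT t|circ. (boundary_value \<phi> (cis t) * boundary_value f (cis t) - boundary_value k (cis t)) * cnj (boundary_value g (cis t)))"
    by (rule integral_cong_AE[OF m borel_measurable_lebesgue_on_AE[OF _ m ae'] ae']) simp
  then have "circle_inner (\<lambda>\<zeta>. boundary_value \<phi> \<zeta> * boundary_value f \<zeta> - boundary_value k \<zeta>) (boundary_value g) = hardy2_inner ?h g"
    by (simp add: hardy2_inner_def circle_inner_def)
  also have "\<dots> = hardy2_inner (\<lambda>z. \<phi> z * f z) g - hardy2_inner k g"
  proof (rule sums_unique2[OF hardy2_inner_sums[OF h g]])
    show "(\<lambda>n. hcoef ?h n * cnj (hcoef g n)) sums (hardy2_inner (\<lambda>z. \<phi> z * f z) g - hardy2_inner k g)"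
      using sums_diff[OF hardy2_inner_sums[OF pf g] hardy2_inner_sums[OF k g]]
      unfolding hcoef_lincomb[OF pf k] by (simp add: algebra_simps)
  qed
  finally show ?thesis .
qed

section \<open>The backward shift and co-analytic Toeplitz operators\<close>

lemma hardy2_inner_lincomb_left:
  assumes f: "f \<in> hardy2" and g: "g \<in> hardy2" and h: "h \<in> hardy2"
  shows "hardy2_inner (\<lambda>z. f z + c * g z) h = hardy2_inner f h + c * hardy2_inner g h"
proof (rule sums_unique2[OF hardy2_inner_sums[OF hardy2_lincomb[OF f g] h]])
  show "(\<lambda>n. hcoef (\<lambda>z. f z + c * g z) n * cnj (hcoef h n)) sums (hardy2_inner f h + c * hardy2_inner g h)"
    using sums_add[OF hardy2_inner_sums[OF f h] sums_mult[OF hardy2_inner_sums[OF g h], of c]]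
    unfolding hcoef_lincomb[OF f g] by (simp add: algebra_simps)
qed

lemma hardy2_inner_commute:
  assumes f: "f \<in> hardy2" and g: "g \<in> hardy2"
  shows "hardy2_inner g f = cnj (hardy2_inner f g)"
proof (rule sums_unique2[OF hardy2_inner_sums[OF g f]])
  show "(\<lambda>n. hcoef g n * cnj (hcoef f n)) sums cnj (hardy2_inner f g)"
    using hardy2_inner_sums[OF f g] by (subst sums_cnj[symmetric]) (simp add: mult.commute)
qed

lemma hardy2_inner_lincomb_right:
  assumes f: "f \<in> hardy2" and g: "g \<in> hardy2" and h: "h \<in> hardy2"
  shows "hardy2_inner h (\<lambda>z. f z + c * g z) = hardy2_inner h f + cnj c * hardy2_inner h g"
  using hardy2_inner_lincomb_left[OF assms] hardy2_inner_commute[OF f h] hardy2_inner_commute[OF g h]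
    hardy2_inner_commute[OF hardy2_lincomb[OF f g] h] by simp

lemma zero_hardy2: "(\<lambda>z. 0) \<in> hardy2"
  by (auto simp: hardy2_def)

lemma hcoef_zero: "hcoef (\<lambda>z. 0) = (\<lambda>n. 0)"
  by (rule hcoef_unique) simp

lemma hardy2_inner_zero_left: "h \<in> hardy2 \<Longrightarrow> hardy2_inner (\<lambda>z. 0) h = 0"
  using hardy2_inner_sums[OF zero_hardy2] by (fastforce simp: hcoef_zero dest: sums_unique)

lemma hardy2_inner_self_eq_0:
  assumes f: "f \<in> hardy2" and 0: "hardy2_inner f f = 0"
  shows "f = (\<lambda>z. 0)"
proof -
  have "(\<lambda>n. complex_of_real ((norm (hcoef f n))\<^sup>2)) sums of_real 0"
    using hardy2_inner_sums[OF f f] 0 by (simp add: complex_norm_square del: of_real_power)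
  then have "(\<lambda>n. (norm (hcoef f n))\<^sup>2) sums 0" by (simp only: sums_of_real_iff)
  then have "\<forall>n. (norm (hcoef f n))\<^sup>2 = 0"
    by (subst suminf_eq_zero_iff[OF hardy2_summable[OF f], symmetric]) (auto simp: sums_iff)
  then have "hcoef f = (\<lambda>n. 0)" by auto
  then show ?thesis using hardy2_eq_disk_series[OF f] by (auto simp: disk_series_def)
qed

lemma hardy2_cauchy_schwarz:
  assumes f: "f \<in> hardy2" and g: "g \<in> hardy2"
  shows "norm (hardy2_inner f g) \<le> sqrt (\<Sum>n. (norm (hcoef f n))\<^sup>2) * sqrt (\<Sum>n. (norm (hcoef g n))\<^sup>2)"
proof (rule tendsto_upperbound)
  show "(\<lambda>N. norm (\<Sum>n<N. hcoef f n * cnj (hcoef g n))) \<longlonglongrightarrow> norm (hardy2_inner f g)"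
    using hardy2_inner_sums[OF f g] by (intro tendsto_norm) (simp add: sums_def)
  show "\<forall>\<^sub>F N in sequentially. norm (\<Sum>n<N. hcoef f n * cnj (hcoef g n)) \<le> sqrt (\<Sum>n. (norm (hcoef f n))\<^sup>2) * sqrt (\<Sum>n. (norm (hcoef g n))\<^sup>2)"
  proof (intro always_eventually allI)
    fix N
    have "norm (\<Sum>n<N. hcoef f n * cnj (hcoef g n)) \<le> (\<Sum>n<N. \<bar>norm (hcoef f n)\<bar> * \<bar>norm (hcoef g n)\<bar>)"
      by (rule order_trans[OF norm_sum]) (simp add: norm_mult)
    also have "\<dots> \<le> L2_set (\<lambda>n. norm (hcoef f n)) {..<N} * L2_set (\<lambda>n. norm (hcoef g n)) {..<N}"
      by (rule L2_set_mult_ineq)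
    also have "\<dots> \<le> sqrt (\<Sum>n. (norm (hcoef f n))\<^sup>2) * sqrt (\<Sum>n. (norm (hcoef g n))\<^sup>2)"
      unfolding L2_set_def
      by (intro mult_mono real_sqrt_le_mono sum_le_suminf real_sqrt_ge_zero sum_nonneg suminf_nonneg hardy2_summable f g) auto
    finally show "norm (\<Sum>n<N. hcoef f n * cnj (hcoef g n)) \<le> sqrt (\<Sum>n. (norm (hcoef f n))\<^sup>2) * sqrt (\<Sum>n. (norm (hcoef g n))\<^sup>2)" .
  qed
qed simp

definition bshift :: "(complex \<Rightarrow> complex) \<Rightarrow> complex \<Rightarrow> complex" where
  "bshift f = disk_series (\<lambda>n. hcoef f (Suc n))"

lemma
  assumes f: "f \<in> hardy2"
  shows bshift_hardy2: "bshift f \<in> hardy2" and hcoef_bshift: "hcoef (bshift f) n = hcoef f (Suc n)"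
proof -
  have s: "summable (\<lambda>n. (norm (hcoef f (Suc n)))\<^sup>2)"
    using hardy2_summable[OF f] by (subst summable_Suc_iff)
  show "bshift f \<in> hardy2" "hcoef (bshift f) n = hcoef f (Suc n)"
    unfolding bshift_def using disk_series_hardy2[OF s] hcoef_disk_series[OF s] by auto
qed

lemma
  assumes f: "f \<in> hardy2"
  shows shift_hardy2: "(\<lambda>z. z * f z) \<in> hardy2"
    and hcoef_shift: "hcoef (\<lambda>z. z * f z) = (\<lambda>n. case n of 0 \<Rightarrow> 0 | Suc m \<Rightarrow> hcoef f m)"
proof -
  show "(\<lambda>z. z * f z) \<in> hardy2"
    using bounded_times_hardy2[OF holomorphic_on_ident, of 1 f] f by simp
  show "hcoef (\<lambda>z. z * f z) = (\<lambda>n. case n of 0 \<Rightarrow> 0 | Suc m \<Rightarrow> hcoef f m)"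
  proof (rule hcoef_unique)
    fix z :: complex assume "norm z < 1"
    then have "(\<lambda>n. hcoef f n * z ^ n) sums f z"
      using f by (intro hcoef_sums) (auto simp: hardy2_def)
    from sums_mult[OF this, of z] show "(\<lambda>n. (case n of 0 \<Rightarrow> 0 | Suc m \<Rightarrow> hcoef f m) * z ^ n) sums (z * f z)"
      using sums_Suc_iff[of "\<lambda>n. (case n of 0 \<Rightarrow> 0 | Suc m \<Rightarrow> hcoef f m) * z ^ n" "z * f z"] by (simp add: mult_ac)
  qed
qed

lemma hardy2_inner_bshift:
  assumes f: "f \<in> hardy2" and g: "g \<in> hardy2"
  shows "hardy2_inner f (bshift g) = hardy2_inner (\<lambda>z. z * f z) g"
proof (rule sums_unique2[OF hardy2_inner_sums[OF f bshift_hardy2[OF g]]])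
  show "(\<lambda>n. hcoef f n * cnj (hcoef (bshift g) n)) sums hardy2_inner (\<lambda>z. z * f z) g"
    using hardy2_inner_sums[OF shift_hardy2[OF f] g] unfolding hcoef_shift[OF f] hcoef_bshift[OF g]
    using sums_Suc_iff[of "\<lambda>n. (case n of 0 \<Rightarrow> 0 | Suc m \<Rightarrow> hcoef f m) * cnj (hcoef g n)" "hardy2_inner (\<lambda>z. z * f z) g"] by simp
qed

text \<open>The Riesz representative is the image of \<^term>\<open>g\<close> under the co-analytic Toeplitz operator
  whose
  symbol is the conjugate of \<^term>\<open>\<phi>\<close>.\<close>

lemma coanalytic_toeplitz_exists:
  assumes \<phi>: "\<phi> \<in> hardy_inf" and g: "g \<in> hardy2"
  obtains k where "k \<in> hardy2" "\<And>h. h \<in> hardy2 \<Longrightarrow> hardy2_inner (\<lambda>z. \<phi> z * h z) g = hardy2_inner h k"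
proof -
  obtain B0 where B0: "\<phi> holomorphic_on ball 0 1" "\<And>z. norm z < 1 \<Longrightarrow> norm (\<phi> z) \<le> B0"
    using \<phi> by (rule hardy_infE) (rule that)
  have B: "norm (\<phi> z) \<le> \<bar>B0\<bar>" if "norm z < 1" for z using B0(2)[OF that] by simp
  define B where "B = \<bar>B0\<bar>"
  define E where "E = (\<lambda>h. \<Sum>n. (norm (hcoef h n))\<^sup>2)"
  have E0: "0 \<le> E h" if "h \<in> hardy2" for h unfolding E_def by (intro suminf_nonneg hardy2_summable that) auto
  define P where "P = (\<lambda>h. hardy2_inner (\<lambda>z. \<phi> z * h z) g)"
  have ph: "(\<lambda>z. \<phi> z * h z) \<in> hardy2" if "h \<in> hardy2" for h
    by (rule hardy_inf_times_hardy2[OF \<phi> that])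
  have Pb: "norm (P h) \<le> B * sqrt (E h) * sqrt (E g)" if h: "h \<in> hardy2" for h
  proof -
    have "norm (P h) \<le> sqrt (E (\<lambda>z. \<phi> z * h z)) * sqrt (E g)"
      unfolding P_def E_def by (rule hardy2_cauchy_schwarz[OF ph[OF h] g])
    also have "sqrt (E (\<lambda>z. \<phi> z * h z)) \<le> sqrt (B\<^sup>2 * E h)"
      unfolding E_def B_def by (rule real_sqrt_le_mono[OF bounded_times_hardy2_norm[OF B0(1) B h]])
    also have "\<dots> = B * sqrt (E h)" by (simp add: real_sqrt_mult B_def)
    finally show ?thesis using E0[OF g] by (simp add: mult_right_mono)
  qed
  have Plin: "P (\<lambda>z. f z + c * h z) = P f + c * P h" if "f \<in> hardy2" "h \<in> hardy2" for f h c
    using hardy2_inner_lincomb_left[OF ph[OF that(1)] ph[OF that(2)] g, of c] by (simp add: P_def algebra_simps)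
  define mono where "mono = (\<lambda>n z. if norm (z::complex) < 1 then z ^ n else (0::complex))"
  have fin: "summable (\<lambda>n. (norm (if n < N then a n else 0))\<^sup>2)" for N and a :: "nat \<Rightarrow> complex"
    by (rule summable_finite[of "{..<N}"]) auto
  define trunc where "trunc = (\<lambda>a N. disk_series (\<lambda>n. if n < N then a n else 0 :: complex))"
  have tr: "trunc a N \<in> hardy2" "hcoef (trunc a N) = (\<lambda>n. if n < N then a n else 0)" for a N
    unfolding trunc_def by (intro disk_series_hardy2 hcoef_disk_series fin)+
  have trE: "E (trunc a N) = (\<Sum>n<N. (norm (a n))\<^sup>2)" for a N
    unfolding E_def tr by (subst suminf_finite[of "{..<N}"]) auto
  have trz: "trunc a N z = (if norm z < 1 then \<Sum>n<N. a n * z ^ n else 0)" for a N z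
    unfolding trunc_def disk_series_def by (subst suminf_finite[of "{..<N}"]) auto
  have mono: "mono n \<in> hardy2" for n
  proof -
    have "mono n = trunc (\<lambda>k. if k = n then 1 else 0) (Suc n)"
      by (auto simp: mono_def trz fun_eq_iff if_distrib[of "\<lambda>x. x * _"] cong: if_cong)
    then show ?thesis using tr by simp
  qed
  have Ptr: "P (trunc a N) = (\<Sum>n<N. a n * P (mono n))" for a N
  proof (induction N)
    case 0
    have "trunc a 0 = (\<lambda>z. 0)" by (auto simp: trz)
    then show ?case using hardy2_inner_zero_left[OF g] by (simp add: P_def)
  next
    case (Suc N)
    have "trunc a (Suc N) = (\<lambda>z. trunc a N z + a N * mono N z)" by (auto simp: trz mono_def)
    then show ?case using Plin[OF tr(1) mono] Suc by simp
  qed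
  \<comment> \<open>The Taylor coefficients of the representative, forced by testing on
    monomials.\<close>
  define k where "k = (\<lambda>n. cnj (P (mono n)))"
  \<comment> \<open>Testing \<open>P\<close> on the truncation of k itself gives
    \<open>S \<le> B * sqrt S * sqrt (E g)\<close>; squaring and cancelling \<open>S\<close> bounds
    the partial sums independently of N.\<close>
  have kb: "(\<Sum>n<N. (norm (k n))\<^sup>2) \<le> B\<^sup>2 * E g" for N
  proof -
    define S where "S = (\<Sum>n<N. (norm (k n))\<^sup>2)"
    have S0: "0 \<le> S" unfolding S_def by (rule sum_nonneg) auto
    have "P (trunc k N) = of_real S"
      unfolding Ptr S_def of_real_sum complex_norm_square by (simp add: k_def mult.commute)
    then have "S \<le> B * sqrt S * sqrt (E g)" using Pb[OF tr(1), of k N] S0 unfolding trE S_def[symmetric] by simp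
    then have "S\<^sup>2 \<le> (B * sqrt S * sqrt (E g))\<^sup>2" using S0 by (rule power_mono)
    also have "\<dots> = S * (B\<^sup>2 * E g)" using S0 E0[OF g] by (simp add: power_mult_distrib)
    finally have "S * S \<le> S * (B\<^sup>2 * E g)" by (simp add: power2_eq_square)
    then show ?thesis using S0 E0[OF g] unfolding S_def[symmetric]
      by (cases "S = 0") auto
  qed
  have ks: "summable (\<lambda>n. (norm (k n))\<^sup>2)"
    by (rule summableI_nonneg_bounded[OF _ kb]) simp
  show thesis
  proof (rule that[OF disk_series_hardy2[OF ks]])
    fix h assume h: "h \<in> hardy2"
    have 1: "(\<lambda>N. P (trunc (hcoef h) N)) \<longlonglongrightarrow> hardy2_inner h (disk_series k)"
      using hardy2_inner_sums[OF h disk_series_hardy2[OF ks]] unfolding hcoef_disk_series[OF ks] Ptr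
      by (simp add: sums_def k_def)
    have 2: "(\<lambda>N. P h - P (trunc (hcoef h) N)) \<longlonglongrightarrow> 0"
    proof (rule Lim_null_comparison[OF always_eventually], rule allI)
      fix N
      let ?R = "\<lambda>z. h z + (-1) * trunc (hcoef h) N z"
      have R: "?R \<in> hardy2" by (rule hardy2_lincomb[OF h tr(1)])
      have "E ?R = (\<Sum>n. (norm (hcoef h (n + N)))\<^sup>2)"
      proof -
        have s: "summable (\<lambda>n. (norm (hcoef ?R n))\<^sup>2)" by (rule hardy2_summable[OF R])
        have "E ?R = (\<Sum>n. (norm (hcoef ?R (n + N)))\<^sup>2) + (\<Sum>n<N. (norm (hcoef ?R n))\<^sup>2)"
          unfolding E_def by (rule suminf_split_initial_segment[OF s])
        then show ?thesis unfolding hcoef_lincomb[OF h tr(1)] tr by simp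
      qed
      moreover have "P h - P (trunc (hcoef h) N) = P ?R" using Plin[OF h tr(1), of "-1"] by simp
      ultimately show "norm (P h - P (trunc (hcoef h) N)) \<le> B * sqrt (\<Sum>n. (norm (hcoef h (n + N)))\<^sup>2) * sqrt (E g)"
        using Pb[OF R] by simp
    next
      have "(\<lambda>N. B * sqrt (\<Sum>n. (norm (hcoef h (n + N)))\<^sup>2) * sqrt (E g)) \<longlonglongrightarrow> B * sqrt 0 * sqrt (E g)"
        by (intro tendsto_intros suminf_exist_split2[OF hardy2_summable[OF h]])
      then show "(\<lambda>N. B * sqrt (\<Sum>n. (norm (hcoef h (n + N)))\<^sup>2) * sqrt (E g)) \<longlonglongrightarrow> 0" by simp
    qed
    have "(\<lambda>N. P h - (P h - P (trunc (hcoef h) N))) \<longlonglongrightarrow> P h - 0"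
      by (intro tendsto_diff tendsto_const 2)
    then show "hardy2_inner (\<lambda>z. \<phi> z * h z) g = hardy2_inner h (disk_series k)"
      using 1 LIMSEQ_unique by (fastforce simp: P_def)
  qed
qed

section \<open>Model spaces and their invariance under adjoint operators\<close>

lemma model_carrier_hardy2: "f \<in> model_carrier \<Theta> \<Longrightarrow> f \<in> hardy2"
  by (simp add: model_carrier_def)

lemma model_carrier_lincomb:
  assumes \<Theta>: "\<Theta> \<in> hardy_inf" and f: "f \<in> model_carrier \<Theta>" and g: "g \<in> model_carrier \<Theta>"
  shows "(\<lambda>z. f z + c * g z) \<in> model_carrier \<Theta>"
  unfolding model_carrier_def
proof (intro CollectI conjI ballI)
  show "(\<lambda>z. f z + c * g z) \<in> hardy2" using f g by (intro hardy2_lincomb) (auto simp: model_carrier_def)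
  fix h assume h: "h \<in> hardy2"
  show "hardy2_inner (\<lambda>z. f z + c * g z) (\<lambda>z. \<Theta> z * h z) = 0"
    using f g h by (subst hardy2_inner_lincomb_left)
      (auto simp: model_carrier_def hardy_inf_times_hardy2[OF \<Theta>])
qed

text \<open>By duality: \<open>bshift\<close> is the adjoint of multiplication by z, which maps the
  multiples of \<Theta> into themselves.\<close>

lemma model_carrier_bshift:
  assumes \<Theta>: "\<Theta> \<in> hardy_inf" and g: "g \<in> model_carrier \<Theta>"
  shows "bshift g \<in> model_carrier \<Theta>"
  unfolding model_carrier_def
proof (intro CollectI conjI ballI)
  note g2 = model_carrier_hardy2[OF g]
  show "bshift g \<in> hardy2" by (rule bshift_hardy2[OF g2])
  fix h assume h: "h \<in> hardy2"
  have \<Theta>h: "(\<lambda>z. \<Theta> z * h z) \<in> hardy2" by (rule hardy_inf_times_hardy2[OF \<Theta> h])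
  have "hardy2_inner (\<lambda>z. \<Theta> z * h z) (bshift g) = hardy2_inner (\<lambda>z. \<Theta> z * (z * h z)) g"
    unfolding hardy2_inner_bshift[OF \<Theta>h g2] by (simp add: mult_ac)
  also have "\<dots> = cnj (hardy2_inner g (\<lambda>z. \<Theta> z * (z * h z)))"
    by (rule hardy2_inner_commute[OF g2 hardy_inf_times_hardy2[OF \<Theta> shift_hardy2[OF h]]])
  also have "hardy2_inner g (\<lambda>z. \<Theta> z * (z * h z)) = 0"
    using g shift_hardy2[OF h] by (auto simp: model_carrier_def)
  finally show "hardy2_inner (bshift g) (\<lambda>z. \<Theta> z * h z) = 0"
    using hardy2_inner_commute[OF \<Theta>h bshift_hardy2[OF g2]] by simp
qed

text \<open>An eigenvector of the adjoint of the compression of multiplication by \<open>\<phi>\<close> is an eigenvector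
  of the adjoint on all of \<open>H\<^sup>2\<close>, because the co-analytic Toeplitz operator leaves the model space
  invariant.\<close>

lemma model_carrier_adjoint_eigenvector:
  assumes \<Theta>: "\<Theta> \<in> hardy_inf" and \<phi>: "\<phi> \<in> hardy_inf" and g: "g \<in> model_carrier \<Theta>"
    and eig: "\<And>f. f \<in> model_carrier \<Theta> \<Longrightarrow> hardy2_inner (\<lambda>z. \<phi> z * f z) g = \<alpha> * hardy2_inner f g"
    and h: "h \<in> hardy2"
  shows "hardy2_inner (\<lambda>z. \<phi> z * h z) g = \<alpha> * hardy2_inner h g"
proof -
  note g2 = model_carrier_hardy2[OF g]
  obtain k where k: "k \<in> hardy2" "\<And>h. h \<in> hardy2 \<Longrightarrow> hardy2_inner (\<lambda>z. \<phi> z * h z) g = hardy2_inner h k"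
    using coanalytic_toeplitz_exists[OF \<phi> g2] by metis
  have kK: "k \<in> model_carrier \<Theta>"
    unfolding model_carrier_def
  proof (intro CollectI conjI ballI k(1))
    fix h assume h: "h \<in> hardy2"
    have 1: "(\<lambda>z. \<Theta> z * h z) \<in> hardy2" by (rule hardy_inf_times_hardy2[OF \<Theta> h])
    have 2: "(\<lambda>z. \<phi> z * h z) \<in> hardy2" by (rule hardy_inf_times_hardy2[OF \<phi> h])
    have "hardy2_inner (\<lambda>z. \<Theta> z * h z) k = hardy2_inner (\<lambda>z. \<Theta> z * (\<phi> z * h z)) g"
      unfolding k(2)[OF 1, symmetric] by (simp add: mult_ac)
    also have "\<dots> = cnj (hardy2_inner g (\<lambda>z. \<Theta> z * (\<phi> z * h z)))"
      by (rule hardy2_inner_commute[OF g2 hardy_inf_times_hardy2[OF \<Theta> 2]])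
    also have "\<dots> = 0" using g 2 by (auto simp: model_carrier_def)
    finally show "hardy2_inner k (\<lambda>z. \<Theta> z * h z) = 0"
      using hardy2_inner_commute[OF 1 k(1)] by simp
  qed
  let ?d = "\<lambda>z. k z + (- cnj \<alpha>) * g z"
  have d: "?d \<in> model_carrier \<Theta>" by (rule model_carrier_lincomb[OF \<Theta> kK g])
  have "hardy2_inner f ?d = 0" if "f \<in> model_carrier \<Theta>" for f
    using eig[OF that] k(2)[OF model_carrier_hardy2[OF that]]
    by (subst hardy2_inner_lincomb_right[OF k(1) g2 model_carrier_hardy2[OF that]]) simp
  then have "?d = (\<lambda>z. 0)" using d by (intro hardy2_inner_self_eq_0) (auto intro: model_carrier_hardy2)
  then have "k = (\<lambda>z. 0 + cnj \<alpha> * g z)" by (auto simp: fun_eq_iff)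
  then have "hardy2_inner h k = \<alpha> * hardy2_inner h g"
    using hardy2_inner_lincomb_right[OF zero_hardy2 g2 h, of "cnj \<alpha>"] hardy2_inner_commute[OF zero_hardy2 h] hardy2_inner_zero_left[OF h] by simp
  then show ?thesis using k(2)[OF h] by simp
qed

text \<open>The eigenvalue equation is a first-order recursion for the coefficients, and square
  summability of the resulting geometric sequence forces the eigenvalue into the open disk.\<close>

lemma bshift_eigenvector:
  assumes g: "g \<in> hardy2" and eig: "bshift g = (\<lambda>z. \<mu> * g z)" and nz: "g \<noteq> (\<lambda>z. 0)"
  shows "hcoef g n = hcoef g 0 * \<mu> ^ n" "hcoef g 0 \<noteq> 0" "norm \<mu> < 1"
proof -
  have s: "hcoef g (Suc n) = \<mu> * hcoef g n" for n
    using hcoef_bshift[OF g, of n] hcoef_lincomb[OF zero_hardy2 g, of \<mu>] by (simp add: eig hcoef_zero)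
  show p: "hcoef g n = hcoef g 0 * \<mu> ^ n" for n by (induction n) (auto simp: s)
  show c0: "hcoef g 0 \<noteq> 0"
  proof
    assume "hcoef g 0 = 0"
    then have "hcoef g n = 0" for n using p[of n] by simp
    then have 0: "hcoef g = (\<lambda>n. 0)" by blast
    show False using hardy2_eq_disk_series[OF g] nz unfolding 0 by (auto simp: disk_series_def)
  qed
  have eq: "(norm (hcoef g n))\<^sup>2 = (norm (hcoef g 0))\<^sup>2 * ((norm \<mu>)\<^sup>2) ^ n" for n
  proof -
    have "norm (hcoef g n) = norm (hcoef g 0) * norm \<mu> ^ n" by (subst p) (simp add: norm_mult norm_power)
    moreover have "(norm \<mu> ^ n)\<^sup>2 = ((norm \<mu>)\<^sup>2) ^ n" by (simp add: power_mult[symmetric] mult.commute)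
    ultimately show ?thesis by (simp add: power_mult_distrib)
  qed
  have "summable (\<lambda>n. (norm (hcoef g 0))\<^sup>2 * ((norm \<mu>)\<^sup>2) ^ n)"
    using hardy2_summable[OF g] unfolding ext[of "\<lambda>n. (norm (hcoef g n))\<^sup>2", OF eq] .
  then have "summable (\<lambda>n. ((norm \<mu>)\<^sup>2) ^ n)" using c0 by (subst (asm) summable_cmult_iff) simp
  then have "(norm \<mu>)\<^sup>2 < 1" by (subst (asm) summable_geometric_iff) simp
  then show "norm \<mu> < 1" by (simp add: abs_square_less_1)
qed

section \<open>Adjoint eigenvectors of truncated Toeplitz operators\<close>

lemma cvec_inner_add_left: "cvec_inner (u + v) w = cvec_inner u w + cvec_inner v w"
  by (simp add: cvec_inner_def algebra_simps sum.distrib)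

lemma cvec_inner_scale_left: "cvec_inner (c *s u) w = c * cvec_inner u w"
  by (simp add: cvec_inner_def algebra_simps sum_distrib_left)

lemma cvec_inner_commute: "cvec_inner v u = cnj (cvec_inner u v)"
  by (simp add: cvec_inner_def mult.commute)

lemma cvec_inner_add_right: "cvec_inner w (u + v) = cvec_inner w u + cvec_inner w v"
  by (simp add: cvec_inner_def algebra_simps sum.distrib)

lemma cvec_inner_scale_right: "cvec_inner w (c *s u) = cnj c * cvec_inner w u"
  by (simp add: cvec_inner_def algebra_simps sum_distrib_left)

lemma cvec_inner_sum_left: "cvec_inner (\<Sum>i\<in>A. f i) w = (\<Sum>i\<in>A. cvec_inner (f i) w)"
  by (induction A rule: infinite_finite_induct) (auto simp: cvec_inner_add_left, auto simp: cvec_inner_def)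

lemma cvec_inner_sum_right: "cvec_inner w (\<Sum>i\<in>A. f i) = (\<Sum>i\<in>A. cvec_inner w (f i))"
  by (induction A rule: infinite_finite_induct) (auto simp: cvec_inner_add_right, auto simp: cvec_inner_def)

lemma cvec_inner_self: "cvec_inner x x = of_real ((norm x)\<^sup>2)"
  unfolding cvec_inner_def norm_vec_def L2_set_def
  by (simp add: sum_nonneg complex_norm_square del: of_real_power)

lemma cvec_inner_eq_zero: "(\<And>v. cvec_inner v u = 0) \<Longrightarrow> u = 0"
  using cvec_inner_self[of u] by simp

lemma cvec_inner_conj_transpose: "cvec_inner (A *v u) v = cvec_inner u (conj_transpose A *v v)"
proof -
  have "cvec_inner (A *v u) v = (\<Sum>i\<in>UNIV. \<Sum>j\<in>UNIV. A $ i $ j * u $ j * cnj (v $ i))"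
    by (simp add: cvec_inner_def matrix_vector_mult_def sum_distrib_right)
  also have "\<dots> = (\<Sum>j\<in>UNIV. \<Sum>i\<in>UNIV. A $ i $ j * u $ j * cnj (v $ i))"
    by (rule sum.swap)
  also have "\<dots> = cvec_inner u (conj_transpose A *v v)"
    by (simp add: cvec_inner_def matrix_vector_mult_def conj_transpose_def sum_distrib_left mult_ac)
  finally show ?thesis .
qed

text \<open>\<open>model_proj\<close> is a definite description, so a candidate has to be supplied.
  The difference of two candidates lies in the model space and is orthogonal to it.\<close>

lemma truncated_toeplitz_eqI:
  assumes \<Theta>: "\<Theta> \<in> hardy_inf" and \<phi>: "\<phi> \<in> hardy_inf" and f: "f \<in> hardy2" and k: "k \<in> model_carrier \<Theta>"
    and eq: "\<And>g. g \<in> model_carrier \<Theta> \<Longrightarrow> hardy2_inner (\<lambda>z. \<phi> z * f z) g = hardy2_inner k g"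
  shows "truncated_toeplitz \<Theta> \<phi> f = k"
  unfolding truncated_toeplitz_def model_proj_def
proof (rule the_equality)
  note k2 = model_carrier_hardy2[OF k]
  show "k \<in> model_carrier \<Theta> \<and> (\<forall>g\<in>model_carrier \<Theta>. circle_inner
     (\<lambda>\<zeta>. boundary_value \<phi> \<zeta> * boundary_value f \<zeta> - boundary_value k \<zeta>) (boundary_value g) = 0)"
    using k eq by (auto simp: circle_inner_hardy2[OF \<phi> f k2 model_carrier_hardy2])
  fix k' assume k': "k' \<in> model_carrier \<Theta> \<and> (\<forall>g\<in>model_carrier \<Theta>. circle_inner
     (\<lambda>\<zeta>. boundary_value \<phi> \<zeta> * boundary_value f \<zeta> - boundary_value k' \<zeta>) (boundary_value g) = 0)"
  then have k'2: "k' \<in> hardy2" by (auto intro: model_carrier_hardy2)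
  let ?d = "\<lambda>z. k' z + (-1) * k z"
  have d: "?d \<in> model_carrier \<Theta>" using k k' by (intro model_carrier_lincomb[OF \<Theta>]) auto
  have "circle_inner (\<lambda>\<zeta>. boundary_value \<phi> \<zeta> * boundary_value f \<zeta> - boundary_value k' \<zeta>) (boundary_value ?d) = 0"
    using k' d by blast
  then have "hardy2_inner k' ?d = hardy2_inner k ?d"
    unfolding circle_inner_hardy2[OF \<phi> f k'2 model_carrier_hardy2[OF d]] eq[OF d] by simp
  then have "hardy2_inner ?d ?d = 0"
    by (subst hardy2_inner_lincomb_left[OF k'2 k2 model_carrier_hardy2[OF d]]) simp
  then have "?d = (\<lambda>z. 0)" by (rule hardy2_inner_self_eq_0[OF model_carrier_hardy2[OF d]])
  then show "k' = k" by (simp add: fun_eq_iff)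
qed

lemma
  fixes U :: "complex ^ 'n::finite \<Rightarrow> complex \<Rightarrow> complex"
  assumes U: "unitary_map cvec_space (model_space \<Theta>) U"
  shows unitary_cvec_model_range: "range U = model_carrier \<Theta>"
    and unitary_cvec_model_mem: "U v \<in> model_carrier \<Theta>"
    and unitary_cvec_model_add: "U (v + w) = (\<lambda>z. U v z + U w z)"
    and unitary_cvec_model_scale: "U (c *s v) = (\<lambda>z. c * U v z)"
    and unitary_cvec_model_inner: "hardy2_inner (U v) (U w) = cvec_inner v w"
  using U by (auto simp: unitary_map_def cvec_space_def model_space_def)

text \<open>The projection exists because \<open>U\<close> makes the model space finite-dimensional:
  the functional \<open>L\<close> is represented by the vector \<open>w\<close> of its values on the
  standard basis, and \<open>U w\<close> is the projection.\<close>

lemma truncated_toeplitz_inner: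
  fixes U :: "complex ^ 'n::finite \<Rightarrow> complex \<Rightarrow> complex"
  assumes \<Theta>: "\<Theta> \<in> hardy_inf" and \<phi>: "\<phi> \<in> hardy_inf"
    and U: "unitary_map cvec_space (model_space \<Theta>) U"
    and f: "f \<in> model_carrier \<Theta>" and g: "g \<in> model_carrier \<Theta>"
  shows "hardy2_inner (truncated_toeplitz \<Theta> \<phi> f) g = hardy2_inner (\<lambda>z. \<phi> z * f z) g"
proof -
  note Us = unitary_cvec_model_range[OF U] unitary_cvec_model_mem[OF U] unitary_cvec_model_add[OF U]
    unitary_cvec_model_scale[OF U] unitary_cvec_model_inner[OF U]
  note U2 = model_carrier_hardy2[OF Us(2)]
  have pf: "(\<lambda>z. \<phi> z * f z) \<in> hardy2" by (rule hardy_inf_times_hardy2[OF \<phi> model_carrier_hardy2[OF f]])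
  define L where "L = (\<lambda>v. hardy2_inner (\<lambda>z. \<phi> z * f z) (U v))"
  have La: "L (v + c *s w) = L v + cnj c * L w" for v c w
    using hardy2_inner_lincomb_right[OF U2 U2 pf, of v c w] by (simp add: L_def Us(3,4))
  have L0: "L 0 = 0" using La[of 0 "-1" 0] by simp
  have Ls: "L (\<Sum>i\<in>A. c i *s b i) = (\<Sum>i\<in>A. cnj (c i) * L (b i))" if "finite A" for A :: "'n set" and c b
    using that
  proof induction
    case (insert i A)
    then show ?case using La[of "\<Sum>i\<in>A. c i *s b i" "c i" "b i"] by (simp add: add.commute)
  qed (simp add: L0)
  define w where "w = (\<chi> i. L (axis i 1))"
  have Lw: "L v = cvec_inner w v" for v
    using Ls[OF finite, where A=UNIV and c="\<lambda>i. v $ i" and b="\<lambda>i. axis i 1"] unfolding basis_expansion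
    by (simp add: cvec_inner_def w_def mult.commute)
  have "truncated_toeplitz \<Theta> \<phi> f = U w"
  proof (rule truncated_toeplitz_eqI[OF \<Theta> \<phi> model_carrier_hardy2[OF f] Us(2)])
    fix g assume "g \<in> model_carrier \<Theta>"
    then obtain v where "g = U v" using Us(1) by auto
    then show "hardy2_inner (\<lambda>z. \<phi> z * f z) g = hardy2_inner (U w) g"
      using Lw[of v] by (simp add: L_def Us(5))
  qed
  moreover obtain v where "g = U v" using g Us(1) by auto
  ultimately show ?thesis using Lw[of v] by (simp add: L_def Us(5))
qed

theorem tto_adjoint_gram:
  fixes M :: "complex ^ 'n ^ 'n::finite" and y :: "'n \<Rightarrow> complex ^ 'n"
  assumes M: "ue_analytic_tto M"
    and y: "\<And>i. conj_transpose M *v y i = cnj (l i) *s y i" "\<And>i. y i \<noteq> 0"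
    and simple: "\<And>i u. conj_transpose M *v u = cnj (l i) *s u \<Longrightarrow> \<exists>c. u = c *s y i"
  obtains c \<mu> where "\<And>i. c i \<noteq> 0" "\<And>i. norm (\<mu> i) < 1"
    "\<And>i j. cvec_inner (y i) (y j) = c i * cnj (c j) / (1 - \<mu> i * cnj (\<mu> j))"
proof -
  obtain \<Theta> \<phi> U where \<Theta>: "\<Theta> \<in> hardy_inf" and \<phi>: "\<phi> \<in> hardy_inf"
    and U: "unitary_map cvec_space (model_space \<Theta>) U"
    and UM: "\<And>v. U (M *v v) = truncated_toeplitz \<Theta> \<phi> (U v)"
    using M by (auto simp: ue_analytic_tto_def unitarily_equivalent_def inner_function_def cvec_space_def)
  note Us = unitary_cvec_model_range[OF U] unitary_cvec_model_mem[OF U] unitary_cvec_model_add[OF U]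
    unitary_cvec_model_scale[OF U] unitary_cvec_model_inner[OF U]
  note U2 = model_carrier_hardy2[OF Us(2)]
  have ip: "hardy2_inner (\<lambda>z. \<phi> z * U v z) (U u) = cvec_inner (M *v v) u" for v u
    unfolding truncated_toeplitz_inner[OF \<Theta> \<phi> U Us(2) Us(2), symmetric] UM[symmetric] by (rule Us(5))
  have "\<exists>\<mu>. bshift (U (y i)) = (\<lambda>z. \<mu> * U (y i) z)" for i
  proof -
    let ?g = "U (y i)"
    \<comment> \<open>Needed on all of H^2, since it is applied below to \<open>z * U v z\<close>,
      which may leave the model space.\<close>
    have e1: "hardy2_inner (\<lambda>z. \<phi> z * h z) ?g = l i * hardy2_inner h ?g" if h: "h \<in> hardy2" for h
    proof (rule model_carrier_adjoint_eigenvector[OF \<Theta> \<phi> Us(2) _ h])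
      fix f assume "f \<in> model_carrier \<Theta>"
      then obtain v where v: "f = U v" using Us(1) by auto
      show "hardy2_inner (\<lambda>z. \<phi> z * f z) (U (y i)) = l i * hardy2_inner f (U (y i))"
        unfolding v ip Us(5) cvec_inner_conj_transpose y(1) by (simp add: cvec_inner_scale_right)
    qed
    have "bshift ?g \<in> range U" unfolding Us(1) by (rule model_carrier_bshift[OF \<Theta> Us(2)])
    then obtain u where u: "bshift ?g = U u" by auto
    \<comment> \<open>The backward shift preserves the eigenspace: moving it across the inner
      product becomes multiplication by z, which commutes with multiplication by \<phi>.\<close>
    have "cvec_inner v (conj_transpose M *v u + (-1) *s (cnj (l i) *s u)) = 0" for v
    proof -
      have "cvec_inner (M *v v) u = hardy2_inner (\<lambda>z. \<phi> z * U v z) (bshift ?g)" unfolding u ip ..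
      also have "\<dots> = hardy2_inner (\<lambda>z. \<phi> z * (z * U v z)) ?g"
        by (subst hardy2_inner_bshift[OF hardy_inf_times_hardy2[OF \<phi> U2] U2]) (simp add: mult_ac)
      also have "\<dots> = l i * hardy2_inner (U v) (bshift ?g)"
        unfolding e1[OF shift_hardy2[OF U2]] hardy2_inner_bshift[OF U2 U2] ..
      also have "\<dots> = l i * cvec_inner v u" unfolding u Us(5) ..
      finally show ?thesis
        unfolding cvec_inner_conj_transpose cvec_inner_add_right cvec_inner_scale_right by simp
    qed
    then have "conj_transpose M *v u + (-1) *s (cnj (l i) *s u) = 0" by (rule cvec_inner_eq_zero)
    then have "conj_transpose M *v u = cnj (l i) *s u" by (simp add: vec_eq_iff)
    then obtain c where "u = c *s y i" using simple by blast
    then show ?thesis using u Us(4) by auto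
  qed
  then obtain \<mu> where \<mu>: "\<And>i. bshift (U (y i)) = (\<lambda>z. \<mu> i * U (y i) z)" by metis
  have nz: "U (y i) \<noteq> (\<lambda>z. 0)" for i
  proof
    assume "U (y i) = (\<lambda>z. 0)"
    then have "cvec_inner (y i) (y i) = 0"
      using Us(5)[of "y i" "y i"] hardy2_inner_zero_left[OF zero_hardy2] by simp
    then show False using y(2)[of i] by (simp add: cvec_inner_self)
  qed
  note ev = bshift_eigenvector[OF U2 \<mu> nz]
  show thesis
  \<comment> \<open>The Taylor coefficients of \<open>U (y i)\<close> form a geometric sequence, so
    the Gram entries are geometric series.\<close>
  proof (rule that[of "\<lambda>i. hcoef (U (y i)) 0" \<mu>])
    fix i j
    have n: "norm (\<mu> i * cnj (\<mu> j)) < 1"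
      using mult_strict_mono[of "norm (\<mu> i)" 1 "norm (\<mu> j)" 1] ev(3)[of i] ev(3)[of j] by (simp add: norm_mult)
    have "(\<lambda>n. hcoef (U (y i)) 0 * cnj (hcoef (U (y j)) 0) * (\<mu> i * cnj (\<mu> j)) ^ n) sums
       (hcoef (U (y i)) 0 * cnj (hcoef (U (y j)) 0) * (1 / (1 - \<mu> i * cnj (\<mu> j))))"
      by (intro sums_mult geometric_sums n)
    moreover have "(\<lambda>n. hcoef (U (y i)) 0 * cnj (hcoef (U (y j)) 0) * (\<mu> i * cnj (\<mu> j)) ^ n) sums cvec_inner (y i) (y j)"
    proof -
      have e: "hcoef (U (y i)) n * cnj (hcoef (U (y j)) n) = hcoef (U (y i)) 0 * cnj (hcoef (U (y j)) 0) * (\<mu> i * cnj (\<mu> j)) ^ n" for n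
        unfolding ev(1)[of i n] ev(1)[of j n] by (simp add: power_mult_distrib mult_ac)
      show ?thesis using hardy2_inner_sums[OF U2 U2, of "y i" "y j"] unfolding Us(5) sums_cong[OF e] .
    qed
    ultimately show "cvec_inner (y i) (y j) = hcoef (U (y i)) 0 * cnj (hcoef (U (y j)) 0) / (1 - \<mu> i * cnj (\<mu> j))"
      using sums_unique2 by fastforce
  qed (rule ev)+
qed

section \<open>Szego kernels and finite Blaschke products\<close>

text \<open>Parametrized by its backward shift eigenvalue \<mu>, it is the reproducing kernel at
  \<open>cnj \<mu>\<close>.\<close>

definition szego :: "complex \<Rightarrow> complex \<Rightarrow> complex" where
  "szego \<mu> = disk_series (\<lambda>n. \<mu> ^ n)"

lemma
  assumes \<mu>: "norm \<mu> < 1"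
  shows szego_hardy2: "szego \<mu> \<in> hardy2"
    and hardy2_inner_szego: "f \<in> hardy2 \<Longrightarrow> hardy2_inner f (szego \<mu>) = f (cnj \<mu>)"
    and szego_eq: "norm z < 1 \<Longrightarrow> szego \<mu> z = 1 / (1 - \<mu> * z)"
proof -
  have "summable (\<lambda>n. ((norm \<mu>)\<^sup>2) ^ n)"
    using \<mu> by (intro summable_geometric) (simp add: abs_square_less_1)
  then have s: "summable (\<lambda>n. (norm (\<mu> ^ n))\<^sup>2)"
    by (simp add: norm_power power_mult[symmetric] mult.commute)
  show h: "szego \<mu> \<in> hardy2" unfolding szego_def by (rule disk_series_hardy2[OF s])
  show "hardy2_inner f (szego \<mu>) = f (cnj \<mu>)" if f: "f \<in> hardy2"
  proof (rule sums_unique2[OF hardy2_inner_sums[OF f h]])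
    show "(\<lambda>n. hcoef f n * cnj (hcoef (szego \<mu>) n)) sums f (cnj \<mu>)"
      using hcoef_sums[of f "cnj \<mu>"] f \<mu> unfolding szego_def hcoef_disk_series[OF s] by (simp add: hardy2_def)
  qed
  show "szego \<mu> z = 1 / (1 - \<mu> * z)" if z: "norm z < 1"
  proof -
    have "norm (\<mu> * z) < 1"
      using mult_strict_mono[of "norm \<mu>" 1 "norm z" 1] \<mu> z by (simp add: norm_mult)
    from geometric_sums[OF this] show ?thesis
      using z by (simp add: szego_def disk_series_def power_mult_distrib sums_iff)
  qed
qed

lemma hardy_inf_continuous_cball:
  assumes "f holomorphic_on ball 0 1" "continuous_on (cball 0 1) f"
  shows "f \<in> hardy_inf"
proof -
  have "bounded (f ` cball 0 1)"
    using assms(2) by (intro compact_imp_bounded compact_continuous_image) auto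
  then have "bounded (f ` ball 0 1)" by (rule bounded_subset) auto
  with assms(1) show ?thesis by (simp add: hardy_inf_def)
qed

lemma boundary_value_continuous_cball:
  assumes f: "continuous_on (cball 0 1) f" and u: "norm u = 1"
  shows "((\<lambda>r. f (of_real r * u)) \<longlongrightarrow> f u) (at_left 1)" "boundary_value f u = f u"
proof -
  have "continuous_on {0..1::real} (\<lambda>r. f (of_real r * u))"
    by (intro continuous_on_compose2[OF f] continuous_intros) (use u in \<open>auto simp: norm_mult\<close>)
  then have "((\<lambda>r. f (of_real r * u)) \<longlongrightarrow> f (of_real 1 * u)) (at 1 within {0..1::real})"
    unfolding continuous_on_def by (rule bspec) auto
  then show 1: "((\<lambda>r. f (of_real r * u)) \<longlongrightarrow> f u) (at_left 1)"
    by (simp add: at_within_Icc_at_left)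
  then show "boundary_value f u = f u" unfolding boundary_value_def by (intro tendsto_Lim) auto
qed

text \<open>Near the circle \<open>z - w\<close> is bounded away from 0, so dividing by it costs
  only a constant in the means; for smaller circles, which may pass through w, the means are
  monotone in the radius.\<close>

lemma hardy2_divide_zero:
  assumes e: "e \<in> hardy2" and w: "norm w < 1" and ew: "e w = 0"
  obtains q where "q \<in> hardy2" "\<And>z. norm z < 1 \<Longrightarrow> e z = (z - w) * q z"
proof -
  have eh: "e holomorphic_on ball 0 1" using e by (simp add: hardy2_def)
  define q0 where "q0 = (\<lambda>z. if z = w then deriv e w else (e z - e w) / (z - w))"
  have q0: "q0 holomorphic_on ball 0 1"
    unfolding q0_def by (rule pole_lemma_open[OF eh]) auto
  have eq: "e z = (z - w) * q0 z" for z by (simp add: q0_def ew)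
  \<comment> \<open>Halfway between \<open>norm w\<close> and 1: points of modulus at least \<rho>
    have distance at least d from w.\<close>
  define \<rho> where "\<rho> = (1 + norm w) / 2"
  define d where "d = (1 - norm w) / 2"
  have \<rho>: "0 \<le> \<rho>" "\<rho> < 1" "d > 0" using w by (auto simp: \<rho>_def d_def)
  define E where "E = (\<Sum>n. (norm (hcoef e n))\<^sup>2)"
  have bd: "(LINT t|circ. (norm (q0 (of_real r * cis t)))\<^sup>2) / (2 * pi) \<le> E / d\<^sup>2" if r: "0 \<le> r" "r < 1" for r
  proof -
    define s where "s = max r \<rho>"
    have s: "0 \<le> s" "r \<le> s" "s < 1" "\<rho> \<le> s" using r \<rho> by (auto simp: s_def)
    have ci: "integrable circ (\<lambda>t. (norm (h (of_real s * cis t)))\<^sup>2)" if "h holomorphic_on ball 0 1" for h :: "complex \<Rightarrow> complex"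
      by (intro integrable_circ_continuous continuous_intros
         continuous_on_compose2[OF holomorphic_on_imp_continuous_on[OF that]]) (use s in \<open>auto simp: norm_mult\<close>)
    have "(LINT t|circ. (norm (q0 (of_real r * cis t)))\<^sup>2) \<le> (LINT t|circ. (norm (q0 (of_real s * cis t)))\<^sup>2)"
      by (rule circle_mean_mono[OF q0]) (use r s in auto)
    also have "\<dots> \<le> (LINT t|circ. (norm (e (of_real s * cis t)))\<^sup>2 / d\<^sup>2)"
    proof (rule integral_mono)
      show "integrable circ (\<lambda>t. (norm (q0 (of_real s * cis t)))\<^sup>2)" by (rule ci[OF q0])
      show "integrable circ (\<lambda>t. (norm (e (of_real s * cis t)))\<^sup>2 / d\<^sup>2)" using ci[OF eh] by simp
      fix t :: real
      have "s - norm w \<le> norm (of_real s * cis t - w)"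
        using norm_triangle_ineq2[of "of_real s * cis t" w] s by (simp add: norm_mult)
      then have "d \<le> norm (of_real s * cis t - w)" using s(4) by (simp add: \<rho>_def d_def field_simps)
      then have "d * norm (q0 (of_real s * cis t)) \<le> norm (e (of_real s * cis t))"
        unfolding eq norm_mult by (rule mult_right_mono) simp
      then have "(d * norm (q0 (of_real s * cis t)))\<^sup>2 \<le> (norm (e (of_real s * cis t)))\<^sup>2"
        using \<rho> by (intro power_mono) auto
      then show "(norm (q0 (of_real s * cis t)))\<^sup>2 \<le> (norm (e (of_real s * cis t)))\<^sup>2 / d\<^sup>2"
        using \<rho> by (simp add: power_mult_distrib pos_le_divide_eq mult.commute)
    qed
    also have "\<dots> = (LINT t|circ. (norm (e (of_real s * cis t)))\<^sup>2) / d\<^sup>2" by simp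
    also have "\<dots> \<le> (2 * pi * E) / d\<^sup>2"
      using hardy2_mean_le[OF e s(1,3)] by (intro divide_right_mono) (auto simp: E_def field_simps)
    finally show ?thesis by (simp add: field_simps)
  qed
  \<comment> \<open>Passing to the Taylor series makes the quotient vanish off the disk, as
    \<open>hardy2\<close> requires.\<close>
  have q: "disk_series (hcoef q0) \<in> hardy2"
    by (rule disk_series_hardy2, rule bounded_means_summable[OF q0]) (use bd in auto)
  show thesis
  proof (rule that[OF q])
    fix z :: complex assume z: "norm z < 1"
    then show "e z = (z - w) * disk_series (hcoef q0) z"
      using hcoef_sums[OF q0 z] eq[of z] by (simp add: disk_series_def sums_iff)
  qed
qed

text \<open>The zeros are \<open>cnj (\<mu> i)\<close>, the points at which
  \<open>szego (\<mu> i)\<close> reproduces; the index set is a parameter for the sake of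
  induction.\<close>

definition blaschke :: "'n set \<Rightarrow> ('n \<Rightarrow> complex) \<Rightarrow> complex \<Rightarrow> complex" where
  "blaschke A \<mu> z = (\<Prod>i\<in>A. (z - cnj (\<mu> i)) / (1 - \<mu> i * z))"

lemma disk_denominator_nonzero:
  assumes "norm \<mu> < 1" "norm z \<le> 1"
  shows "1 - \<mu> * z \<noteq> (0 :: complex)"
proof
  assume "1 - \<mu> * z = 0"
  then have "norm (\<mu> * z) = 1" by (metis eq_iff_diff_eq_0 norm_one)
  moreover have "norm (\<mu> * z) \<le> norm \<mu> * 1" unfolding norm_mult using assms by (intro mult_left_mono) auto
  ultimately show False using assms by simp
qed

lemma blaschke_hardy_inf:
  assumes "\<And>i. i \<in> A \<Longrightarrow> norm (\<mu> i) < 1"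
  shows "continuous_on (cball 0 1) (blaschke A \<mu>)" "blaschke A \<mu> \<in> hardy_inf"
proof -
  show c: "continuous_on (cball 0 1) (blaschke A \<mu>)"
    unfolding blaschke_def[abs_def]
    by (intro continuous_intros) (use assms disk_denominator_nonzero in auto)
  show "blaschke A \<mu> \<in> hardy_inf"
    by (rule hardy_inf_continuous_cball[OF _ c], unfold blaschke_def[abs_def])
      (intro holomorphic_intros; use assms disk_denominator_nonzero in auto)
qed

lemma norm_blaschke_circle:
  assumes "\<And>i. i \<in> A \<Longrightarrow> norm (\<mu> i) < 1" "norm z = 1"
  shows "norm (blaschke A \<mu> z) = 1"
proof -
  have "norm ((z - cnj (\<mu> i)) / (1 - \<mu> i * z)) = 1" if "i \<in> A" for i
  proof -
    have "cnj z * z = 1" using assms(2) by (simp add: mult.commute[of "cnj z"] complex_norm_square[symmetric])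
    then have "cnj (z - cnj (\<mu> i)) = cnj z * (1 - \<mu> i * z)" by (simp add: algebra_simps)
    then have "norm (cnj (z - cnj (\<mu> i))) = norm (1 - \<mu> i * z)" using assms(2) by (simp add: norm_mult)
    then have "norm (z - cnj (\<mu> i)) = norm (1 - \<mu> i * z)" by (simp only: complex_mod_cnj)
    moreover have "1 - \<mu> i * z \<noteq> 0" using assms that by (intro disk_denominator_nonzero) auto
    ultimately show ?thesis by (simp add: norm_divide)
  qed
  then show ?thesis unfolding blaschke_def prod_norm[symmetric] by simp
qed

lemma inner_function_blaschke:
  assumes "\<And>i. i \<in> A \<Longrightarrow> norm (\<mu> i) < 1"
  shows "inner_function (blaschke A \<mu>)"
  unfolding inner_function_def
  by (intro conjI blaschke_hardy_inf[OF assms] always_eventually allI)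
    (auto simp: boundary_value_continuous_cball[OF blaschke_hardy_inf(1)[OF assms]] norm_blaschke_circle[OF assms])

text \<open>Zeros are divided out one at a time. Injectivity keeps the factors already removed from
  vanishing at the next zero, and the bounded factor \<open>1 - \<mu> i * z\<close> compensates for
  the Blaschke denominator.\<close>

lemma hardy2_divide_blaschke:
  assumes "finite A" "\<And>i. i \<in> A \<Longrightarrow> norm (\<mu> i) < 1" "inj_on \<mu> A" "e \<in> hardy2"
    "\<And>i. i \<in> A \<Longrightarrow> e (cnj (\<mu> i)) = 0"
  shows "\<exists>h\<in>hardy2. \<forall>z. norm z < 1 \<longrightarrow> e z = blaschke A \<mu> z * h z"
  using assms
proof (induction A)
  case empty
  then show ?case by (auto simp: blaschke_def)
next
  case (insert i A)
  then obtain h where h: "h \<in> hardy2" "\<And>z. norm z < 1 \<Longrightarrow> e z = blaschke A \<mu> z * h z"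
    by (auto simp: inj_on_insert)
  have \<mu>: "norm (\<mu> i) < 1" using insert by simp
  have "blaschke A \<mu> (cnj (\<mu> i)) \<noteq> 0"
  proof -
    have "(cnj (\<mu> i) - cnj (\<mu> j)) / (1 - \<mu> j * cnj (\<mu> i)) \<noteq> 0" if "j \<in> A" for j
    proof -
      have "1 - \<mu> j * cnj (\<mu> i) \<noteq> 0" using insert.prems(1)[of j] \<mu> that by (intro disk_denominator_nonzero) auto
      moreover have "\<mu> i \<noteq> \<mu> j" using insert.prems(2) insert.hyps(2) that by (auto simp: inj_on_def)
      ultimately show ?thesis by simp
    qed
    then show ?thesis using insert.hyps by (simp add: blaschke_def)
  qed
  moreover have "blaschke A \<mu> (cnj (\<mu> i)) * h (cnj (\<mu> i)) = 0"
    using insert.prems(4)[of i] h(2)[of "cnj (\<mu> i)"] \<mu> by simp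
  ultimately have "h (cnj (\<mu> i)) = 0" by simp
  then obtain q where q: "q \<in> hardy2" "\<And>z. norm z < 1 \<Longrightarrow> h z = (z - cnj (\<mu> i)) * q z"
    using hardy2_divide_zero[OF h(1), of "cnj (\<mu> i)"] \<mu> by auto
  have "(\<lambda>z. 1 - \<mu> i * z) \<in> hardy_inf"
    by (rule hardy_inf_continuous_cball) (intro holomorphic_intros continuous_intros)+
  then have "(\<lambda>z. (1 - \<mu> i * z) * q z) \<in> hardy2" by (rule hardy_inf_times_hardy2[OF _ q(1)])
  moreover have "e z = blaschke (insert i A) \<mu> z * ((1 - \<mu> i * z) * q z)" if z: "norm z < 1" for z
    using disk_denominator_nonzero[OF \<mu>, of z] z insert.hyps
    by (simp add: h(2)[OF z] q(2)[OF z] blaschke_def)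
  ultimately show ?case by (intro bexI[of _ "\<lambda>z. (1 - \<mu> i * z) * q z"] allI impI)
qed

text \<open>The unitary sends \<open>y i\<close> to \<open>c i\<close> times
  \<open>szego (\<mu> i)\<close>, and the Gram hypothesis makes it isometric. An element of the
  model space is determined by its values at the zeros \<open>w i\<close>, so identities are checked
  there.\<close>

theorem tto_of_adjoint_gram:
  fixes M :: "complex ^ 'n ^ 'n::finite" and x y :: "'n \<Rightarrow> complex ^ 'n"
  assumes expand: "\<And>v. v = (\<Sum>i\<in>UNIV. cvec_inner v (x i) *s y i)"
    and dual: "\<And>i j. cvec_inner (x i) (y j) = (if i = j then 1 else 0)"
    and eig: "\<And>i. conj_transpose M *v y i = cnj (l i) *s y i"
    and gram: "\<And>i j. cvec_inner (y i) (y j) = c i * cnj (c j) / (1 - \<mu> i * cnj (\<mu> j))"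
    and c: "\<And>i. c i \<noteq> 0" and \<mu>: "\<And>i. norm (\<mu> i) < 1" and inj: "inj \<mu>"
  shows "ue_analytic_tto M"
proof -
  define w where "w = (\<lambda>i. cnj (\<mu> i))"
  have w: "norm (w i) < 1" for i using \<mu> by (simp add: w_def)
  define \<Theta> where "\<Theta> = blaschke UNIV \<mu>"
  have \<Theta>: "\<Theta> \<in> hardy_inf" "continuous_on (cball 0 1) \<Theta>" unfolding \<Theta>_def by (intro blaschke_hardy_inf \<mu>)+
  have inner: "inner_function \<Theta>" unfolding \<Theta>_def by (intro inner_function_blaschke \<mu>)
  have \<Theta>w: "\<Theta> (w i) = 0" for i
    unfolding \<Theta>_def blaschke_def w_def by (rule prod_zero) auto
  \<comment> \<open>A constant with a zero is 0, whereas the modulus at the boundary point 1 is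
    1.\<close>
  have nonconst: "\<not> \<Theta> constant_on ball 0 1"
  proof
    assume "\<Theta> constant_on ball 0 1"
    then have z: "\<Theta> z = 0" if "norm z < 1" for z
      using \<Theta>w w that by (auto simp: constant_on_def)
    have "\<forall>\<^sub>F r::real in at_left 1. 0 < r \<and> r < 1"
      using eventually_at_left_real[of 0 "1::real"] by simp
    then have "\<forall>\<^sub>F r::real in at_left 1. \<Theta> (of_real r * 1) = 0" by eventually_elim (simp add: z)
    then have "((\<lambda>r::real. \<Theta> (of_real r * 1)) \<longlongrightarrow> 0) (at_left 1)" by (rule tendsto_eventually)
    then have "\<Theta> 1 = 0"
      using boundary_value_continuous_cball(1)[OF \<Theta>(2), of 1] tendsto_unique[of "at_left (1::real)"] by fastforce
    then show False using norm_blaschke_circle[of UNIV \<mu> 1] \<mu> by (simp add: \<Theta>_def)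
  qed
  \<comment> \<open>Lagrange interpolation of the eigenvalues \<open>l i\<close> at the zeros
    \<open>w i\<close>.\<close>
  define \<phi> where "\<phi> = (\<lambda>z. \<Sum>i\<in>UNIV. l i * (\<Prod>j\<in>UNIV - {i}. (z - w j) / (w i - w j)))"
  have \<phi>: "\<phi> \<in> hardy_inf"
    by (rule hardy_inf_continuous_cball; unfold \<phi>_def) 
      (intro holomorphic_intros continuous_intros; use inj in \<open>auto simp: w_def inj_def\<close>)+
  have \<phi>w: "\<phi> (w k) = l k" for k
  proof -
    have "l i * (\<Prod>j\<in>UNIV - {i}. (w k - w j) / (w i - w j)) = (if i = k then l k else 0)" for i
    proof (cases "i = k")
      case True
      have "(w k - w j) / (w k - w j) = 1" if "j \<noteq> k" for j using inj that by (auto simp: w_def inj_def)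
      then show ?thesis using True by simp
    next
      case False
      then have "(\<Prod>j\<in>UNIV - {i}. (w k - w j) / (w i - w j)) = 0" by (intro prod_zero) auto
      then show ?thesis using False by simp
    qed
    then show ?thesis by (simp add: \<phi>_def)
  qed
  define K where "K = model_carrier \<Theta>"
  have kK: "szego (\<mu> i) \<in> K" for i
    unfolding K_def model_carrier_def
  proof (intro CollectI conjI ballI szego_hardy2 \<mu>)
    fix h assume h: "h \<in> hardy2"
    have th: "(\<lambda>z. \<Theta> z * h z) \<in> hardy2" by (rule hardy_inf_times_hardy2[OF \<Theta>(1) h])
    show "hardy2_inner (szego (\<mu> i)) (\<lambda>z. \<Theta> z * h z) = 0"
      using hardy2_inner_commute[OF th szego_hardy2[OF \<mu>]] hardy2_inner_szego[OF \<mu> th] \<Theta>w by (simp add: w_def)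
  qed
  define C where "C = (\<lambda>a z. \<Sum>i\<in>UNIV. a i * szego (\<mu> i) z)"
  have Csum: "(\<lambda>z. \<Sum>i\<in>A. a i * szego (\<mu> i) z) \<in> K \<and>
      (\<forall>g\<in>hardy2. hardy2_inner g (\<lambda>z. \<Sum>i\<in>A. a i * szego (\<mu> i) z) = (\<Sum>i\<in>A. cnj (a i) * g (w i)))"
    if "finite A" for A a
    using that
  proof induction
    case empty
    show ?case
      using hardy2_inner_zero_left zero_hardy2 hardy2_inner_commute[OF zero_hardy2] hardy_inf_times_hardy2[OF \<Theta>(1)]
      by (auto simp: K_def model_carrier_def)
  next
    case (insert i A)
    let ?f = "\<lambda>z. \<Sum>i\<in>A. a i * szego (\<mu> i) z"
    have eq: "(\<lambda>z. \<Sum>i\<in>insert i A. a i * szego (\<mu> i) z) = (\<lambda>z. ?f z + a i * szego (\<mu> i) z)"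
      using insert.hyps by (simp add: add.commute)
    have f: "?f \<in> K" and IH: "\<forall>g\<in>hardy2. hardy2_inner g ?f = (\<Sum>i\<in>A. cnj (a i) * g (w i))"
      using insert.IH by blast+
    then have f2: "?f \<in> hardy2" by (simp add: K_def model_carrier_hardy2)
    show ?case unfolding eq
    proof (intro conjI ballI)
      show "(\<lambda>z. ?f z + a i * szego (\<mu> i) z) \<in> K"
        using model_carrier_lincomb[OF \<Theta>(1)] f kK unfolding K_def by blast
      fix g assume g: "g \<in> hardy2"
      show "hardy2_inner g (\<lambda>z. ?f z + a i * szego (\<mu> i) z) = (\<Sum>i\<in>insert i A. cnj (a i) * g (w i))"
        unfolding hardy2_inner_lincomb_right[OF f2 szego_hardy2[OF \<mu>] g] hardy2_inner_szego[OF \<mu> g] IH[rule_format, OF g]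
        using insert.hyps by (simp add: w_def)
    qed
  qed
  have CK: "C a \<in> K" and Cinner: "g \<in> hardy2 \<Longrightarrow> hardy2_inner g (C a) = (\<Sum>i\<in>UNIV. cnj (a i) * g (w i))" for a g
    using Csum[OF finite, where A=UNIV and a=a] unfolding C_def by auto
  \<comment> \<open>By \<open>expand\<close>, \<open>cvec_inner v (x i)\<close> is the coordinate of
    v along \<open>y i\<close>.\<close>
  define U where "U = (\<lambda>v. C (\<lambda>i. cvec_inner v (x i) * c i))"
  have UK: "U v \<in> K" for v unfolding U_def by (rule CK)
  then have U2: "U v \<in> hardy2" for v unfolding K_def by (rule model_carrier_hardy2)
  have Uw: "U v (w j) = cvec_inner v (y j) / cnj (c j)" for v j
  proof -
    have "U v (w j) = (\<Sum>i\<in>UNIV. cvec_inner v (x i) * (c i / (1 - \<mu> i * w j)))"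
      using w[of j] by (simp add: U_def C_def szego_eq[OF \<mu>])
    also have "\<dots> = (\<Sum>i\<in>UNIV. cvec_inner v (x i) * (cvec_inner (y i) (y j) / cnj (c j)))"
      using c by (simp add: gram w_def)
    also have "\<dots> = cvec_inner (\<Sum>i\<in>UNIV. cvec_inner v (x i) *s y i) (y j) / cnj (c j)"
      by (simp add: cvec_inner_sum_left cvec_inner_scale_left sum_divide_distrib)
    finally show ?thesis using expand[of v] by simp
  qed
  have gU: "hardy2_inner g (U u) = (\<Sum>i\<in>UNIV. cnj (cvec_inner u (x i) * c i) * g (w i))" if "g \<in> hardy2" for g u
    unfolding U_def by (rule Cinner[OF that])
  have UU: "hardy2_inner (U v) (U u) = cvec_inner v u" for v u
  proof -
    have "hardy2_inner (U v) (U u) = (\<Sum>i\<in>UNIV. cnj (cvec_inner u (x i)) * cvec_inner v (y i))"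
      using c by (simp add: gU[OF U2] Uw)
    also have "\<dots> = cvec_inner v (\<Sum>i\<in>UNIV. cvec_inner u (x i) *s y i)"
      by (simp add: cvec_inner_sum_right cvec_inner_scale_right)
    finally show ?thesis using expand[of u] by simp
  qed
  \<comment> \<open>Choose v so that \<open>U v\<close> interpolates f at the zeros. The difference
    lies in the model space and, vanishing at every zero, is also a multiple of \<Theta>; hence it
    is orthogonal to itself.\<close>
  have onto: "\<exists>v. f = U v" if f: "f \<in> K" for f
  proof -
    define v where "v = (\<Sum>j\<in>UNIV. (cnj (c j) * f (w j)) *s x j)"
    have "cvec_inner v (y j) = cnj (c j) * f (w j)" for j
      by (simp add: v_def cvec_inner_sum_left cvec_inner_scale_left dual mult_delta_right)
    then have Uv: "U v (w j) = f (w j)" for j using c by (simp add: Uw)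
    let ?e = "\<lambda>z. f z + (-1) * U v z"
    have eK: "?e \<in> K" using model_carrier_lincomb[OF \<Theta>(1)] f UK unfolding K_def by blast
    then have e2: "?e \<in> hardy2" unfolding K_def by (rule model_carrier_hardy2)
    have "?e (cnj (\<mu> j)) = 0" for j using Uv[of j] by (simp add: w_def)
    then obtain h where h: "h \<in> hardy2" "\<And>z. norm z < 1 \<Longrightarrow> ?e z = \<Theta> z * h z"
      using hardy2_divide_blaschke[OF finite \<mu> inj e2] unfolding \<Theta>_def by blast
    have eq: "?e = (\<lambda>z. \<Theta> z * h z)"
    proof
      fix z show "?e z = \<Theta> z * h z"
      proof (cases "norm z < 1")
        case False
        then have "?e z = 0" "h z = 0" using h(1) e2 by (auto simp: hardy2_def)
        then show ?thesis by simp
      qed (rule h(2))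
    qed
    have "hardy2_inner ?e (\<lambda>z. \<Theta> z * h z) = 0" using eK h(1) unfolding K_def model_carrier_def by blast
    then have "hardy2_inner ?e ?e = 0" unfolding eq[symmetric] .
    then have "?e = (\<lambda>z. 0)" by (rule hardy2_inner_self_eq_0[OF e2])
    then have "f = U v" by (simp add: fun_eq_iff)
    then show ?thesis by blast
  qed
  have unit: "unitary_map cvec_space (model_space \<Theta>) U"
    unfolding unitary_map_def cvec_space_def model_space_def
  proof (simp add: K_def[symmetric], intro conjI allI)
    show "range U = K"
    proof
      show "range U \<subseteq> K" using UK by blast
      show "K \<subseteq> range U" using onto by blast
    qed
    show "U (v + u) = (\<lambda>z. U v z + U u z)" for v u
      by (simp add: U_def C_def cvec_inner_add_left algebra_simps sum.distrib)
    show "U (a *s v) = (\<lambda>z. a * U v z)" for a v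
      by (simp add: U_def C_def cvec_inner_scale_left sum_distrib_left mult_ac)
    show "hardy2_inner (U v) (U u) = cvec_inner v u" for v u by (rule UU)
  qed
  have "truncated_toeplitz \<Theta> \<phi> (U v) = U (M *v v)" for v
  proof (rule truncated_toeplitz_eqI[OF \<Theta>(1) \<phi> U2 UK[unfolded K_def]])
    fix g assume "g \<in> model_carrier \<Theta>"
    then obtain u where g: "g = U u" using onto by (auto simp: K_def)
    have "cvec_inner (M *v v) (y i) = l i * cvec_inner v (y i)" for i
      by (simp add: cvec_inner_conj_transpose eig cvec_inner_scale_right)
    \<comment> \<open>By \<open>gU\<close>, inner products with elements of the model space see only
      the values at the zeros.\<close>
    then have "\<phi> (w i) * U v (w i) = U (M *v v) (w i)" for i by (simp add: Uw \<phi>w)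
    then show "hardy2_inner (\<lambda>z. \<phi> z * U v z) g = hardy2_inner (U (M *v v)) g"
      unfolding g by (simp add: gU[OF hardy_inf_times_hardy2[OF \<phi> U2]] gU[OF U2])
  qed
  then have "unitarily_equivalent cvec_space ((*v) M) (model_space \<Theta>) (truncated_toeplitz \<Theta> \<phi>)"
    unfolding unitarily_equivalent_def by (intro exI[of _ U] conjI ballI unit) (rule sym)
  then show ?thesis
    unfolding ue_analytic_tto_def using inner nonconst \<phi> by blast
qed

section \<open>Complex symmetric matrices and Gram matrices\<close>

lemma eigenvectors_independent:
  fixes M :: "complex ^ 'n ^ 'n::finite" and x :: "'i \<Rightarrow> complex ^ 'n"
  assumes l: "inj l" and M: "\<And>i. M *v x i = l i *s x i" and nz: "\<And>i. x i \<noteq> 0"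
    and "finite A" "(\<Sum>i\<in>A. c i *s x i) = 0" "i \<in> A"
  shows "c i = 0"
  using assms(4-6)
proof (induction A arbitrary: c i)
  case (insert k A)
  have Mlin: "M *v (\<Sum>i\<in>B. f i *s x i) = (\<Sum>i\<in>B. (f i * l i) *s x i)" for B f
    by (induction B rule: infinite_finite_induct)
      (auto simp: matrix_vector_right_distrib M vector_scalar_commute)
  have s: "(\<Sum>i\<in>A. c i *s x i) = - (c k *s x k)"
    using insert by (simp add: eq_neg_iff_add_eq_0 add.commute)
  have "M *v (\<Sum>i\<in>A. c i *s x i) = l k *s (\<Sum>i\<in>A. c i *s x i)"
    unfolding s by (simp add: M vec.neg vector_scalar_commute)
  then have "(\<Sum>i\<in>A. (c i * l i) *s x i) - (\<Sum>i\<in>A. (l k * c i) *s x i) = 0"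
    unfolding Mlin by (simp add: vec.scale_sum_right)
  moreover have "(\<Sum>i\<in>A. (c i * (l i - l k)) *s x i) = (\<Sum>i\<in>A. (c i * l i) *s x i) - (\<Sum>i\<in>A. (l k * c i) *s x i)"
    unfolding sum_subtractf[symmetric] by (intro sum.cong refl) (simp add: vec_eq_iff algebra_simps)
  ultimately have "(\<Sum>i\<in>A. (c i * (l i - l k)) *s x i) = 0" by (simp only:)
  from insert.IH[OF this] have "c i * (l i - l k) = 0" if "i \<in> A" for i using that .
  moreover have "l i \<noteq> l k" if "i \<in> A" for i using that insert.hyps l by (auto simp: inj_def)
  ultimately have c0: "c i = 0" if "i \<in> A" for i using that by auto
  then have "c k *s x k = 0" using s by simp
  then have "c k = 0" using nz[of k] by simp
  then show ?case using c0 insert.prems by auto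
qed simp

lemma dual_eigenbasis:
  fixes M :: "complex ^ 'n ^ 'n::finite" and x :: "'n \<Rightarrow> complex ^ 'n"
  assumes l: "inj l" and M: "\<And>i. M *v x i = l i *s x i" and nz: "\<And>i. x i \<noteq> 0"
  obtains y where "\<And>i j. cvec_inner (x i) (y j) = (if i = j then 1 else 0)"
    "\<And>v. v = (\<Sum>i\<in>UNIV. cvec_inner v (y i) *s x i)"
    "\<And>v. v = (\<Sum>i\<in>UNIV. cvec_inner v (x i) *s y i)"
    "\<And>i. y i \<noteq> 0"
    "\<And>i. conj_transpose M *v y i = cnj (l i) *s y i"
    "\<And>i u. conj_transpose M *v u = cnj (l i) *s u \<Longrightarrow> \<exists>c. u = c *s y i"
proof -
  define X :: "complex ^ 'n ^ 'n" where "X = (\<chi> i j. x j $ i)"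
  have Xv: "X *v c = (\<Sum>j\<in>UNIV. c $ j *s x j)" for c
    by (simp add: X_def vec_eq_iff matrix_vector_mult_def mult.commute)
  have "c = 0" if "X *v c = 0" for c
  proof -
    have "c $ i = 0" for i
      by (rule eigenvectors_independent[OF l M nz finite, where A=UNIV]) (use that in \<open>simp_all add: Xv\<close>)
    then show ?thesis by (simp add: vec_eq_iff)
  qed
  then have "\<exists>B. B ** X = mat 1" unfolding matrix_left_invertible_ker by blast
  then obtain B where B: "B ** X = mat 1" by blast
  then have B': "X ** B = mat 1" using matrix_left_right_inverse by blast
  \<comment> \<open>The conjugated rows of the inverse of the eigenvector matrix.\<close>
  define y where "y = (\<lambda>i. \<chi> k. cnj (B $ i $ k))"
  have dual: "cvec_inner (x j) (y i) = (if j = i then 1 else 0)" for i j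
  proof -
    have "cvec_inner (x j) (y i) = (B ** X) $ i $ j"
      by (simp add: cvec_inner_def y_def matrix_matrix_mult_def X_def mult.commute)
    then show ?thesis unfolding B by (simp add: mat_def)
  qed
  have ex: "v = (\<Sum>i\<in>UNIV. cvec_inner v (y i) *s x i)" for v
  proof -
    have "(B *v v) $ i = cvec_inner v (y i)" for i
      by (simp add: cvec_inner_def y_def matrix_vector_mult_def mult.commute)
    moreover have "v = X *v (B *v v)" by (simp add: matrix_vector_mul_assoc B')
    ultimately show ?thesis unfolding Xv by simp
  qed
  have eq0: "u = 0" if "\<And>j. cvec_inner (x j) u = 0" for u
  proof (rule cvec_inner_eq_zero)
    fix v show "cvec_inner v u = 0"
      by (subst ex[of v]) (simp add: cvec_inner_sum_left cvec_inner_scale_left that)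
  qed
  have eqI: "u = w" if "\<And>j. cvec_inner (x j) u = cvec_inner (x j) w" for u w
  proof -
    have "u + (-1) *s w = 0" by (rule eq0) (simp only: cvec_inner_add_right cvec_inner_scale_right that, simp)
    then show ?thesis by (simp add: vec_eq_iff)
  qed
  have ey: "v = (\<Sum>i\<in>UNIV. cvec_inner v (x i) *s y i)" for v
  proof (rule eqI)
    fix j show "cvec_inner (x j) v = cvec_inner (x j) (\<Sum>i\<in>UNIV. cvec_inner v (x i) *s y i)"
      using cvec_inner_commute[of "x j" v]
      by (simp add: cvec_inner_sum_right cvec_inner_scale_right dual mult_delta_right)
  qed
  show thesis
  proof (rule that[OF dual ex ey])
    show "y i \<noteq> 0" for i using dual[of i i] by (auto simp: cvec_inner_def)
    show "conj_transpose M *v y i = cnj (l i) *s y i" for i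
      by (rule eqI) (simp add: cvec_inner_conj_transpose[symmetric] M cvec_inner_scale_left cvec_inner_scale_right dual)
    show "\<exists>c. u = c *s y i" if u: "conj_transpose M *v u = cnj (l i) *s u" for i u
    proof (intro exI eqI)
      fix j
      have "l j * cvec_inner (x j) u = cvec_inner (M *v x j) u" by (simp add: M cvec_inner_scale_left)
      also have "\<dots> = l i * cvec_inner (x j) u"
        by (simp add: cvec_inner_conj_transpose u cvec_inner_scale_right)
      finally have "j \<noteq> i \<Longrightarrow> cvec_inner (x j) u = 0" using l by (auto simp: inj_def)
      then show "cvec_inner (x j) u = cvec_inner (x j) (cvec_inner u (x i) *s y i)"
        using cvec_inner_commute[of "x i" u]
        by (cases "j = i") (auto simp: cvec_inner_scale_right dual)
    qed
  qed
qed

lemma gram_inverse: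
  fixes x y :: "'n::finite \<Rightarrow> complex ^ 'm::finite"
  assumes dual: "\<And>i j. cvec_inner (x i) (y j) = (if i = j then 1 else 0)"
    and ex: "\<And>v. v = (\<Sum>i\<in>UNIV. cvec_inner v (y i) *s x i)"
  shows "(\<Sum>j\<in>UNIV. cvec_inner (y k) (y j) * cvec_inner (x j) (x i)) = (if i = k then 1 else 0)"
proof -
  have "cvec_inner (y k) (x i) = cvec_inner (\<Sum>j\<in>UNIV. cvec_inner (y k) (y j) *s x j) (x i)"
    by (subst ex[of "y k"]) (rule refl)
  then have "cvec_inner (y k) (x i) = (\<Sum>j\<in>UNIV. cvec_inner (y k) (y j) * cvec_inner (x j) (x i))"
    by (simp add: cvec_inner_sum_left cvec_inner_scale_left)
  then show ?thesis using cvec_inner_commute[of "y k" "x i"] dual[of i k] by (cases "i = k") auto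
qed

lemma complex_symmetric_gram:
  fixes M :: "complex ^ 'n ^ 'n::finite" and x y :: "'n \<Rightarrow> complex ^ 'n"
  assumes M: "ue_complex_symmetric M"
    and x: "\<And>i. M *v x i = l i *s x i" and nz: "\<And>i. x i \<noteq> 0"
    and simple: "\<And>i u. conj_transpose M *v u = cnj (l i) *s u \<Longrightarrow> \<exists>c. u = c *s y i"
  obtains d where "\<And>i. d i \<noteq> 0"
    "\<And>i j. cvec_inner (y i) (y j) = d i * cnj (d j) * cnj (cvec_inner (x i) (x j))"
proof -
  obtain S :: "complex ^ 'n ^ 'n" and U where S: "transpose S = S"
    and U: "unitary_map cvec_space cvec_space U" and US: "\<And>v. U (M *v v) = S *v U v"
    using M by (auto simp: ue_complex_symmetric_def complex_symmetric_def unitarily_equivalent_def cvec_space_def)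
  have Us: "surj U" "\<And>c v. U (c *s v) = c *s U v" "\<And>u v. cvec_inner (U u) (U v) = cvec_inner u v"
    using U by (auto simp: unitary_map_def cvec_space_def)
  \<comment> \<open>For symmetric \<open>S\<close> the adjoint is the entrywise conjugate, so
    conjugating an eigenvector of \<open>S\<close> gives one of its adjoint.\<close>
  define t where "t = (\<lambda>i. \<chi> k. cnj (U (x i) $ k))"
  have t: "conj_transpose S *v t i = cnj (l i) *s t i" for i
  proof -
    have "S *v U (x i) = l i *s U (x i)" using US[of "x i"] by (simp add: x Us)
    then have "cnj ((S *v U (x i)) $ k) = cnj ((l i *s U (x i)) $ k)" for k by simp
    moreover have "S $ j $ k = S $ k $ j" for j k using S by (metis transpose_def vec_lambda_beta)
    ultimately show ?thesis
      by (simp add: vec_eq_iff t_def matrix_vector_mult_def conj_transpose_def)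
  qed
  define u where "u = (\<lambda>i. inv U (t i))"
  have u: "U (u i) = t i" for i unfolding u_def by (rule surj_f_inv_f[OF Us(1)])
  have "\<exists>e. u i = e *s y i" for i
  proof (rule simple)
    have "cvec_inner v (conj_transpose M *v u i + (-1) *s (cnj (l i) *s u i)) = 0" for v
    proof -
      have "cvec_inner v (conj_transpose M *v u i) = cvec_inner (U (M *v v)) (U (u i))"
        by (simp add: cvec_inner_conj_transpose Us)
      also have "\<dots> = l i * cvec_inner v (u i)"
        unfolding US u cvec_inner_conj_transpose t cvec_inner_scale_right unfolding u[symmetric] Us(3) by simp
      finally show ?thesis unfolding cvec_inner_add_right cvec_inner_scale_right by simp
    qed
    then have "conj_transpose M *v u i + (-1) *s (cnj (l i) *s u i) = 0" by (rule cvec_inner_eq_zero)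
    then show "conj_transpose M *v u i = cnj (l i) *s u i" by (simp add: vec_eq_iff)
  qed
  then obtain e where e: "\<And>i. u i = e i *s y i" by metis
  have ip: "e i * cnj (e j) * cvec_inner (y i) (y j) = cnj (cvec_inner (x i) (x j))" for i j
  proof -
    have "e i * cnj (e j) * cvec_inner (y i) (y j) = cvec_inner (u i) (u j)"
      by (simp add: e cvec_inner_scale_left cvec_inner_scale_right)
    also have "\<dots> = cvec_inner (t i) (t j)" unfolding Us(3)[of "u i" "u j", symmetric] u ..
    also have "\<dots> = cnj (cvec_inner (U (x i)) (U (x j)))" by (simp add: cvec_inner_def t_def)
    finally show ?thesis unfolding Us(3) .
  qed
  have e0: "e i \<noteq> 0" for i using ip[of i i] nz[of i] by (auto simp: cvec_inner_self)
  show thesis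
    by (rule that[of "\<lambda>i. 1 / e i"]) (use e0 in \<open>simp_all add: ip[symmetric]\<close>)
qed


section \<open>Conjugations and complex symmetry\<close>

lemma inner_eq_Re_cvec_inner: "u \<bullet> v = Re (cvec_inner u v)" for u v :: "complex ^ 'n::finite"
  by (simp add: cvec_inner_def inner_vec_def inner_complex_def)

lemma scaleR_eq_scale: "r *\<^sub>R v = complex_of_real r *s v" for v :: "complex ^ 'n::finite"
  by (simp only: vec_eq_iff vector_scaleR_component vector_smult_component) (simp add: scaleR_conv_of_real)

text \<open>A real orthonormal basis of the fixed space of an antiunitary involution \<open>J\<close> is a complex
  orthonormal basis in which \<open>J\<close> acts by entrywise conjugation.\<close>

lemma conjugation_real_basis:
  fixes J :: "complex ^ 'n::finite \<Rightarrow> complex ^ 'n"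
  assumes Jadd: "\<And>u v. J (u + v) = J u + J v" and Jscale: "\<And>c v. J (c *s v) = cnj c *s J v"
    and JJ: "\<And>v. J (J v) = v" and Jinner: "\<And>u v. cvec_inner (J u) (J v) = cvec_inner v u"
  obtains e :: "'n \<Rightarrow> complex ^ 'n" where "\<And>i. J (e i) = e i"
    "\<And>i j. cvec_inner (e i) (e j) = (if i = j then 1 else 0)"
    "\<And>v. v = (\<Sum>i\<in>UNIV. cvec_inner v (e i) *s e i)"
proof -
  define R where "R = {v. J v = v}"
  have J0: "J 0 = 0" using Jscale[of 0 0] by simp
  have R: "subspace R"
    unfolding subspace_def R_def by (auto simp: J0 Jadd Jscale scaleR_eq_scale)
  obtain B where B: "B \<subseteq> R" "pairwise orthogonal B" "\<And>b. b \<in> B \<Longrightarrow> norm b = 1" "independent B" "span B = R"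
    using orthonormal_basis_subspace[OF R] by metis
  have finB: "finite B" using B(4) by (rule independent_imp_finite)
  have real: "cvec_inner u v = of_real (u \<bullet> v)" if "u \<in> R" "v \<in> R" for u v
  proof -
    have "cvec_inner u v = cnj (cvec_inner u v)"
      using Jinner[of u v] that cvec_inner_commute[of v u] by (simp add: R_def)
    then show ?thesis by (simp add: inner_eq_Re_cvec_inner complex_eq_iff)
  qed
  have on: "cvec_inner b b' = (if b = b' then 1 else 0)" if "b \<in> B" "b' \<in> B" for b b'
  proof -
    have "b \<bullet> b' = (if b = b' then 1 else 0)"
      using that B(2,3) by (auto simp: pairwise_def orthogonal_def norm_eq_1)
    moreover have "b \<in> R" "b' \<in> R" using that B(1) by auto
    ultimately show ?thesis using real[of b b'] by simp
  qed
  have exR: "v = (\<Sum>b\<in>B. cvec_inner v b *s b)" if v: "v \<in> R" for v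
  proof -
    have "(\<Sum>b\<in>B. (v \<bullet> b) *\<^sub>R b) = v"
      by (rule orthonormal_basis_expand[OF B(2,3) _ finB]) (use v B(5) in auto)
    moreover have "(\<Sum>b\<in>B. (v \<bullet> b) *\<^sub>R b) = (\<Sum>b\<in>B. cvec_inner v b *s b)"
      using v B(1) by (intro sum.cong refl) (auto simp: scaleR_eq_scale real)
    ultimately show ?thesis by simp
  qed
  \<comment> \<open>Every vector is \<open>p + \<i> *s q\<close> with p and q fixed by
    \<open>J\<close>, the analogues of real and imaginary part.\<close>
  have exB: "v = (\<Sum>b\<in>B. cvec_inner v b *s b)" for v
  proof -
    define p where "p = (1/2) *s (v + J v)"
    define q where "q = (1/(2*\<i>)) *s (v + (-1) *s J v)"
    have "p \<in> R" by (simp only: p_def R_def mem_Collect_eq Jscale Jadd JJ) (simp add: add.commute)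
    moreover have "q \<in> R"
      by (simp only: q_def R_def mem_Collect_eq Jscale Jadd JJ) (simp add: vec_eq_iff field_simps)
    moreover have v: "v = p + \<i> *s q" by (simp add: p_def q_def vec_eq_iff field_simps)
    ultimately have "v = (\<Sum>b\<in>B. cvec_inner p b *s b) + \<i> *s (\<Sum>b\<in>B. cvec_inner q b *s b)"
      using exR[of p] exR[of q] by simp
    also have "\<dots> = (\<Sum>b\<in>B. cvec_inner v b *s b)"
      unfolding vec.scale_sum_right sum.distrib[symmetric]
      by (intro sum.cong refl) (simp add: v cvec_inner_add_left cvec_inner_scale_left vec_eq_iff algebra_simps)
    finally show ?thesis .
  qed
  \<comment> \<open>The trace of the identity computed twice: every coordinate contributes 1, so B
    can be indexed by the coordinates.\<close>
  have "real (card B) = (\<Sum>b\<in>B. (norm b)\<^sup>2)" using B(3) by simp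
  also have "\<dots> = (\<Sum>b\<in>B. \<Sum>i\<in>UNIV. (norm (b $ i))\<^sup>2)"
    by (simp add: norm_vec_def L2_set_def sum_nonneg)
  also have "\<dots> = (\<Sum>i\<in>UNIV. \<Sum>b\<in>B. (norm (b $ i))\<^sup>2)" by (rule sum.swap)
  also have "\<dots> = (\<Sum>i\<in>(UNIV :: 'n set). 1)"
  proof (intro sum.cong refl)
    fix i :: 'n
    have ax: "cvec_inner (axis i 1) b = cnj (b $ i)" for b
      by (simp add: cvec_inner_def axis_def mult_delta_left)
    have "(axis i 1 :: complex ^ 'n) $ i = (\<Sum>b\<in>B. cnj (b $ i) *s b) $ i"
      using exB[of "axis i 1"] unfolding ax by (rule arg_cong)
    then have "1 = (\<Sum>b\<in>B. complex_of_real ((norm (b $ i))\<^sup>2))"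
      unfolding complex_norm_square by (simp add: axis_def mult.commute)
    then have "complex_of_real (\<Sum>b\<in>B. (norm (b $ i))\<^sup>2) = of_real 1" by simp
    then show "(\<Sum>b\<in>B. (norm (b $ i))\<^sup>2) = 1" unfolding of_real_eq_iff .
  qed
  finally have "card B = card (UNIV :: 'n set)" by simp
  then obtain e where e: "bij_betw e (UNIV :: 'n set) B"
    using finite_same_card_bij[of "UNIV :: 'n set" B] finB by auto
  have eB: "e i \<in> B" for i using e by (auto simp: bij_betw_def)
  show thesis
  proof (rule that[of e])
    show "J (e i) = e i" for i using eB[of i] B(1) by (auto simp: R_def)
    show "cvec_inner (e i) (e j) = (if i = j then 1 else 0)" for i j
      using on[OF eB eB] e by (auto simp: bij_betw_def inj_def)
    show "v = (\<Sum>i\<in>UNIV. cvec_inner v (e i) *s e i)" for v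
      using exB[of v] sum.reindex_bij_betw[OF e, of "\<lambda>b. cvec_inner v b *s b"] by simp
  qed
qed

text \<open>In a basis fixed by \<open>J\<close>, reversing the inner product with \<open>J\<close>
  and then replacing \<open>J M J\<close> by the adjoint exchanges the two indices of a matrix
  entry.\<close>

lemma complex_symmetric_of_conjugation:
  fixes M :: "complex ^ 'n ^ 'n::finite" and J :: "complex ^ 'n \<Rightarrow> complex ^ 'n"
  assumes Jadd: "\<And>u v. J (u + v) = J u + J v" and Jscale: "\<And>c v. J (c *s v) = cnj c *s J v"
    and JJ: "\<And>v. J (J v) = v" and Jinner: "\<And>u v. cvec_inner (J u) (J v) = cvec_inner v u"
    and JM: "\<And>v. J (M *v J v) = conj_transpose M *v v"
  shows "ue_complex_symmetric M"
proof -
  obtain e :: "'n \<Rightarrow> complex ^ 'n" where e: "\<And>i. J (e i) = e i"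
    and on: "\<And>i j. cvec_inner (e i) (e j) = (if i = j then 1 else 0)"
    and ex: "\<And>v. v = (\<Sum>i\<in>UNIV. cvec_inner v (e i) *s e i)"
    using conjugation_real_basis[OF Jadd Jscale JJ Jinner] by metis
  define S :: "complex ^ 'n ^ 'n" where "S = (\<chi> i j. cvec_inner (M *v e j) (e i))"
  define U where "U = (\<lambda>v. \<chi> i. cvec_inner v (e i))"
  have "cvec_inner (M *v e j) (e i) = cvec_inner (M *v e i) (e j)" for i j
  proof -
    have "cvec_inner (M *v e j) (e i) = cvec_inner (J (e i)) (J (M *v J (e j)))"
      by (simp only: Jinner) (simp only: e)
    also have "\<dots> = cvec_inner (e i) (conj_transpose M *v e j)" unfolding JM unfolding e ..
    also have "\<dots> = cvec_inner (M *v e i) (e j)" by (rule cvec_inner_conj_transpose[symmetric])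
    finally show ?thesis .
  qed
  then have "complex_symmetric S" by (simp add: complex_symmetric_def S_def transpose_def vec_eq_iff)
  moreover have "unitary_map cvec_space cvec_space U"
    unfolding unitary_map_def cvec_space_def
  proof (simp, intro conjI allI)
    show "surj U"
    proof (rule surjI)
      fix w show "U (\<Sum>i\<in>UNIV. (w $ i) *s e i) = w"
        by (simp add: U_def vec_eq_iff cvec_inner_sum_left cvec_inner_scale_left on mult_delta_right)
    qed
    show "U (u + v) = U u + U v" for u v by (simp add: U_def vec_eq_iff cvec_inner_add_left)
    show "U (c *s v) = c *s U v" for c v by (simp add: U_def vec_eq_iff cvec_inner_scale_left)
    show "cvec_inner (U u) (U v) = cvec_inner u v" for u v
    proof -
      have "cvec_inner u v = cvec_inner u (\<Sum>i\<in>UNIV. cvec_inner v (e i) *s e i)" by (subst ex[of v]) (rule refl)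
      also have "\<dots> = cvec_inner (U u) (U v)"
        unfolding cvec_inner_sum_right cvec_inner_scale_right cvec_inner_def[of "U u" "U v"]
        by (simp add: U_def mult.commute)
      finally show ?thesis ..
    qed
  qed
  moreover have "U (M *v v) = S *v U v" for v
  proof -
    have "M *v v = (\<Sum>j\<in>UNIV. cvec_inner v (e j) *s (M *v e j))"
    proof -
      have "M *v (\<Sum>j\<in>A. c j *s e j) = (\<Sum>j\<in>A. c j *s (M *v e j))" for A :: "'n set" and c
        by (induction A rule: infinite_finite_induct) (auto simp: matrix_vector_right_distrib vector_scalar_commute)
      then show ?thesis using ex[of v] by metis
    qed
    then have "cvec_inner (M *v v) (e i) = (\<Sum>j\<in>UNIV. cvec_inner v (e j) * cvec_inner (M *v e j) (e i))" for i
      by (simp add: cvec_inner_sum_left cvec_inner_scale_left)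
    then show ?thesis by (simp add: U_def S_def vec_eq_iff matrix_vector_mult_def mult.commute)
  qed
  ultimately show ?thesis
    unfolding ue_complex_symmetric_def unitarily_equivalent_def by blast
qed

lemma complex_symmetric_of_gram:
  fixes M :: "complex ^ 'n ^ 'n::finite" and x y :: "'n \<Rightarrow> complex ^ 'n"
  assumes dual: "\<And>i j. cvec_inner (x i) (y j) = (if i = j then 1 else 0)"
    and ex: "\<And>v. v = (\<Sum>i\<in>UNIV. cvec_inner v (y i) *s x i)"
    and ey: "\<And>v. v = (\<Sum>i\<in>UNIV. cvec_inner v (x i) *s y i)"
    and Mx: "\<And>i. M *v x i = l i *s x i"
    and My: "\<And>i. conj_transpose M *v y i = cnj (l i) *s y i"
    and d: "\<And>i. d i \<noteq> 0"
    and gram: "\<And>i j. cvec_inner (y i) (y j) = d i * cnj (d j) * cnj (cvec_inner (x i) (x j))"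
  shows "ue_complex_symmetric M"
proof -
  \<comment> \<open>The antilinear map sending \<open>x i\<close> to
    \<open>(1 / d i) *s y i\<close>.\<close>
  define J where "J = (\<lambda>v. \<Sum>i\<in>UNIV. (cnj (cvec_inner v (y i)) / d i) *s y i)"
  have Jadd: "J (u + v) = J u + J v" for u v
    unfolding J_def sum.distrib[symmetric]
    by (intro sum.cong refl) (simp add: cvec_inner_add_left vec_eq_iff add_divide_distrib algebra_simps)
  have Jscale: "J (c *s v) = cnj c *s J v" for c v
    unfolding J_def vec.scale_sum_right
    by (intro sum.cong refl) (simp add: cvec_inner_scale_left)
  have Jsum: "J (\<Sum>i\<in>A. c i *s b i) = (\<Sum>i\<in>A. cnj (c i) *s J (b i))" if "finite A" for A :: "'n set" and c b
    using that
  proof induction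
    case empty
    show ?case using Jscale[of 0 0] by simp
  qed (simp add: Jadd Jscale)
  have Jx: "J (x i) = (1 / d i) *s y i" for i
  proof -
    have "(cnj (cvec_inner (x i) (y j)) / d j) *s y j = (if j = i then (1 / d i) *s y i else 0)" for j
      by (simp add: dual)
    then show ?thesis unfolding J_def by simp
  qed
  \<comment> \<open>On the vectors \<open>x i\<close> this is precisely the rescaling
    hypothesis.\<close>
  have Jinner: "cvec_inner (J u) (J v) = cvec_inner v u" for u v
  proof -
    have "cvec_inner (J u) (J v) = (\<Sum>i\<in>UNIV. \<Sum>j\<in>UNIV. cnj (cvec_inner u (y i)) / d i * (cnj (cnj (cvec_inner v (y j)) / d j) * cvec_inner (y i) (y j)))"
      unfolding J_def cvec_inner_sum_left cvec_inner_scale_left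
      by (simp only: cvec_inner_sum_right cvec_inner_scale_right sum_distrib_left)
    also have "\<dots> = (\<Sum>i\<in>UNIV. \<Sum>j\<in>UNIV. cnj (cvec_inner u (y i)) * (cvec_inner v (y j) * cvec_inner (x j) (x i)))"
    proof (intro sum.cong refl)
      fix i j
      have "cnj (cvec_inner (x i) (x j)) = cvec_inner (x j) (x i)" by (rule cvec_inner_commute[symmetric])
      then show "cnj (cvec_inner u (y i)) / d i * (cnj (cnj (cvec_inner v (y j)) / d j) * cvec_inner (y i) (y j)) =
        cnj (cvec_inner u (y i)) * (cvec_inner v (y j) * cvec_inner (x j) (x i))"
        using d[of i] d[of j] by (simp add: gram)
    qed
    also have "\<dots> = cvec_inner (\<Sum>j\<in>UNIV. cvec_inner v (y j) *s x j) (\<Sum>i\<in>UNIV. cvec_inner u (y i) *s x i)"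
      unfolding cvec_inner_sum_right cvec_inner_scale_right
      by (simp only: cvec_inner_sum_left cvec_inner_scale_left sum_distrib_left)
    finally show ?thesis using ex[of u] ex[of v] by simp
  qed
  \<comment> \<open>Since \<open>y j\<close> is a multiple of \<open>J (x j)\<close>, antiunitarity
    removes one \<open>J\<close> from the inner product with \<open>y j\<close>, and the diagonal
    factors cancel.\<close>
  have JJx: "J (J (x i)) = x i" for i
  proof -
    have *: "cvec_inner (x k) (J (x j)) = (if k = j then 1 / cnj (d j) else 0)" for j k
      by (simp add: Jx cvec_inner_scale_right dual)
    have "cvec_inner (J (J (x i))) (x k) = cvec_inner (x i) (x k)" for k
    proof -
      have e: "x k = (\<Sum>j\<in>UNIV. cvec_inner (x k) (x j) *s y j)" by (rule ey)
      have "y j = d j *s J (x j)" for j using d[of j] by (simp add: Jx)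
      then have "cvec_inner (J (J (x i))) (y j) = cnj (d j) * cvec_inner (x j) (J (x i))" for j
        by (simp add: cvec_inner_scale_right Jinner)
      then have "cvec_inner (J (J (x i))) (y j) = cvec_inner (x i) (y j)" for j
        using d[of j] by (simp add: * dual)
      then show ?thesis using e cvec_inner_sum_right by (metis (no_types, lifting) cvec_inner_scale_right sum.cong)
    qed
    then have "cvec_inner (x i + (-1) *s J (J (x i))) (x k) = 0" for k
      unfolding cvec_inner_add_left cvec_inner_scale_left by simp
    then have "x i + (-1) *s J (J (x i)) = 0" by (subst ey) simp
    then show ?thesis by (simp add: vec_eq_iff)
  qed
  have JJ: "J (J v) = v" for v
  proof -
    have "J (J (\<Sum>i\<in>UNIV. cvec_inner v (y i) *s x i)) = (\<Sum>i\<in>UNIV. cvec_inner v (y i) *s x i)"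
      by (simp add: Jsum JJx)
    then show ?thesis using ex[of v] by metis
  qed
  have JM: "J (M *v J v) = conj_transpose M *v v" for v
  proof -
    have lin: "A *v (\<Sum>j\<in>B. c j *s b j) = (\<Sum>j\<in>B. c j *s (A *v b j))" for A :: "complex ^ 'n ^ 'n" and B :: "'n set" and c b
      by (induction B rule: infinite_finite_induct) (auto simp: matrix_vector_right_distrib vector_scalar_commute)
    have "J (M *v J (y i)) = conj_transpose M *v y i" for i
    proof -
      have "y i = d i *s J (x i)" using d[of i] by (simp add: Jx)
      then have "J (y i) = cnj (d i) *s x i" by (simp add: Jscale JJ)
      then have "J (M *v J (y i)) = (d i * cnj (l i)) *s J (x i)"
        by (simp add: vector_scalar_commute Mx Jscale mult.commute)
      also have "\<dots> = conj_transpose M *v y i" using d[of i] by (simp add: Jx My)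
      finally show ?thesis .
    qed
    then have "J (M *v J (\<Sum>i\<in>UNIV. cvec_inner v (x i) *s y i)) = conj_transpose M *v (\<Sum>i\<in>UNIV. cvec_inner v (x i) *s y i)"
      by (simp add: Jsum lin)
    then show ?thesis using ey[of v] by metis
  qed
  show ?thesis by (rule complex_symmetric_of_conjugation[OF Jadd Jscale JJ Jinner JM])
qed

section \<open>The three-dimensional case\<close>

text \<open>Cramer's rule for a row times a matrix with unit diagonal and determinant
  \<open>D\<close>. Primed letters stand for conjugates but are independent variables, so that the
  claims are polynomial identities.\<close>

lemma gram3_solve:
  fixes a b c a' b' c' h1 h2 h3 u v w :: complex
  assumes "h1 + h2 * a' + h3 * c = u" "h1 * a + h2 + h3 * b' = v" "h1 * c' + h2 * b + h3 = w"
  defines "D \<equiv> 1 + a * b * c + a' * b' * c' - a * a' - b * b' - c * c'"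
  shows "D * h1 = u * (1 - b * b') + v * (b * c - a') + w * (a' * b' - c)"
    "D * h2 = u * (b' * c' - a) + v * (1 - c * c') + w * (c * a - b')"
    "D * h3 = u * (a * b - c') + v * (c' * a' - b) + w * (1 - a * a')"
  unfolding D_def assms(1-3)[symmetric] by algebra+

text \<open>After multiplication by \<open>D^2\<close> the difference of the two sides on the left
  becomes the difference of the two sides on the right.\<close>

lemma gram3_key:
  fixes a b c a' b' c' h11 h12 h21 h22 D :: complex
  assumes D: "D = 1 + a * b * c + a' * b' * c' - a * a' - b * b' - c * c'" and "D \<noteq> 0"
    and h: "D * h11 = 1 - b * b'" "D * h22 = 1 - c * c'" "D * h12 = b' * c' - a" "D * h21 = b * c - a'"
  shows "h12 * h21 = a * a' * h11 * h22 \<longleftrightarrow> D = (1 - a * a') * (1 - b * b') * (1 - c * c')"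
proof -
  have "D\<^sup>2 * (h12 * h21 - a * a' * h11 * h22) = (D * h12) * (D * h21) - a * a' * (D * h11) * (D * h22)"
    by algebra
  also have "\<dots> = (1 - a * a') * (1 - b * b') * (1 - c * c') - D"
    unfolding h unfolding D by algebra
  finally have "D\<^sup>2 * (h12 * h21 - a * a' * h11 * h22) = (1 - a * a') * (1 - b * b') * (1 - c * c') - D" .
  moreover have "h12 * h21 = a * a' * h11 * h22 \<longleftrightarrow> D\<^sup>2 * (h12 * h21 - a * a' * h11 * h22) = 0"
    using \<open>D \<noteq> 0\<close> by simp
  ultimately show ?thesis by (metis eq_iff_diff_eq_0)
qed

text \<open>Scale-invariant form of the fact that \<open>1 - k 3 3 * k i j / (k i 3 * k 3 j)\<close> has rank one for
  the kernel \<open>k i j = 1 / (1 - m i * n j)\<close>.\<close>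

lemma szego_gram_relation:
  fixes c c' m n :: "3 \<Rightarrow> complex"
  assumes "\<And>i j. 1 - m i * n j \<noteq> 0" and H: "\<And>i j. H i j = c i * c' j / (1 - m i * n j)"
  shows "(H 1 2 * H 3 3 - H 1 3 * H 3 2) * (H 2 1 * H 3 3 - H 2 3 * H 3 1) * (H 1 1 * H 2 2)
    = (H 1 1 * H 3 3 - H 1 3 * H 3 1) * (H 2 2 * H 3 3 - H 2 3 * H 3 2) * (H 1 2 * H 2 1)"
proof -
  \<comment> \<open>The correction factor splits into a function of i times a function of j, so it
    contributes equally to the index pairs (1,2), (2,1) and to (1,1), (2,2).\<close>
  have eq: "H i j * H 3 3 - H i 3 * H 3 j = H i j * ((m i - m 3) * (n j - n 3) * c 3 * c' 3 / ((1 - m i * n 3) * (1 - m 3 * n j) * (1 - m 3 * n 3)))" for i j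
  proof -
    have nz: "1 - m i * n j \<noteq> 0" "1 - m 3 * n 3 \<noteq> 0" "1 - m i * n 3 \<noteq> 0" "1 - m 3 * n j \<noteq> 0" using assms(1) by auto
    have gen: "c i * c' j / p * (c 3 * c' 3 / q) - c i * c' 3 / r * (c 3 * c' j / s) = c i * c' j / p * ((r * s - p * q) * c 3 * c' 3 / (r * s * q))"
      if "p \<noteq> 0" "q \<noteq> 0" "r \<noteq> 0" "s \<noteq> 0" for p q r s
      using that by (simp add: field_simps)
    have id: "(1 - m i * n 3) * (1 - m 3 * n j) - (1 - m i * n j) * (1 - m 3 * n 3) = (m i - m 3) * (n j - n 3)"
      by (simp add: algebra_simps)
    show ?thesis unfolding H gen[OF nz] id ..
  qed
  show ?thesis unfolding eq[of 1 2] eq[of 2 1] eq[of 1 1] eq[of 2 2] by (simp add: mult_ac)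
qed


text \<open>Controls arguments, where \<open>gram3_key\<close> only controls moduli. After
  multiplication by \<open>D^2\<close> the two sides differ by exactly
  \<open>(1 - a * a') * (1 - b * b') * (1 - c * c') - D\<close>.\<close>

lemma gram3_phase:
  fixes a b c a' b' c' h12 h33 h13 h32 D :: complex
  assumes D: "D = 1 + a * b * c + a' * b' * c' - a * a' - b * b' - c * c'" and "D \<noteq> 0"
    and h: "D * h12 = b' * c' - a" "D * h33 = 1 - a * a'" "D * h13 = a * b - c'" "D * h32 = c * a - b'"
    and III: "D = (1 - a * a') * (1 - b * b') * (1 - c * c')"
  shows "h12 * h33 * (c * b) = h13 * h32 * a'"
proof -
  have "D\<^sup>2 * (h12 * h33 * (c * b)) = (D * h12) * (D * h33) * (c * b)" by algebra
  also have "\<dots> = (D * h13) * (D * h32) * a'"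
    using D III unfolding h by algebra
  also have "\<dots> = D\<^sup>2 * (h13 * h32 * a')" by algebra
  finally show ?thesis using \<open>D \<noteq> 0\<close> by simp
qed

theorem theorem5p1:
  fixes M X :: "complex ^ 3 ^ 3"
    and l :: "3 \<Rightarrow> complex"
    and x :: "3 \<Rightarrow> complex ^ 3"
  assumes distinct: "inj l"
    and eigen: "\<And>i. M *v x i = l i *s x i"
    and unit: "\<And>i. norm (x i) = 1"
    and nonorth: "\<And>i j. cvec_inner (x i) (x j) \<noteq> 0"
    and X: "X = (\<chi> i j. x j $ i)"
  shows "(ue_analytic_tto M \<longleftrightarrow> ue_complex_symmetric M) \<and>
    (ue_complex_symmetric M \<longleftrightarrow>
      det (conj_transpose X ** X) =
        of_real ((1 - (norm (cvec_inner (x 1) (x 2)))\<^sup>2) *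
                 (1 - (norm (cvec_inner (x 2) (x 3)))\<^sup>2) *
                 (1 - (norm (cvec_inner (x 3) (x 1)))\<^sup>2)))"
proof -
  have nz: "x i \<noteq> 0" for i using unit[of i] by force
  obtain y where dual: "\<And>i j. cvec_inner (x i) (y j) = (if i = j then 1 else 0)"
    and ex: "\<And>v. v = (\<Sum>i\<in>UNIV. cvec_inner v (y i) *s x i)"
    and ey: "\<And>v. v = (\<Sum>i\<in>UNIV. cvec_inner v (x i) *s y i)"
    and y0: "\<And>i. y i \<noteq> 0"
    and My: "\<And>i. conj_transpose M *v y i = cnj (l i) *s y i"
    and simple: "\<And>i u. conj_transpose M *v u = cnj (l i) *s u \<Longrightarrow> \<exists>c. u = c *s y i"
    by (rule dual_eigenbasis[OF distinct eigen nz]) (rule that)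
  define G where "G = (\<lambda>i j. cvec_inner (x i) (x j))"
  define H where "H = (\<lambda>i j. cvec_inner (y i) (y j))"
  \<comment> \<open>The cyclic labelling lets the identities be reused under rotation of the
    indices.\<close>
  define a b c where "a = G 1 2" and "b = G 2 3" and "c = G 3 1"
  define D where "D = 1 + a * b * c + cnj a * cnj b * cnj c - a * cnj a - b * cnj b - c * cnj c"
  have Gc: "G j i = cnj (G i j)" and Hc: "H j i = cnj (H i j)" for i j
    unfolding G_def H_def by (rule cvec_inner_commute)+
  have Gs: "G i i = 1" for i using unit[of i] by (simp add: G_def cvec_inner_self)
  have G6: "G 1 2 = a" "G 2 3 = b" "G 3 1 = c" "G 2 1 = cnj a" "G 3 2 = cnj b" "G 1 3 = cnj c"
    using Gc[of 2 1] Gc[of 3 2] Gc[of 1 3] by (simp_all add: a_def b_def c_def)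
  have abc0: "a \<noteq> 0" "b \<noteq> 0" "c \<noteq> 0" using nonorth by (auto simp: a_def b_def c_def G_def)
  have inv: "H k 1 * G 1 i + H k 2 * G 2 i + H k 3 * G 3 i = (if i = k then 1 else 0)" for k i
    using gram_inverse[OF dual ex, of k i] by (simp add: sum_3 G_def H_def)
  have solve: "D * H k 1 = (if 1 = k then 1 else 0) * (1 - b * cnj b) + (if 2 = k then 1 else 0) * (b * c - cnj a) + (if 3 = k then 1 else 0) * (cnj a * cnj b - c)"
    "D * H k 2 = (if 1 = k then 1 else 0) * (cnj b * cnj c - a) + (if 2 = k then 1 else 0) * (1 - c * cnj c) + (if 3 = k then 1 else 0) * (c * a - cnj b)"
    "D * H k 3 = (if 1 = k then 1 else 0) * (a * b - cnj c) + (if 2 = k then 1 else 0) * (cnj c * cnj a - b) + (if 3 = k then 1 else 0) * (1 - a * cnj a)" for k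
    unfolding D_def using inv[of k 1] inv[of k 2] inv[of k 3] by (intro gram3_solve; simp add: G6 Gs)+
  have ne3: "(1::3) \<noteq> 2" "(1::3) \<noteq> 3" "(2::3) \<noteq> 3" by simp_all
  have DH: "D * H 1 1 = 1 - b * cnj b" "D * H 2 2 = 1 - c * cnj c" "D * H 3 3 = 1 - a * cnj a"
    "D * H 1 2 = cnj b * cnj c - a" "D * H 2 1 = b * c - cnj a"
    "D * H 2 3 = cnj c * cnj a - b" "D * H 3 2 = c * a - cnj b"
    "D * H 3 1 = cnj a * cnj b - c" "D * H 1 3 = a * b - cnj c"
    using solve[of 1] solve[of 2] solve[of 3] ne3 by simp_all
  define A B C where "A = (norm a)\<^sup>2" and "B = (norm b)\<^sup>2" and "C = (norm c)\<^sup>2"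
  have ABC: "a * cnj a = of_real A" "b * cnj b = of_real B" "c * cnj c = of_real C"
    by (simp_all add: A_def B_def C_def complex_norm_square del: of_real_power)
  have ABC0: "A > 0" "B > 0" "C > 0" using abc0 by (simp_all add: A_def B_def C_def)
  define \<rho> where "\<rho> = (\<lambda>i. (norm (y i))\<^sup>2)"
  have \<rho>: "\<rho> i > 0" "H i i = of_real (\<rho> i)" for i using y0[of i] by (simp_all add: \<rho>_def H_def cvec_inner_self)
  \<comment> \<open>Strict Cauchy-Schwarz: the part of \<open>x 1\<close> orthogonal to
    \<open>x 2\<close> has square norm \<open>1 - A\<close>, and it is nonzero because its inner
    product with \<open>y 1\<close> is 1.\<close>
  have A1: "A < 1"
  proof -
    let ?v = "x 1 + (- a) *s x 2"
    have "cvec_inner ?v (y 1) = 1" by (simp only: cvec_inner_add_left cvec_inner_scale_left dual) simp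
    then have "?v \<noteq> 0" by (auto simp: cvec_inner_def)
    then have "0 < (norm ?v)\<^sup>2" by simp
    moreover have "cvec_inner ?v ?v = of_real (1 - A)"
    proof -
      have "cvec_inner ?v ?v = G 1 1 + (- cnj a) * G 1 2 + ((- a) * G 2 1 + (- a) * ((- cnj a) * G 2 2))"
        unfolding G_def by (simp only: cvec_inner_add_left cvec_inner_scale_left cvec_inner_add_right cvec_inner_scale_right complex_cnj_minus) (simp add: algebra_simps)
      also have "\<dots> = 1 - a * cnj a" by (simp add: G6 Gs)
      finally show ?thesis by (simp add: ABC)
    qed
    then have "(norm ?v)\<^sup>2 = 1 - A" unfolding cvec_inner_self of_real_eq_iff .
    ultimately show ?thesis by linarith
  qed
  \<comment> \<open>Read off from \<open>D * H 3 3 = 1 - A\<close>. It shows that the determinant is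
    positive, which in turn gives \<open>B < 1\<close> and \<open>C < 1\<close> from the other
    diagonal entries.\<close>
  define \<delta> where "\<delta> = (1 - A) / \<rho> 3"
  have \<delta>: "\<delta> > 0" "D = of_real \<delta>"
    using A1 \<rho>[of 3] DH(3) by (simp_all add: \<delta>_def ABC field_simps)
  have D0: "D \<noteq> 0" using \<delta> by simp
  have "complex_of_real (\<delta> * \<rho> 1) = of_real (1 - B)" "complex_of_real (\<delta> * \<rho> 2) = of_real (1 - C)"
    using DH(1,2) by (simp_all add: \<delta> \<rho> ABC)
  then have "\<delta> * \<rho> 1 = 1 - B" "\<delta> * \<rho> 2 = 1 - C" unfolding of_real_eq_iff .
  then have B1: "B < 1" and C1: "C < 1" using mult_pos_pos[OF \<delta>(1) \<rho>(1)[of 1]] mult_pos_pos[OF \<delta>(1) \<rho>(1)[of 2]] by auto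
  define III where "III \<longleftrightarrow> D = (1 - a * cnj a) * (1 - b * cnj b) * (1 - c * cnj c)"
  have III_iff: "det (conj_transpose X ** X) = of_real ((1 - (norm (cvec_inner (x 1) (x 2)))\<^sup>2) *
     (1 - (norm (cvec_inner (x 2) (x 3)))\<^sup>2) * (1 - (norm (cvec_inner (x 3) (x 1)))\<^sup>2)) \<longleftrightarrow> III"
  proof -
    \<comment> \<open>Indices are swapped because the inner product is conjugate-linear in its
      second argument; the determinant does not notice.\<close>
    have XX: "(conj_transpose X ** X) $ i $ j = G j i" for i j
      by (simp add: matrix_matrix_mult_def conj_transpose_def X G_def cvec_inner_def mult.commute)
    have "det (conj_transpose X ** X) = D"
      unfolding det_3 XX G6 Gs D_def by (simp add: algebra_simps)
    moreover have "complex_of_real ((1 - (norm (cvec_inner (x 1) (x 2)))\<^sup>2) *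
     (1 - (norm (cvec_inner (x 2) (x 3)))\<^sup>2) * (1 - (norm (cvec_inner (x 3) (x 1)))\<^sup>2)) = (1 - a * cnj a) * (1 - b * cnj b) * (1 - c * cnj c)"
      unfolding ABC unfolding A_def B_def C_def unfolding a_def b_def c_def G_def by simp
    ultimately show ?thesis by (simp only: III_def)
  qed
  have key12: "H 1 2 * H 2 1 = a * cnj a * H 1 1 * H 2 2 \<longleftrightarrow> III"
    unfolding III_def by (rule gram3_key[OF D_def D0 DH(1,2,4,5)])
  have key23: "H 2 3 * H 3 2 = b * cnj b * H 2 2 * H 3 3 \<longleftrightarrow> III"
  proof -
    have "D = 1 + b * c * a + cnj b * cnj c * cnj a - b * cnj b - c * cnj c - a * cnj a"
      unfolding D_def by (simp add: algebra_simps)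
    from gram3_key[OF this D0 DH(2,3,6,7)] show ?thesis unfolding III_def by (simp add: mult_ac)
  qed
  have key31: "H 3 1 * H 1 3 = c * cnj c * H 3 3 * H 1 1 \<longleftrightarrow> III"
  proof -
    have "D = 1 + c * a * b + cnj c * cnj a * cnj b - c * cnj c - a * cnj a - b * cnj b"
      unfolding D_def by (simp add: algebra_simps)
    from gram3_key[OF this D0 DH(3,1,8,9)] show ?thesis unfolding III_def by (simp add: mult_ac)
  qed
  \<comment> \<open>Two-by-two minors of the inverse matrix: times \<open>D\<close> they are entries
    of the Gram matrix of x, up to sign.\<close>
  have cof: "D * (H 1 2 * H 3 3 - H 1 3 * H 3 2) = - a" "D * (H 2 1 * H 3 3 - H 2 3 * H 3 1) = - cnj a"
    "D * (H 1 1 * H 3 3 - H 1 3 * H 3 1) = 1" "D * (H 2 2 * H 3 3 - H 2 3 * H 3 2) = 1"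
  proof -
    have e: "D * (D * (p * q - r * s)) = (D * p) * (D * q) - (D * r) * (D * s)" for p q r s by algebra
    have "D * (D * (H 1 2 * H 3 3 - H 1 3 * H 3 2)) = D * - a"
      "D * (D * (H 2 1 * H 3 3 - H 2 3 * H 3 1)) = D * - cnj a"
      "D * (D * (H 1 1 * H 3 3 - H 1 3 * H 3 1)) = D * 1"
      "D * (D * (H 2 2 * H 3 3 - H 2 3 * H 3 2)) = D * 1"
      unfolding e DH by (simp_all add: D_def algebra_simps)
    then show "D * (H 1 2 * H 3 3 - H 1 3 * H 3 2) = - a" "D * (H 2 1 * H 3 3 - H 2 3 * H 3 1) = - cnj a"
      "D * (H 1 1 * H 3 3 - H 1 3 * H 3 1) = 1" "D * (H 2 2 * H 3 3 - H 2 3 * H 3 2) = 1"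
      unfolding mult_left_cancel[OF D0] .
  qed
  have symm_III: "III" if ii: "ue_complex_symmetric M"
  proof -
    obtain d where d: "\<And>i j. cvec_inner (y i) (y j) = d i * cnj (d j) * cnj (cvec_inner (x i) (x j))"
      by (rule complex_symmetric_gram[where x=x and y=y and l=l, OF ii eigen nz]) (erule simple, rule that)
    have "H i j = d i * cnj (d j) * cnj (G i j)" for i j unfolding H_def G_def by (rule d)
    then have "H 1 2 * H 2 1 = a * cnj a * H 1 1 * H 2 2" by (simp add: G6 Gs)
    then show ?thesis unfolding key12 .
  qed
  have tto_III: "III" if i: "ue_analytic_tto M"
  proof -
    obtain \<kappa> \<mu> where \<mu>: "\<And>i. norm (\<mu> i) < 1"
      and "\<And>i j. cvec_inner (y i) (y j) = \<kappa> i * cnj (\<kappa> j) / (1 - \<mu> i * cnj (\<mu> j))"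
      by (rule tto_adjoint_gram[where y=y and l=l, OF i My y0]) (erule simple, rule that)
    then have gram: "H i j = \<kappa> i * cnj (\<kappa> j) / (1 - \<mu> i * cnj (\<mu> j))" for i j unfolding H_def by blast
    have "1 - \<mu> i * cnj (\<mu> j) \<noteq> 0" for i j
      using \<mu>[of i] \<mu>[of j] by (intro disk_denominator_nonzero) auto
    from szego_gram_relation[where H=H and m=\<mu> and n="\<lambda>j. cnj (\<mu> j)" and c=\<kappa> and c'="\<lambda>j. cnj (\<kappa> j)", OF this gram]
    have "(D * (H 1 2 * H 3 3 - H 1 3 * H 3 2)) * (D * (H 2 1 * H 3 3 - H 2 3 * H 3 1)) * (H 1 1 * H 2 2)
      = (D * (H 1 1 * H 3 3 - H 1 3 * H 3 1)) * (D * (H 2 2 * H 3 3 - H 2 3 * H 3 2)) * (H 1 2 * H 2 1)"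
      by algebra
    then have "H 1 2 * H 2 1 = a * cnj a * H 1 1 * H 2 2" unfolding cof by (simp add: mult.assoc)
    then show ?thesis unfolding key12 .
  qed
  have III_facts: "H 1 2 * H 2 1 = a * cnj a * H 1 1 * H 2 2" "H 2 3 * H 3 2 = b * cnj b * H 2 2 * H 3 3"
    "H 3 1 * H 1 3 = c * cnj c * H 3 3 * H 1 1" if III
    using that key12 key23 key31 by blast+
  have Hii0: "H i i \<noteq> 0" for i using \<rho>[of i] by simp
  \<comment> \<open>Under (iii) the off-diagonal entries of \<open>H\<close> inherit nonvanishing
    from those of \<open>G\<close>, which permits the divisions below.\<close>
  have H0: "H 1 2 \<noteq> 0" "H 2 3 \<noteq> 0" "H 1 3 \<noteq> 0" if III
    using III_facts[OF that] abc0 Hii0 by (metis complex_cnj_zero_iff mult_eq_0_iff)+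
  have root: "of_real (sqrt (\<rho> 3)) * of_real (sqrt (\<rho> 3)) = H 3 3"
    using \<rho>[of 3] by (simp flip: of_real_mult)
  have III_symm: "ue_complex_symmetric M" if iii: III
  proof -
    \<comment> \<open>Forced by the third column of the rescaling equation once \<open>d 3\<close>
      is chosen positive, that is, equal to \<open>sqrt (\<rho> 3)\<close>.\<close>
    define d where "d = (\<lambda>i. H i 3 / (of_real (sqrt (\<rho> 3)) * cnj (G i 3)))"
    have G0: "G i j \<noteq> 0" for i j using nonorth by (simp add: G_def)
    have Hi3: "H i 3 \<noteq> 0" for i using H0[OF iii] Hii0 exhaust_3[of i] by auto
    have d0: "d i \<noteq> 0" for i using \<rho>(1)[of 3] by (simp add: d_def Hi3 G0)
    \<comment> \<open>Entries in row or column 3 are trivial and the diagonal ones are moduli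
      identities; only (1,2) and its conjugate need the phase identity.\<close>
    have main: "H i j * H 3 3 * (G 3 i * G j 3) = H i 3 * H 3 j * G j i" for i j
    proof -
      have 12: "H 1 2 * H 3 3 * (c * b) = H 1 3 * H 3 2 * cnj a"
        by (rule gram3_phase[OF D_def D0 DH(4,3,9,7)]) (use iii in \<open>simp add: III_def\<close>)
      then have "cnj (H 1 2 * H 3 3 * (c * b)) = cnj (H 1 3 * H 3 2 * cnj a)" by simp
      then have 21: "H 2 1 * H 3 3 * (cnj c * cnj b) = H 2 3 * H 3 1 * a"
        using Hc[of 2 1] Hc[of 3 3] Hc[of 3 1] Hc[of 2 3] by (simp add: mult_ac)
      show ?thesis
        using exhaust_3[of i] exhaust_3[of j] 12 21 III_facts[OF iii] by (auto simp: G6 Gs mult_ac)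
    qed
    have gram: "cvec_inner (y i) (y j) = d i * cnj (d j) * cnj (cvec_inner (x i) (x j))" for i j
    proof -
      have "d i * cnj (d j) * cnj (G i j) = H i 3 * H 3 j * G j i / (H 3 3 * (G 3 i * G j 3))"
        unfolding d_def root[symmetric] using Gc[of i 3] Gc[of i j] Hc[of j 3] by simp
      also have "\<dots> = H i j" unfolding main[symmetric] using Hii0 G0 by simp
      finally show ?thesis by (simp add: H_def G_def)
    qed
    show ?thesis
      by (rule complex_symmetric_of_gram[where x=x and y=y and l=l and d=d, OF dual ex ey eigen My d0 gram])
  qed
  have III_tto: "ue_analytic_tto M" if iii: III
  proof -
    \<comment> \<open>The value that \<open>\<mu> 3 = 0\<close> forces on
      \<open>\<mu> 1 * cnj (\<mu> 2)\<close>. A rotation of the disk makes \<open>\<mu> 1\<close>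
      positive, and the entry (1,1) then requires \<open>m^2 = 1 - C\<close>.\<close>
    define q where "q = 1 - H 1 3 * H 3 2 / (H 3 3 * H 1 2)"
    define m where "m = sqrt (1 - C)"
    define \<mu> :: "3 \<Rightarrow> complex" where "\<mu> = (\<lambda>i. if i = 1 then of_real m else if i = 2 then cnj q / of_real m else 0)"
    \<comment> \<open>From \<open>H i 3 = \<kappa> i * cnj (\<kappa> 3)\<close>, valid because
      \<open>\<mu> 3 = 0\<close>, with \<open>\<kappa> 3\<close> positive.\<close>
    define \<kappa> where "\<kappa> = (\<lambda>i. H i 3 / of_real (sqrt (\<rho> 3)))"
    have m: "0 < m" "m < 1" "m\<^sup>2 = 1 - C" using C1 ABC0 by (auto simp: m_def)
    have mm: "complex_of_real m * of_real m = 1 - c * cnj c"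
      using m(3) by (simp add: ABC power2_eq_square flip: of_real_mult)
    have q_eq: "q * (D * H 3 3 * H 1 2) = - a"
    proof -
      have "q * (H 3 3 * H 1 2) = H 1 2 * H 3 3 - H 1 3 * H 3 2"
        unfolding q_def using Hii0[of 3] H0(1)[OF iii] by (simp add: field_simps)
      then show ?thesis using cof(1) by (simp add: mult_ac)
    qed
    \<comment> \<open>The rank-one condition: it makes the \<open>\<mu> 2\<close> already determined
      by q and m satisfy the remaining diagonal equation (2,2).\<close>
    have qq: "q * cnj q = (1 - b * cnj b) * (1 - c * cnj c)"
    proof -
      have "cnj (q * (D * H 3 3 * H 1 2)) = cnj (- a)" unfolding q_eq ..
      then have "cnj q * (D * H 3 3 * H 2 1) = - cnj a" using Hc[of 2 1] Hc[of 3 3] by (simp add: \<delta>)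
      then have "(q * (D * H 3 3 * H 1 2)) * (cnj q * (D * H 3 3 * H 2 1)) = a * cnj a" unfolding q_eq by simp
      then have "q * cnj q * (D * H 3 3)\<^sup>2 * (H 1 2 * H 2 1) = a * cnj a" by algebra
      then have "(a * cnj a) * (q * cnj q * (D * H 3 3)\<^sup>2 * (H 1 1 * H 2 2)) = (a * cnj a) * 1"
        unfolding III_facts(1)[OF iii] by (simp add: mult_ac)
      then have "q * cnj q * (D * H 3 3)\<^sup>2 * (H 1 1 * H 2 2) = 1" using abc0 by simp
      then have "q * cnj q * (D * H 3 3)\<^sup>2 * ((D * H 1 1) * (D * H 2 2)) = D\<^sup>2" by algebra
      then have "q * cnj q * ((1 - a * cnj a)\<^sup>2 * ((1 - b * cnj b) * (1 - c * cnj c))) = D\<^sup>2"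
        unfolding DH by (simp only: mult.assoc)
      also have "D\<^sup>2 = ((1 - b * cnj b) * (1 - c * cnj c)) * ((1 - a * cnj a)\<^sup>2 * ((1 - b * cnj b) * (1 - c * cnj c)))"
        unfolding iii[unfolded III_def] by algebra
      finally have "q * cnj q * ((1 - a * cnj a)\<^sup>2 * ((1 - b * cnj b) * (1 - c * cnj c))) =
        ((1 - b * cnj b) * (1 - c * cnj c)) * ((1 - a * cnj a)\<^sup>2 * ((1 - b * cnj b) * (1 - c * cnj c)))" .
      moreover have "(1 - a * cnj a)\<^sup>2 * ((1 - b * cnj b) * (1 - c * cnj c)) \<noteq> 0"
      proof -
        have "1 - complex_of_real t \<noteq> 0" if "t < 1" for t
        proof -
          have "1 - complex_of_real t = of_real (1 - t)" by simp
          then show ?thesis using that by (simp only: of_real_eq_0_iff)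
        qed
        then show ?thesis using A1 B1 C1 unfolding ABC by simp
      qed
      ultimately show ?thesis by (metis mult_right_cancel)
    qed
    have \<mu>2: "\<mu> 2 * cnj (\<mu> 2) = 1 - b * cnj b"
    proof -
      have "\<mu> 2 * cnj (\<mu> 2) = q * cnj q / (of_real m * of_real m)" by (simp add: \<mu>_def)
      also have "\<dots> = 1 - b * cnj b" unfolding qq mm[symmetric] using m(1) by simp
      finally show ?thesis .
    qed
    have \<mu>2': "(norm (\<mu> 2))\<^sup>2 = 1 - B"
    proof -
      have "complex_of_real ((norm (\<mu> 2))\<^sup>2) = of_real (1 - B)"
        using \<mu>2 unfolding complex_norm_square ABC by simp
      then show ?thesis unfolding of_real_eq_iff .
    qed
    have \<mu>1: "norm (\<mu> i) < 1" for i
    proof -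
      have "(norm (\<mu> 2))\<^sup>2 < 1" using \<mu>2' ABC0 by simp
      then have "norm (\<mu> 2) < 1" by (simp add: abs_square_less_1)
      moreover have "norm (\<mu> 1) < 1" "norm (\<mu> 3) < 1" using m by (simp_all add: \<mu>_def)
      ultimately show ?thesis using exhaust_3[of i] by metis
    qed
    have den: "1 - \<mu> i * cnj (\<mu> j) \<noteq> 0" for i j
      using \<mu>1[of i] \<mu>1[of j] by (intro disk_denominator_nonzero) auto
    have gram0: "H i j * H 3 3 * (1 - \<mu> i * cnj (\<mu> j)) = H i 3 * H 3 j" for i j
    proof -
      have 12: "H 1 2 * H 3 3 * (1 - \<mu> 1 * cnj (\<mu> 2)) = H 1 3 * H 3 2"
        using m(1) Hii0[of 3] H0(1)[OF iii] by (simp add: \<mu>_def q_def field_simps)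
      then have "cnj (H 1 2 * H 3 3 * (1 - \<mu> 1 * cnj (\<mu> 2))) = cnj (H 1 3 * H 3 2)" by simp
      then have 21: "H 2 1 * H 3 3 * (1 - \<mu> 2 * cnj (\<mu> 1)) = H 2 3 * H 3 1"
        using Hc[of 2 1] Hc[of 3 3] Hc[of 3 1] Hc[of 2 3] by (simp add: mult_ac)
      have 11: "H 1 1 * H 3 3 * (1 - \<mu> 1 * cnj (\<mu> 1)) = H 1 3 * H 3 1"
        using III_facts(3)[OF iii] mm by (simp add: \<mu>_def mult_ac)
      have 22: "H 2 2 * H 3 3 * (1 - \<mu> 2 * cnj (\<mu> 2)) = H 2 3 * H 3 2"
        using III_facts(2)[OF iii] unfolding \<mu>2 by (simp add: mult_ac)
      have \<mu>3: "\<mu> 3 = 0" by (simp add: \<mu>_def)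
      show ?thesis
        using exhaust_3[of i] exhaust_3[of j] 11 12 21 22 by (auto simp: \<mu>3 mult_ac)
    qed
    show ?thesis
    proof (rule tto_of_adjoint_gram[where x=x and y=y and l=l and \<mu>=\<mu> and c=\<kappa>, OF ey dual My _ _ \<mu>1])
      show "cvec_inner (y i) (y j) = \<kappa> i * cnj (\<kappa> j) / (1 - \<mu> i * cnj (\<mu> j))" for i j
      proof -
        have "\<kappa> i * cnj (\<kappa> j) = H i 3 * H 3 j / H 3 3"
          unfolding \<kappa>_def root[symmetric] using Hc[of j 3] by simp
        also have "\<dots> = H i j * (1 - \<mu> i * cnj (\<mu> j))" unfolding gram0[symmetric] using Hii0[of 3] by simp
        finally show ?thesis using den[of i j] by (simp add: H_def)
      qed
      show "\<kappa> i \<noteq> 0" for i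
        using H0[OF iii] Hii0 exhaust_3[of i] \<rho>(1)[of 3] by (auto simp: \<kappa>_def)
      have "\<mu> 1 \<noteq> 0" "\<mu> 3 = 0" using m by (simp_all add: \<mu>_def)
      moreover have "\<mu> 2 \<noteq> 0" using \<mu>2' B1 by auto
      moreover have "\<mu> 1 \<noteq> \<mu> 2"
      \<comment> \<open>Equal nodes would make \<open>y 1\<close> and \<open>y 2\<close> satisfy
        equality in Cauchy-Schwarz, which (iii) turns into \<open>a * cnj a = 1\<close>.\<close>
      proof
        assume e: "\<mu> 1 = \<mu> 2"
        define t where "t = 1 - \<mu> 2 * cnj (\<mu> 2)"
        have t: "t \<noteq> 0" unfolding t_def by (rule den)
        have "(H 1 1 * H 3 3 * t) * (H 2 2 * H 3 3 * t) = (H 1 2 * H 3 3 * t) * (H 2 1 * H 3 3 * t)"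
          using gram0[of 1 1] gram0[of 2 2] gram0[of 1 2] gram0[of 2 1] unfolding e t_def[symmetric] by simp
        then have "H 1 1 * H 2 2 = H 1 2 * H 2 1" using t Hii0[of 3] by simp
        then have "a * cnj a = 1" unfolding III_facts(1)[OF iii] using Hii0 by simp
        then show False using A1 unfolding ABC by simp
      qed
      ultimately have "\<mu> i = \<mu> j \<Longrightarrow> i = j" for i j
        using exhaust_3[of i] exhaust_3[of j] by metis
      then show "inj \<mu>" by (rule injI)
    qed
  qed
  show ?thesis unfolding III_iff using symm_III tto_III III_symm III_tto by blast
qed

end
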